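(* Let $\Lambda$ be an artin algebra and let $M_1$ and $M_2$ be maximal $l$-orthogonal modules in $\operatorname{mod}\Lambda$. Assume that there exists a positive integer $k$ such that $k\leq l\leq 2k+1$ and $M_2\perp_k M_1$. Then (a) $\operatorname{Ext}^i_{F_{M_2}}(M_1,M_1)=(0)$ for $0<i\leq l$; (b) $\operatorname{Ext}^i_{F^{M_1}}(M_2,M_2)=(0)$ for $0<i\leq l$.
   Context: $\operatorname{mod}\Lambda$ is the category of finitely generated left $\Lambda$-modules; $\operatorname{add} M$ is the full subcategory of summands of finite direct sums of copies of $M$. For $X,Y$ in $\operatorname{mod}\Lambda$ write $X\perp_k Y$ if $\operatorname{Ext}^i_\Lambda(X,Y)=(0)$ for $0<i\leq k$. Put $M^{\perp_k}=\{Y\in\operatorname{mod}\Lambda\mid M\perp_k Y\}$ and ${}^{\perp_k}M=\{X\in\operatorname{mod}\Lambda\mid X\perp_k M\}$. $M$ is maximal $l$-orthogonal if $M^{\perp_l}=\operatorname{add}M={}^{\perp_l}M$. Relative homology. For $M$ in $\operatorname{mod}\Lambda$, a short exact sequence $0\to A\to B\to C\to 0$ in $\operatorname{mod}\Lambda$ is $F_M$-exact if $\operatorname{Hom}_\Lambda(M,B)\to\operatorname{Hom}_\Lambda(M,C)\to 0$ is exact, and $F^M$-exact if $\operatorname{Hom}_\Lambda(B,M)\to\operatorname{Hom}_\Lambda(A,M)\to 0$ is exact. These define additive sub-bifunctors $F_M$ and $F^M$ of $\operatorname{Ext}^1_\Lambda(-,-)$. Let $F$ be one of them. A longer exact sequence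 is $F$-exact if all the short exact sequences into which it breaks up are $F$-exact. A module $P$ (resp. $I$) is $F$-projective (resp. $F$-injective) if $\operatorname{Hom}_\Lambda(P,-)$ (resp. $\operatorname{Hom}_\Lambda(-,I)$) is exact on $F$-exact short exact sequences. Every module $C$ has an $F$-projective resolution, i.e. an $F$-exact sequence $\cdots\to P_1\to P_0\to C\to 0$ with all $P_i$ $F$-projective, and dually an $F$-injective resolution. $\operatorname{Ext}^i_F(C,A)$ is the $i$-th cohomology of $\operatorname{Hom}_\Lambda(P_\bullet,A)$ for an $F$-projective resolution $P_\bullet$ of $C$ (equivalently, computed from an $F$-injective resolution of $A$). *)

theory Defs
  imports "HOL-Algebra.Algebra" "HOL-Library.Equipollence"
begin

section \<open>Finitely generated left modules\<close>

text \<open>The library locale \<^locale>\<open>module\<close> requires a commutative ring of scalars. The axioms below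
  are the same, over an arbitrary ring. As usual for the record type \<^typ>\<open>('r, 'm) module\<close>, the
  fields \<^const>\<open>monoid.mult\<close> and \<^const>\<open>one\<close> of a module are irrelevant.\<close>

locale left_module = R?: ring R + M?: abelian_group M
  for R :: "('r, 'a) ring_scheme" (structure) and M :: "('r, 'm, 'b) module_scheme" (structure) +
  assumes smult_closed [simp, intro]:
      "\<lbrakk>a \<in> carrier R; x \<in> carrier M\<rbrakk> \<Longrightarrow> a \<odot>\<^bsub>M\<^esub> x \<in> carrier M"
    and smult_l_distr:
      "\<lbrakk>a \<in> carrier R; b \<in> carrier R; x \<in> carrier M\<rbrakk> \<Longrightarrow>
        (a \<oplus>\<^bsub>R\<^esub> b) \<odot>\<^bsub>M\<^esub> x = a \<odot>\<^bsub>M\<^esub> x \<oplus>\<^bsub>M\<^esub> b \<odot>\<^bsub>M\<^esub> x"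
    and smult_r_distr:
      "\<lbrakk>a \<in> carrier R; x \<in> carrier M; y \<in> carrier M\<rbrakk> \<Longrightarrow>
        a \<odot>\<^bsub>M\<^esub> (x \<oplus>\<^bsub>M\<^esub> y) = a \<odot>\<^bsub>M\<^esub> x \<oplus>\<^bsub>M\<^esub> a \<odot>\<^bsub>M\<^esub> y"
    and smult_assoc1:
      "\<lbrakk>a \<in> carrier R; b \<in> carrier R; x \<in> carrier M\<rbrakk> \<Longrightarrow>
        (a \<otimes>\<^bsub>R\<^esub> b) \<odot>\<^bsub>M\<^esub> x = a \<odot>\<^bsub>M\<^esub> (b \<odot>\<^bsub>M\<^esub> x)"
    and smult_one [simp]:
      "x \<in> carrier M \<Longrightarrow> \<one>\<^bsub>R\<^esub> \<odot>\<^bsub>M\<^esub> x = x"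

definition finitely_generated :: "('r, 'a) ring_scheme \<Rightarrow> ('r, 'm, 'b) module_scheme \<Rightarrow> bool" where
  "finitely_generated R M \<longleftrightarrow>
     (\<exists>S. finite S \<and> S \<subseteq> carrier M \<and>
        (\<forall>x\<in>carrier M. \<exists>a\<in>S \<rightarrow> carrier R. x = (\<Oplus>\<^bsub>M\<^esub>s\<in>S. a s \<odot>\<^bsub>M\<^esub> s)))"

text \<open>The objects of $\mathrm{mod}\,\Lambda$ whose underlying set lives in the type \<^typ>\<open>'m\<close>. If
  \<^typ>\<open>'m\<close> is infinite and at least as large as the carrier of $\Lambda$, then every finitely
  generated left module is isomorphic to one of these, so that they represent all of
  $\mathrm{mod}\,\Lambda$; the existence of sums, kernels, cokernels and resolutions within
  \<^term>\<open>mod_cat \<Lambda>\<close> depends on these two assumptions on the type.\<close>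

definition mod_cat :: "('r, 'a) ring_scheme \<Rightarrow> ('r, 'm) module set" where
  "mod_cat \<Lambda> = {M. left_module \<Lambda> M \<and> finitely_generated \<Lambda> M}"

section \<open>Artin algebras\<close>

definition artinian_ring :: "('k, 'a) ring_scheme \<Rightarrow> bool" where
  "artinian_ring K \<longleftrightarrow> ring K \<and>
     (\<forall>I :: nat \<Rightarrow> 'k set. (\<forall>n. ideal (I n) K) \<and> (\<forall>n. I (Suc n) \<subseteq> I n) \<longrightarrow>
        (\<exists>n. \<forall>m\<ge>n. I m = I n))"

definition restrict_scalars ::
  "('k \<Rightarrow> 'r) \<Rightarrow> ('r, 'a) ring_scheme \<Rightarrow> ('k, 'r) module" where
  "restrict_scalars \<phi> \<Lambda> =
     \<lparr>carrier = carrier \<Lambda>, monoid.mult = monoid.mult \<Lambda>, one = one \<Lambda>, ring.zero = ring.zero \<Lambda>, add = add \<Lambda>,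
      smult = (\<lambda>c x. \<phi> c \<otimes>\<^bsub>\<Lambda>\<^esub> x)\<rparr>"

text \<open>\<^term>\<open>\<Lambda>\<close> is an artin algebra over the commutative artinian ring \<^term>\<open>K\<close>, with structure
  map \<^term>\<open>\<phi>\<close>.\<close>

definition artin_algebra ::
  "('k, 'a) ring_scheme \<Rightarrow> ('k \<Rightarrow> 'r) \<Rightarrow> ('r, 'b) ring_scheme \<Rightarrow> bool" where
  "artin_algebra K \<phi> \<Lambda> \<longleftrightarrow>
     cring K \<and> artinian_ring K \<and> ring \<Lambda> \<and> \<phi> \<in> ring_hom K \<Lambda> \<and>
     (\<forall>c\<in>carrier K. \<forall>x\<in>carrier \<Lambda>. \<phi> c \<otimes>\<^bsub>\<Lambda>\<^esub> x = x \<otimes>\<^bsub>\<Lambda>\<^esub> \<phi> c) \<and>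
     finitely_generated K (restrict_scalars \<phi> \<Lambda>)"

section \<open>Homomorphisms and direct sums\<close>

text \<open>Homomorphisms are \<^const>\<open>extensional\<close> on the carrier, so that equality of functions is
  equality of homomorphisms.\<close>

definition Hom_set ::
  "('r, 'a) ring_scheme \<Rightarrow> ('r, 'm, 'b) module_scheme \<Rightarrow> ('r, 'n, 'c) module_scheme \<Rightarrow> ('m \<Rightarrow> 'n) set"
  where
  "Hom_set \<Lambda> V W =
     {f \<in> carrier V \<rightarrow>\<^sub>E carrier W.
        (\<forall>x\<in>carrier V. \<forall>y\<in>carrier V. f (x \<oplus>\<^bsub>V\<^esub> y) = f x \<oplus>\<^bsub>W\<^esub> f y) \<and>
        (\<forall>a\<in>carrier \<Lambda>. \<forall>x\<in>carrier V. f (a \<odot>\<^bsub>V\<^esub> x) = a \<odot>\<^bsub>W\<^esub> f x)}"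

definition Hom ::
  "('r, 'a) ring_scheme \<Rightarrow> ('r, 'm, 'b) module_scheme \<Rightarrow> ('r, 'n, 'c) module_scheme \<Rightarrow> ('m \<Rightarrow> 'n) monoid"
  where
  "Hom \<Lambda> V W =
     \<lparr>carrier = Hom_set \<Lambda> V W,
      monoid.mult = (\<lambda>f g. \<lambda>x\<in>carrier V. f x \<oplus>\<^bsub>W\<^esub> g x),
      one = (\<lambda>x\<in>carrier V. \<zero>\<^bsub>W\<^esub>)\<rparr>"

definition mod_iso ::
  "('r, 'a) ring_scheme \<Rightarrow> ('r, 'm, 'b) module_scheme \<Rightarrow> ('r, 'n, 'c) module_scheme \<Rightarrow> bool" where
  "mod_iso \<Lambda> V W \<longleftrightarrow> (\<exists>f\<in>Hom_set \<Lambda> V W. bij_betw f (carrier V) (carrier W))"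

definition direct_sum ::
  "('r, 'm, 'b) module_scheme \<Rightarrow> ('r, 'n, 'c) module_scheme \<Rightarrow> ('r, 'm \<times> 'n) module" where
  "direct_sum V W =
     \<lparr>carrier = carrier V \<times> carrier W, monoid.mult = (\<lambda>_ _. undefined), one = undefined,
      ring.zero = (\<zero>\<^bsub>V\<^esub>, \<zero>\<^bsub>W\<^esub>),
      add = (\<lambda>u v. (fst u \<oplus>\<^bsub>V\<^esub> fst v, snd u \<oplus>\<^bsub>W\<^esub> snd v)),
      smult = (\<lambda>a u. (a \<odot>\<^bsub>V\<^esub> fst u, a \<odot>\<^bsub>W\<^esub> snd u))\<rparr>"

definition direct_power :: "nat \<Rightarrow> ('r, 'm, 'b) module_scheme \<Rightarrow> ('r, nat \<Rightarrow> 'm) module" where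
  "direct_power n M =
     \<lparr>carrier = {..<n} \<rightarrow>\<^sub>E carrier M, monoid.mult = (\<lambda>_ _. undefined), one = undefined,
      ring.zero = (\<lambda>i\<in>{..<n}. \<zero>\<^bsub>M\<^esub>),
      add = (\<lambda>u v. \<lambda>i\<in>{..<n}. u i \<oplus>\<^bsub>M\<^esub> v i),
      smult = (\<lambda>a u. \<lambda>i\<in>{..<n}. a \<odot>\<^bsub>M\<^esub> u i)\<rparr>"

definition add_cat :: "('r, 'a) ring_scheme \<Rightarrow> ('r, 'm) module \<Rightarrow> ('r, 'm) module set" where
  "add_cat \<Lambda> M =
     {V \<in> mod_cat \<Lambda>. \<exists>n. \<exists>W \<in> (mod_cat \<Lambda> :: ('r, 'm) module set).
        mod_iso \<Lambda> (direct_sum V W) (direct_power n M)}"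

section \<open>Classes of short exact sequences\<close>

text \<open>A class of short exact sequences $0 \to A \to B \to C \to 0$ in $\mathrm{mod}\,\Lambda$ (such as the
  $F$-exact ones, for a subfunctor $F$ of $\mathrm{Ext}^1$) is a predicate on the modules and the
  two maps.\<close>

type_synonym ('r, 'm) ses_class =
  "('r, 'm) module \<Rightarrow> ('m \<Rightarrow> 'm) \<Rightarrow> ('r, 'm) module \<Rightarrow> ('m \<Rightarrow> 'm) \<Rightarrow> ('r, 'm) module \<Rightarrow> bool"

definition all_ses :: "('r, 'a) ring_scheme \<Rightarrow> ('r, 'm) ses_class" where
  "all_ses \<Lambda> A f B g C \<longleftrightarrow>
     A \<in> mod_cat \<Lambda> \<and> B \<in> mod_cat \<Lambda> \<and> C \<in> mod_cat \<Lambda> \<and>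
     f \<in> Hom_set \<Lambda> A B \<and> g \<in> Hom_set \<Lambda> B C \<and>
     inj_on f (carrier A) \<and> f ` carrier A = a_kernel B C g \<and> g ` carrier B = carrier C"

text \<open>The $F_M$-exact sequences are \<open>F_lower \<Lambda> M\<close>, the $F^M$-exact ones \<open>F_upper \<Lambda> M\<close>.\<close>

definition F_lower :: "('r, 'a) ring_scheme \<Rightarrow> ('r, 'm) module \<Rightarrow> ('r, 'm) ses_class" where
  "F_lower \<Lambda> M A f B g C \<longleftrightarrow>
     all_ses \<Lambda> A f B g C \<and> compose (carrier M) g ` Hom_set \<Lambda> M B = Hom_set \<Lambda> M C"

definition F_upper :: "('r, 'a) ring_scheme \<Rightarrow> ('r, 'm) module \<Rightarrow> ('r, 'm) ses_class" where
  "F_upper \<Lambda> M A f B g C \<longleftrightarrow>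
     all_ses \<Lambda> A f B g C \<and> (\<lambda>h. compose (carrier A) h f) ` Hom_set \<Lambda> B M = Hom_set \<Lambda> A M"

definition F_projective ::
  "('r, 'a) ring_scheme \<Rightarrow> ('r, 'm) ses_class \<Rightarrow> ('r, 'm) module \<Rightarrow> bool" where
  "F_projective \<Lambda> F P \<longleftrightarrow> P \<in> mod_cat \<Lambda> \<and>
     (\<forall>A f B g C. F A f B g C \<longrightarrow>
        short_exact_sequence (Hom \<Lambda> P C) (Hom \<Lambda> P B) (Hom \<Lambda> P A)
          (compose (carrier P) g) (compose (carrier P) f))"

section \<open>Relative Ext\<close>

text \<open>A resolution $\cdots \to P_1 \to P_0 \to C \to 0$ is given by the modules \<^term>\<open>P i\<close> and maps
  \<^term>\<open>d i\<close>, where \<^term>\<open>d 0\<close> is the augmentation $P_0 \to C$ and \<^term>\<open>d (Suc i)\<close> goes from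
  \<^term>\<open>P (Suc i)\<close> to \<^term>\<open>P i\<close>.\<close>

definition res_target ::
  "('r, 'm) module \<Rightarrow> (nat \<Rightarrow> ('r, 'm) module) \<Rightarrow> nat \<Rightarrow> ('r, 'm) module" where
  "res_target C P i = (case i of 0 \<Rightarrow> C | Suc j \<Rightarrow> P j)"

text \<open>The last clause says that the sequences
  $0 \to \mathrm{Ker}\, d_i \to P_i \to \mathrm{Im}\, d_i \to 0$ into which the resolution breaks up are
  $F$-exact.\<close>

definition F_projective_resolution ::
  "('r, 'a) ring_scheme \<Rightarrow> ('r, 'm) ses_class \<Rightarrow> ('r, 'm) module \<Rightarrow>
     (nat \<Rightarrow> ('r, 'm) module) \<Rightarrow> (nat \<Rightarrow> 'm \<Rightarrow> 'm) \<Rightarrow> bool" where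
  "F_projective_resolution \<Lambda> F C P d \<longleftrightarrow>
     (\<forall>i. F_projective \<Lambda> F (P i)) \<and>
     (\<forall>i. d i \<in> Hom_set \<Lambda> (P i) (res_target C P i)) \<and>
     d 0 ` carrier (P 0) = carrier C \<and>
     (\<forall>i. d (Suc i) ` carrier (P (Suc i)) = a_kernel (P i) (res_target C P i) (d i)) \<and>
     (\<forall>i. let K = a_kernel (P i) (res_target C P i) (d i) in
        F ((P i)\<lparr>carrier := K\<rparr>) (\<lambda>x\<in>K. x) (P i)
          (d i) ((res_target C P i)\<lparr>carrier := d i ` carrier (P i)\<rparr>))"

definition Hom_differential ::
  "(nat \<Rightarrow> ('r, 'm) module) \<Rightarrow> (nat \<Rightarrow> 'm \<Rightarrow> 'm) \<Rightarrow> nat \<Rightarrow> ('m \<Rightarrow> 'm) \<Rightarrow> ('m \<Rightarrow> 'm)" where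
  "Hom_differential P d i h = compose (carrier (P (Suc i))) h (d (Suc i))"

definition Hom_cocycles ::
  "('r, 'a) ring_scheme \<Rightarrow> (nat \<Rightarrow> ('r, 'm) module) \<Rightarrow> (nat \<Rightarrow> 'm \<Rightarrow> 'm) \<Rightarrow>
     ('r, 'm) module \<Rightarrow> nat \<Rightarrow> ('m \<Rightarrow> 'm) set" where
  "Hom_cocycles \<Lambda> P d A i =
     kernel (Hom \<Lambda> (P i) A) (Hom \<Lambda> (P (Suc i)) A) (Hom_differential P d i)"

definition Hom_coboundaries ::
  "('r, 'a) ring_scheme \<Rightarrow> (nat \<Rightarrow> ('r, 'm) module) \<Rightarrow> (nat \<Rightarrow> 'm \<Rightarrow> 'm) \<Rightarrow>
     ('r, 'm) module \<Rightarrow> nat \<Rightarrow> ('m \<Rightarrow> 'm) set" where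
  "Hom_coboundaries \<Lambda> P d A i =
     (case i of 0 \<Rightarrow> {\<one>\<^bsub>Hom \<Lambda> (P 0) A\<^esub>}
              | Suc j \<Rightarrow> Hom_differential P d j ` carrier (Hom \<Lambda> (P j) A))"

definition Hom_cohomology ::
  "('r, 'a) ring_scheme \<Rightarrow> (nat \<Rightarrow> ('r, 'm) module) \<Rightarrow> (nat \<Rightarrow> 'm \<Rightarrow> 'm) \<Rightarrow>
     ('r, 'm) module \<Rightarrow> nat \<Rightarrow> ('m \<Rightarrow> 'm) set monoid" where
  "Hom_cohomology \<Lambda> P d A i =
     (Hom \<Lambda> (P i) A)\<lparr>carrier := Hom_cocycles \<Lambda> P d A i\<rparr> Mod Hom_coboundaries \<Lambda> P d A i"

text \<open>$\mathrm{Ext}^i_F(C,A) = 0$. The group $\mathrm{Ext}^i_F(C,A)$ is only determined up to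
  isomorphism, by the choice of an $F$-projective resolution of $C$, so its vanishing is stated
  for all choices. For $F$ given by \<^const>\<open>all_ses\<close>, \<^const>\<open>F_lower\<close> or \<^const>\<open>F_upper\<close> over an
  artin algebra, every module has such a resolution.\<close>

definition Ext_F_zero ::
  "('r, 'a) ring_scheme \<Rightarrow> ('r, 'm) ses_class \<Rightarrow> nat \<Rightarrow> ('r, 'm) module \<Rightarrow> ('r, 'm) module \<Rightarrow> bool"
  where
  "Ext_F_zero \<Lambda> F i C A \<longleftrightarrow>
     (\<forall>P d. F_projective_resolution \<Lambda> F C P d \<longrightarrow> trivial_group (Hom_cohomology \<Lambda> P d A i))"

text \<open>The ordinary $\mathrm{Ext}^i_\Lambda$ is the case where all short exact sequences are
  $F$-exact.\<close>

definition Ext_zero ::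
  "('r, 'a) ring_scheme \<Rightarrow> nat \<Rightarrow> ('r, 'm) module \<Rightarrow> ('r, 'm) module \<Rightarrow> bool" where
  "Ext_zero \<Lambda> i V W \<longleftrightarrow> Ext_F_zero \<Lambda> (all_ses \<Lambda>) i V W"

section \<open>Maximal orthogonal modules\<close>

definition Ext_orthogonal ::
  "('r, 'a) ring_scheme \<Rightarrow> nat \<Rightarrow> ('r, 'm) module \<Rightarrow> ('r, 'm) module \<Rightarrow> bool" where
  "Ext_orthogonal \<Lambda> k V W \<longleftrightarrow> (\<forall>i. 0 < i \<and> i \<le> k \<longrightarrow> Ext_zero \<Lambda> i V W)"

definition right_perp ::
  "('r, 'a) ring_scheme \<Rightarrow> nat \<Rightarrow> ('r, 'm) module \<Rightarrow> ('r, 'm) module set" where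
  "right_perp \<Lambda> k M = {W \<in> mod_cat \<Lambda>. Ext_orthogonal \<Lambda> k M W}"

definition left_perp ::
  "('r, 'a) ring_scheme \<Rightarrow> nat \<Rightarrow> ('r, 'm) module \<Rightarrow> ('r, 'm) module set" where
  "left_perp \<Lambda> k M = {V \<in> mod_cat \<Lambda>. Ext_orthogonal \<Lambda> k V M}"

definition maximal_orthogonal ::
  "('r, 'a) ring_scheme \<Rightarrow> nat \<Rightarrow> ('r, 'm) module \<Rightarrow> bool" where
  "maximal_orthogonal \<Lambda> l M \<longleftrightarrow>
     M \<in> mod_cat \<Lambda> \<and> right_perp \<Lambda> l M = add_cat \<Lambda> M \<and> add_cat \<Lambda> M = left_perp \<Lambda> l M"

end

theory Submission
  imports Defs
begin

text \<open>The vanishing of $\mathrm{Ext}^{n+1}(X,Y)$ means that every map to Y from the syzygy of X of order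
  n + 1 extends to the projective module containing the syzygy. All dimension shifts are carried
  out with this description.

  (a) Let $X_j$ be the syzygies in an $F_{M_2}$-projective resolution of $M_1$, whose terms lie in
  $\mathrm{add}\, M_2$. Dimension shift gives $\mathrm{Ext}^n(M_2, X_j) = 0$ for $0 < n \leq \min(k+j, l)$ and
  $\mathrm{Ext}^n(X_j, M_1) = 0$ for $0 < n$, $n + j \leq \min(l, k+1)$. If $i \leq k+1$, then
  $\mathrm{Ext}^i_F(M_1,M_1)$ embeds into $\mathrm{Ext}^1(X_{i-1}, M_1) = 0$. If $i > k+1 \geq l-k$, then
  $X_{i-1} \in M_2^{\perp_l} = \mathrm{add}\, M_2$, so that the resolution splits at $X_{i-1}$.

  (b) The dual argument uses a coresolution of $M_2$ by left $\mathrm{add}\, M_1$-approximations, which is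
  $F^{M_1}$-exact with $F^{M_1}$-injective terms. A relative dimension shift in the second variable
  connects it with the $F^{M_1}$-projective resolutions by which $\mathrm{Ext}_F$ is defined.\<close>

section \<open>Linear maps, submodules and spans\<close>

text \<open>The artin algebra enters through finiteness over \<open>K\<close>: a commutative
  artinian ring is noetherian, so submodules of finitely generated modules and all groups Hom(V,W)
  are finitely generated over \<open>K\<close>. The first fact keeps kernels in
  \<open>mod_cat \<Lambda>\<close>; the second yields right and left add M approximations, which
  make the relative homology computable. A right approximation is onto because add M contains the
  projective modules. For (b) a left approximation must be injective, so add M has to cogenerate;
  this is the main obstacle, and universal extensions overcome it. In (b) the terms of an
  F^{M_1}-projective resolution stay unknown: only their lifting property and the F^{M_1}-exactness
  of the resolution are used. Vanishing of Ext is quantified over all presentations or resolutions,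
  in hypotheses and conclusions alike, so each step works with the one at hand.\<close>

definition lin ::
  "('r, 'a) ring_scheme \<Rightarrow> ('r, 'm, 'b) module_scheme \<Rightarrow> ('r, 'n, 'c) module_scheme \<Rightarrow> ('m \<Rightarrow> 'n) \<Rightarrow> bool"
  where
  "lin R V W f \<longleftrightarrow>
     (\<forall>x\<in>carrier V. f x \<in> carrier W) \<and>
     (\<forall>x\<in>carrier V. \<forall>y\<in>carrier V. f (x \<oplus>\<^bsub>V\<^esub> y) = f x \<oplus>\<^bsub>W\<^esub> f y) \<and>
     (\<forall>a\<in>carrier R. \<forall>x\<in>carrier V. f (a \<odot>\<^bsub>V\<^esub> x) = a \<odot>\<^bsub>W\<^esub> f x)"

definition submod :: "('r, 'a) ring_scheme \<Rightarrow> ('r, 'm, 'b) module_scheme \<Rightarrow> 'm set \<Rightarrow> bool" where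
  "submod R V N \<longleftrightarrow> N \<subseteq> carrier V \<and> \<zero>\<^bsub>V\<^esub> \<in> N \<and> (\<forall>x\<in>N. \<forall>y\<in>N. x \<oplus>\<^bsub>V\<^esub> y \<in> N) \<and>
     (\<forall>a\<in>carrier R. \<forall>x\<in>N. a \<odot>\<^bsub>V\<^esub> x \<in> N)"

text \<open>An inductive span instead of finite linear combinations: its rule induction replaces
  computations with \<open>finsum\<close>. \<open>gspan_finite\<close> links it to
  \<open>finitely_generated\<close>.\<close>

inductive_set gspan :: "('r, 'a) ring_scheme \<Rightarrow> ('r, 'm, 'b) module_scheme \<Rightarrow> 'm set \<Rightarrow> 'm set"
  for R and V and S where
  zero: "\<zero>\<^bsub>V\<^esub> \<in> gspan R V S"
| base: "x \<in> S \<Longrightarrow> x \<in> gspan R V S"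
| add: "x \<in> gspan R V S \<Longrightarrow> y \<in> gspan R V S \<Longrightarrow> x \<oplus>\<^bsub>V\<^esub> y \<in> gspan R V S"
| smult: "a \<in> carrier R \<Longrightarrow> x \<in> gspan R V S \<Longrightarrow> a \<odot>\<^bsub>V\<^esub> x \<in> gspan R V S"

text \<open>Speaks of a subset of an ambient module, so that kernels, images and submodules are
  handled without changing the carrier.\<close>

definition fg_set :: "('r, 'a) ring_scheme \<Rightarrow> ('r, 'm, 'b) module_scheme \<Rightarrow> 'm set \<Rightarrow> bool" where
  "fg_set R V N \<longleftrightarrow> (\<exists>S. finite S \<and> S \<subseteq> carrier V \<and> N = gspan R V S)"

lemma linD:
  assumes "lin R V W f"
  shows lin_closed: "x \<in> carrier V \<Longrightarrow> f x \<in> carrier W"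
    and lin_add: "x \<in> carrier V \<Longrightarrow> y \<in> carrier V \<Longrightarrow> f (x \<oplus>\<^bsub>V\<^esub> y) = f x \<oplus>\<^bsub>W\<^esub> f y"
    and lin_smult: "a \<in> carrier R \<Longrightarrow> x \<in> carrier V \<Longrightarrow> f (a \<odot>\<^bsub>V\<^esub> x) = a \<odot>\<^bsub>W\<^esub> f x"
  using assms by (auto simp: lin_def)

lemma linI:
  assumes "\<And>x. x \<in> carrier V \<Longrightarrow> f x \<in> carrier W"
    and "\<And>x y. x \<in> carrier V \<Longrightarrow> y \<in> carrier V \<Longrightarrow> f (x \<oplus>\<^bsub>V\<^esub> y) = f x \<oplus>\<^bsub>W\<^esub> f y"
    and "\<And>a x. a \<in> carrier R \<Longrightarrow> x \<in> carrier V \<Longrightarrow> f (a \<odot>\<^bsub>V\<^esub> x) = a \<odot>\<^bsub>W\<^esub> f x"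
  shows "lin R V W f"
  using assms by (auto simp: lin_def)

lemma submodD:
  assumes "submod R V N"
  shows "N \<subseteq> carrier V" "\<zero>\<^bsub>V\<^esub> \<in> N"
    "x \<in> N \<Longrightarrow> y \<in> N \<Longrightarrow> x \<oplus>\<^bsub>V\<^esub> y \<in> N"
    "a \<in> carrier R \<Longrightarrow> x \<in> N \<Longrightarrow> a \<odot>\<^bsub>V\<^esub> x \<in> N"
  using assms by (auto simp: submod_def)

context left_module begin

lemma smult_r_zero [simp]: assumes "a \<in> carrier R" shows "a \<odot>\<^bsub>M\<^esub> \<zero>\<^bsub>M\<^esub> = \<zero>\<^bsub>M\<^esub>"
proof -
  have "a \<odot>\<^bsub>M\<^esub> \<zero>\<^bsub>M\<^esub> \<oplus>\<^bsub>M\<^esub> a \<odot>\<^bsub>M\<^esub> \<zero>\<^bsub>M\<^esub> = a \<odot>\<^bsub>M\<^esub> \<zero>\<^bsub>M\<^esub>"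
    using smult_r_distr[OF assms M.zero_closed M.zero_closed] by simp
  then show ?thesis using assms by (simp add: M.add.r_cancel_one')
qed

lemma smult_l_zero [simp]: assumes "x \<in> carrier M" shows "\<zero>\<^bsub>R\<^esub> \<odot>\<^bsub>M\<^esub> x = \<zero>\<^bsub>M\<^esub>"
proof -
  have "\<zero>\<^bsub>R\<^esub> \<odot>\<^bsub>M\<^esub> x \<oplus>\<^bsub>M\<^esub> \<zero>\<^bsub>R\<^esub> \<odot>\<^bsub>M\<^esub> x = \<zero>\<^bsub>R\<^esub> \<odot>\<^bsub>M\<^esub> x"
    using smult_l_distr[OF R.zero_closed R.zero_closed assms] by simp
  then show ?thesis using assms by (simp add: M.add.r_cancel_one')
qed

lemma smult_l_minus: assumes "a \<in> carrier R" "x \<in> carrier M"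
  shows "(\<ominus>\<^bsub>R\<^esub> a) \<odot>\<^bsub>M\<^esub> x = \<ominus>\<^bsub>M\<^esub> (a \<odot>\<^bsub>M\<^esub> x)"
proof -
  have "(\<ominus>\<^bsub>R\<^esub> a) \<odot>\<^bsub>M\<^esub> x \<oplus>\<^bsub>M\<^esub> a \<odot>\<^bsub>M\<^esub> x = \<zero>\<^bsub>M\<^esub>"
    using smult_l_distr[of "\<ominus>\<^bsub>R\<^esub> a" a x] assms by (simp add: R.l_neg)
  then show ?thesis using assms by (metis M.minus_equality R.a_inv_closed smult_closed)
qed

lemma smult_r_minus: assumes "a \<in> carrier R" "x \<in> carrier M"
  shows "a \<odot>\<^bsub>M\<^esub> (\<ominus>\<^bsub>M\<^esub> x) = \<ominus>\<^bsub>M\<^esub> (a \<odot>\<^bsub>M\<^esub> x)"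
proof -
  have "a \<odot>\<^bsub>M\<^esub> (\<ominus>\<^bsub>M\<^esub> x) \<oplus>\<^bsub>M\<^esub> a \<odot>\<^bsub>M\<^esub> x = \<zero>\<^bsub>M\<^esub>"
    using smult_r_distr[of a "\<ominus>\<^bsub>M\<^esub> x" x] assms by (simp add: M.l_neg)
  then show ?thesis using assms by (metis M.minus_equality M.a_inv_closed smult_closed)
qed

text \<open>From this, submodules inherit closure under negatives, and linear maps compatibility
  with them, out of the scalar action.\<close>

lemma minus_eq_smult: "x \<in> carrier M \<Longrightarrow> \<ominus>\<^bsub>M\<^esub> x = (\<ominus>\<^bsub>R\<^esub> \<one>\<^bsub>R\<^esub>) \<odot>\<^bsub>M\<^esub> x"
  by (simp add: smult_l_minus)

lemma submod_uminus: "submod R M N \<Longrightarrow> x \<in> N \<Longrightarrow> \<ominus>\<^bsub>M\<^esub> x \<in> N"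
  using submodD[of R M N] by (metis R.a_inv_closed R.one_closed minus_eq_smult subsetD)

lemma submod_minus: "submod R M N \<Longrightarrow> x \<in> N \<Longrightarrow> y \<in> N \<Longrightarrow> x \<ominus>\<^bsub>M\<^esub> y \<in> N"
  using submod_uminus submodD(3)[of R M N] by (simp add: M.minus_eq)

lemma submod_carrier: "submod R M (carrier M)"
  by (auto simp: submod_def)

lemma submod_zero: "submod R M {\<zero>\<^bsub>M\<^esub>}"
  by (auto simp: submod_def)

lemma submod_left_module:
  assumes "submod R M N" shows "left_module R (M\<lparr>carrier := N\<rparr>)"
proof -
  note sub = submodD[OF assms]
  have car: "x \<in> N \<Longrightarrow> x \<in> carrier M" for x using sub(1) by blast
  have "abelian_group (M\<lparr>carrier := N\<rparr>)"
  proof (rule abelian_groupI)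
    fix x assume "x \<in> carrier (M\<lparr>carrier := N\<rparr>)"
    then show "\<exists>y\<in>carrier (M\<lparr>carrier := N\<rparr>). y \<oplus>\<^bsub>M\<lparr>carrier := N\<rparr>\<^esub> x = \<zero>\<^bsub>M\<lparr>carrier := N\<rparr>\<^esub>"
      using submod_uminus[OF assms] by (auto intro!: bexI[of _ "\<ominus>\<^bsub>M\<^esub> x"] simp: M.l_neg car)
  qed (use sub car in \<open>auto simp: M.a_ac\<close>)
  then show ?thesis
    using sub car R.ring_axioms
    by (intro left_module.intro left_module_axioms.intro)
      (auto simp: smult_l_distr smult_r_distr smult_assoc1)
qed

lemma gspan_closed: "S \<subseteq> carrier M \<Longrightarrow> x \<in> gspan R M S \<Longrightarrow> x \<in> carrier M"
  by (erule gspan.induct) auto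

lemma gspan_submod: "S \<subseteq> carrier M \<Longrightarrow> submod R M (gspan R M S)"
  using gspan_closed by (auto simp: submod_def intro: gspan.intros)

lemma diff_eq_zero_iff: "x \<in> carrier M \<Longrightarrow> y \<in> carrier M \<Longrightarrow> x \<ominus>\<^bsub>M\<^esub> y = \<zero>\<^bsub>M\<^esub> \<longleftrightarrow> x = y"
  by (metis M.minus_equality M.minus_eq M.minus_minus M.r_neg M.a_inv_closed)

lemma diff_add_cancel: "x \<in> carrier M \<Longrightarrow> y \<in> carrier M \<Longrightarrow> (x \<ominus>\<^bsub>M\<^esub> y) \<oplus>\<^bsub>M\<^esub> y = x"
  by (simp add: M.minus_eq M.a_assoc M.l_neg)

lemma add_diff_cancel: "x \<in> carrier M \<Longrightarrow> y \<in> carrier M \<Longrightarrow> (x \<oplus>\<^bsub>M\<^esub> y) \<ominus>\<^bsub>M\<^esub> y = x"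
  by (simp add: M.minus_eq M.a_assoc M.r_neg)

lemma diff_diff_cancel: "x \<in> carrier M \<Longrightarrow> y \<in> carrier M \<Longrightarrow> x \<ominus>\<^bsub>M\<^esub> (x \<ominus>\<^bsub>M\<^esub> y) = y"
  by (metis M.minus_closed add_diff_cancel diff_add_cancel M.a_comm)

lemma diff_zero [simp]: "x \<in> carrier M \<Longrightarrow> x \<ominus>\<^bsub>M\<^esub> \<zero>\<^bsub>M\<^esub> = x"
  by (simp add: M.minus_eq)

lemma add_diff_add:
  "x \<in> carrier M \<Longrightarrow> y \<in> carrier M \<Longrightarrow> z \<in> carrier M \<Longrightarrow> w \<in> carrier M \<Longrightarrow>
   (x \<oplus>\<^bsub>M\<^esub> y) \<ominus>\<^bsub>M\<^esub> (z \<oplus>\<^bsub>M\<^esub> w) = (x \<ominus>\<^bsub>M\<^esub> z) \<oplus>\<^bsub>M\<^esub> (y \<ominus>\<^bsub>M\<^esub> w)"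
  by (simp add: M.minus_eq M.minus_add M.a_ac)

lemma smult_diff:
  "a \<in> carrier R \<Longrightarrow> x \<in> carrier M \<Longrightarrow> y \<in> carrier M \<Longrightarrow>
   a \<odot>\<^bsub>M\<^esub> (x \<ominus>\<^bsub>M\<^esub> y) = a \<odot>\<^bsub>M\<^esub> x \<ominus>\<^bsub>M\<^esub> a \<odot>\<^bsub>M\<^esub> y"
  by (simp add: M.minus_eq smult_r_distr smult_r_minus)

end

lemma gspan_least:
  assumes "submod R V N" "S \<subseteq> N" shows "gspan R V S \<subseteq> N"
proof
  fix x assume "x \<in> gspan R V S"
  then show "x \<in> N" by induct (use assms in \<open>auto simp: submod_def\<close>)
qed

lemma gspan_mono: "S \<subseteq> T \<Longrightarrow> gspan R V S \<subseteq> gspan R V T"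
proof
  fix x assume "S \<subseteq> T" "x \<in> gspan R V S"
  from this(2) show "x \<in> gspan R V T" by induct (use \<open>S \<subseteq> T\<close> in \<open>auto intro: gspan.intros\<close>)
qed

text \<open>The span depends on the operations alone. So generators of a submodule inside the
  ambient module also generate it as a module in its own right.\<close>

lemma gspan_carrier_update [simp]: "gspan R (V\<lparr>carrier := N\<rparr>) S = gspan R V S"
proof (intro subset_antisym subsetI)
  fix x assume "x \<in> gspan R (V\<lparr>carrier := N\<rparr>) S"
  then show "x \<in> gspan R V S"
    by induct (auto intro: gspan.intros)
next
  fix x assume "x \<in> gspan R V S"
  then show "x \<in> gspan R (V\<lparr>carrier := N\<rparr>) S"
  proof induct
    case zero then show ?case using gspan.zero[of "V\<lparr>carrier := N\<rparr>"] by simp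
  next
    case (add x y) then show ?case using gspan.add[of x R "V\<lparr>carrier := N\<rparr>"] by simp
  next
    case (smult a x) then show ?case using gspan.smult[of a R x "V\<lparr>carrier := N\<rparr>"] by simp
  qed (rule gspan.base)
qed

context
  fixes R :: "('r, 'a) ring_scheme" and V :: "('r, 'm, 'b) module_scheme"
    and W :: "('r, 'n, 'c) module_scheme" and f
  assumes V: "left_module R V" and W: "left_module R W" and f: "lin R V W f"
begin

interpretation V: left_module R V by (rule V)
interpretation W: left_module R W by (rule W)

lemma lin_zero: "f \<zero>\<^bsub>V\<^esub> = \<zero>\<^bsub>W\<^esub>"
  using lin_smult[OF f, of "\<zero>\<^bsub>R\<^esub>" "\<zero>\<^bsub>V\<^esub>"] lin_closed[OF f, of "\<zero>\<^bsub>V\<^esub>"] by simp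

lemma lin_uminus: "x \<in> carrier V \<Longrightarrow> f (\<ominus>\<^bsub>V\<^esub> x) = \<ominus>\<^bsub>W\<^esub> f x"
  using lin_smult[OF f, of "\<ominus>\<^bsub>R\<^esub> \<one>\<^bsub>R\<^esub>" x] lin_closed[OF f, of x]
  by (simp add: V.minus_eq_smult W.minus_eq_smult)

lemma lin_minus: "x \<in> carrier V \<Longrightarrow> y \<in> carrier V \<Longrightarrow> f (x \<ominus>\<^bsub>V\<^esub> y) = f x \<ominus>\<^bsub>W\<^esub> f y"
  by (simp add: V.M.minus_eq W.M.minus_eq lin_add[OF f] lin_uminus)

lemma lin_inj_iff: "inj_on f (carrier V) \<longleftrightarrow> (\<forall>x\<in>carrier V. f x = \<zero>\<^bsub>W\<^esub> \<longrightarrow> x = \<zero>\<^bsub>V\<^esub>)"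
proof
  assume "inj_on f (carrier V)"
  then show "\<forall>x\<in>carrier V. f x = \<zero>\<^bsub>W\<^esub> \<longrightarrow> x = \<zero>\<^bsub>V\<^esub>"
    by (metis V.M.zero_closed inj_onD lin_zero)
next
  assume *: "\<forall>x\<in>carrier V. f x = \<zero>\<^bsub>W\<^esub> \<longrightarrow> x = \<zero>\<^bsub>V\<^esub>"
  show "inj_on f (carrier V)"
  proof (rule inj_onI)
    fix x y assume xy: "x \<in> carrier V" "y \<in> carrier V" "f x = f y"
    then have "f (x \<ominus>\<^bsub>V\<^esub> y) = \<zero>\<^bsub>W\<^esub>"
      using lin_closed[OF f] by (simp add: lin_minus W.diff_eq_zero_iff)
    then show "x = y" using * xy V.diff_eq_zero_iff V.M.minus_closed by blast
  qed
qed

lemma lin_kernel_submod: "submod R V {x \<in> carrier V. f x = \<zero>\<^bsub>W\<^esub>}"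
  by (auto simp: submod_def lin_zero lin_add[OF f] lin_smult[OF f])

lemma lin_image_submod: assumes "submod R V N" shows "submod R W (f ` N)"
proof -
  note sub = submodD[OF assms]
  have car: "x \<in> N \<Longrightarrow> x \<in> carrier V" for x using sub(1) by blast
  show ?thesis unfolding submod_def
  proof (intro conjI ballI)
    show "f ` N \<subseteq> carrier W" using car lin_closed[OF f] by blast
    show "\<zero>\<^bsub>W\<^esub> \<in> f ` N" using sub(2) lin_zero by (metis imageI)
    fix x assume "x \<in> f ` N"
    then obtain u where u: "u \<in> N" "x = f u" by blast
    { fix y assume "y \<in> f ` N"
      then obtain v where v: "v \<in> N" "y = f v" by blast
      show "x \<oplus>\<^bsub>W\<^esub> y \<in> f ` N"
        using u v sub(3) car by (metis imageI lin_add[OF f]) }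
    fix a assume "a \<in> carrier R"
    then show "a \<odot>\<^bsub>W\<^esub> x \<in> f ` N"
      using u sub(4) car by (metis imageI lin_smult[OF f])
  qed
qed

lemma lin_image_gspan: assumes S: "S \<subseteq> carrier V" shows "f ` gspan R V S = gspan R W (f ` S)"
proof (intro subset_antisym)
  show "gspan R W (f ` S) \<subseteq> f ` gspan R V S"
    using lin_image_submod[OF V.gspan_submod[OF S]]
    by (rule gspan_least) (auto intro: gspan.base)
  show "f ` gspan R V S \<subseteq> gspan R W (f ` S)"
  proof
    fix y assume "y \<in> f ` gspan R V S"
    then obtain x where x: "x \<in> gspan R V S" "y = f x" by blast
    from x(1) have "f x \<in> gspan R W (f ` S)"
    proof induct
      case (add x y) then show ?case
        using lin_add[OF f] V.gspan_closed[OF S] by (simp add: gspan.add)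
    next
      case (smult a x) then show ?case
        using lin_smult[OF f] V.gspan_closed[OF S] by (simp add: gspan.smult)
    qed (auto simp: lin_zero intro: gspan.intros)
    then show "y \<in> gspan R W (f ` S)" using x by simp
  qed
qed

lemma fg_set_image: "fg_set R V N \<Longrightarrow> fg_set R W (f ` N)"
  unfolding fg_set_def using lin_image_gspan lin_closed[OF f]
  by (metis finite_imageI image_subset_iff subset_iff)

text \<open>Generators of the kernel together with preimages of generators of the image suffice:
  subtracting from an element of \<open>N\<close> a combination of these preimages with the same
  value under \<open>f\<close> leaves an element of the kernel.\<close>

lemma fg_set_extension:
  assumes N: "submod R V N"
    and ker: "fg_set R V {x \<in> N. f x = \<zero>\<^bsub>W\<^esub>}" and im: "fg_set R W (f ` N)"
  shows "fg_set R V N"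
proof -
  note sub = submodD[OF N]
  have car: "x \<in> N \<Longrightarrow> x \<in> carrier V" for x using sub(1) by blast
  obtain S where S: "finite S" "S \<subseteq> carrier V" "{x \<in> N. f x = \<zero>\<^bsub>W\<^esub>} = gspan R V S"
    using ker by (auto simp: fg_set_def)
  obtain T where T: "finite T" "T \<subseteq> carrier W" "f ` N = gspan R W T"
    using im by (auto simp: fg_set_def)
  have "T \<subseteq> f ` N" unfolding T(3) by (auto intro: gspan.base)
  then obtain U where U: "U \<subseteq> N" "finite U" "T = f ` U"
    using T(1) by (meson finite_subset_image)
  have UV: "U \<subseteq> carrier V" using U car by blast
  have SN: "S \<subseteq> N" using S(3) gspan.base[of _ S] by blast
  have "N = gspan R V (S \<union> U)"
  proof
    show "gspan R V (S \<union> U) \<subseteq> N" by (rule gspan_least[OF N]) (use SN U in auto)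
    show "N \<subseteq> gspan R V (S \<union> U)"
    proof
      fix x assume x: "x \<in> N"
      then have "f x \<in> f ` gspan R V U"
        using T(3) U(3) lin_image_gspan[OF UV] by blast
      then obtain u where u: "u \<in> gspan R V U" "f x = f u" by blast
      have uN: "u \<in> N" using u gspan_least[OF N U(1)] by blast
      have "x \<ominus>\<^bsub>V\<^esub> u \<in> gspan R V S"
        unfolding S(3)[symmetric] using u uN x car V.submod_minus[OF N] lin_closed[OF f]
        by (simp add: lin_minus W.diff_eq_zero_iff)
      then have "x \<ominus>\<^bsub>V\<^esub> u \<in> gspan R V (S \<union> U)" using gspan_mono[of S "S \<union> U"] by blast
      moreover have "u \<in> gspan R V (S \<union> U)" using u gspan_mono[of U "S \<union> U"] by blast
      ultimately have "(x \<ominus>\<^bsub>V\<^esub> u) \<oplus>\<^bsub>V\<^esub> u \<in> gspan R V (S \<union> U)" by (rule gspan.add)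
      then show "x \<in> gspan R V (S \<union> U)" using x uN car by (simp add: V.diff_add_cancel)
    qed
  qed
  then show ?thesis using S U UV by (auto simp: fg_set_def intro!: exI[of _ "S \<union> U"])
qed

end

text \<open>The linear combinations over a finite \<open>S\<close> contain 0 and \<open>S\<close>
  and are closed under sums and multiples, so rule induction stays inside them; conversely every
  partial sum lies in the span.\<close>

lemma (in left_module) gspan_finite:
  assumes "finite S" "S \<subseteq> carrier M"
  shows "gspan R M S = {x. \<exists>a\<in>S \<rightarrow> carrier R. x = (\<Oplus>\<^bsub>M\<^esub>s\<in>S. a s \<odot>\<^bsub>M\<^esub> s)}" (is "_ = ?C")
proof (intro subset_antisym subsetI)
  fix x assume "x \<in> ?C"
  then obtain a where a: "a \<in> S \<rightarrow> carrier R" "x = (\<Oplus>\<^bsub>M\<^esub>s\<in>S. a s \<odot>\<^bsub>M\<^esub> s)" by blast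
  have "T \<subseteq> S \<Longrightarrow> (\<Oplus>\<^bsub>M\<^esub>s\<in>T. a s \<odot>\<^bsub>M\<^esub> s) \<in> gspan R M S" if "finite T" for T using that
  proof (induct T)
    case (insert t T)
    have "(\<lambda>s. a s \<odot>\<^bsub>M\<^esub> s) \<in> T \<rightarrow> carrier M" "a t \<odot>\<^bsub>M\<^esub> t \<in> carrier M" "a t \<in> carrier R"
      using insert a assms by auto
    then show ?case using insert by (auto simp: M.finsum_insert intro!: gspan.add gspan.smult intro: gspan.base)
  qed (simp add: gspan.zero)
  then show "x \<in> gspan R M S" using a assms by blast
next
  have car: "(\<lambda>s. a s \<odot>\<^bsub>M\<^esub> s) \<in> S \<rightarrow> carrier M" if "a \<in> S \<rightarrow> carrier R" for a
    using that assms by auto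
  have sm: "c \<odot>\<^bsub>M\<^esub> (\<Oplus>\<^bsub>M\<^esub>s\<in>T. a s \<odot>\<^bsub>M\<^esub> s) = (\<Oplus>\<^bsub>M\<^esub>s\<in>T. (c \<otimes>\<^bsub>R\<^esub> a s) \<odot>\<^bsub>M\<^esub> s)"
    if "finite T" "T \<subseteq> S" "a \<in> S \<rightarrow> carrier R" "c \<in> carrier R" for T a c
    using that
  proof (induct T)
    case (insert t T)
    have "(\<lambda>s. a s \<odot>\<^bsub>M\<^esub> s) \<in> T \<rightarrow> carrier M" "(\<lambda>s. (c \<otimes>\<^bsub>R\<^esub> a s) \<odot>\<^bsub>M\<^esub> s) \<in> T \<rightarrow> carrier M"
      "a t \<in> carrier R" "t \<in> carrier M"
      using insert assms by (auto intro!: smult_closed R.m_closed)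
    then show ?case using insert by (simp add: M.finsum_insert smult_r_distr smult_assoc1)
  qed simp
  fix x assume "x \<in> gspan R M S"
  then show "x \<in> ?C"
  proof induct
    case zero
    have "(\<Oplus>\<^bsub>M\<^esub>s\<in>S. \<zero>\<^bsub>R\<^esub> \<odot>\<^bsub>M\<^esub> s) = (\<Oplus>\<^bsub>M\<^esub>s\<in>S. \<zero>\<^bsub>M\<^esub>)"
      by (rule M.finsum_cong') (use assms in auto)
    then show ?case by (auto intro!: bexI[of _ "\<lambda>_. \<zero>\<^bsub>R\<^esub>"])
  next
    case (base x)
    have "(\<Oplus>\<^bsub>M\<^esub>s\<in>S. (if s = x then \<one>\<^bsub>R\<^esub> else \<zero>\<^bsub>R\<^esub>) \<odot>\<^bsub>M\<^esub> s)
        = (\<Oplus>\<^bsub>M\<^esub>s\<in>S. if s = x then s else \<zero>\<^bsub>M\<^esub>)"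
      by (rule M.finsum_cong') (use assms in auto)
    also have "\<dots> = x"
      using base assms M.add.finprod_singleton_swap[of x S "\<lambda>x. x"] by auto
    finally show ?case
      by (auto intro!: bexI[of _ "\<lambda>s. if s = x then \<one>\<^bsub>R\<^esub> else \<zero>\<^bsub>R\<^esub>"])
  next
    case (add x y)
    then obtain a b where ab: "a \<in> S \<rightarrow> carrier R" "b \<in> S \<rightarrow> carrier R"
      "x = (\<Oplus>\<^bsub>M\<^esub>s\<in>S. a s \<odot>\<^bsub>M\<^esub> s)" "y = (\<Oplus>\<^bsub>M\<^esub>s\<in>S. b s \<odot>\<^bsub>M\<^esub> s)" by blast
    have "x \<oplus>\<^bsub>M\<^esub> y = (\<Oplus>\<^bsub>M\<^esub>s\<in>S. a s \<odot>\<^bsub>M\<^esub> s \<oplus>\<^bsub>M\<^esub> b s \<odot>\<^bsub>M\<^esub> s)"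
      using ab car by (simp add: M.finsum_addf)
    also have "\<dots> = (\<Oplus>\<^bsub>M\<^esub>s\<in>S. (a s \<oplus>\<^bsub>R\<^esub> b s) \<odot>\<^bsub>M\<^esub> s)"
    proof (rule M.finsum_cong')
      fix i assume "i \<in> S"
      then have "a i \<in> carrier R" "b i \<in> carrier R" "i \<in> carrier M" using ab assms by auto
      then show "a i \<odot>\<^bsub>M\<^esub> i \<oplus>\<^bsub>M\<^esub> b i \<odot>\<^bsub>M\<^esub> i = (a i \<oplus>\<^bsub>R\<^esub> b i) \<odot>\<^bsub>M\<^esub> i"
        by (simp add: smult_l_distr)
    qed (use ab assms in auto)
    finally show ?case using ab by (auto intro!: bexI[of _ "\<lambda>s. a s \<oplus>\<^bsub>R\<^esub> b s"])
  next
    case (smult c x)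
    then obtain a where "a \<in> S \<rightarrow> carrier R" "x = (\<Oplus>\<^bsub>M\<^esub>s\<in>S. a s \<odot>\<^bsub>M\<^esub> s)" by blast
    then show ?case using sm[of S a c] assms smult
      by (auto intro!: bexI[of _ "\<lambda>s. c \<otimes>\<^bsub>R\<^esub> a s"])
  qed
qed

lemma (in left_module) finitely_generated_iff_fg_set:
  "finitely_generated R M \<longleftrightarrow> fg_set R M (carrier M)"
proof
  assume "finitely_generated R M"
  then obtain S where S: "finite S" "S \<subseteq> carrier M"
    "\<forall>x\<in>carrier M. \<exists>a\<in>S \<rightarrow> carrier R. x = (\<Oplus>\<^bsub>M\<^esub>s\<in>S. a s \<odot>\<^bsub>M\<^esub> s)"
    by (auto simp: finitely_generated_def)
  then have "carrier M = gspan R M S"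
    using gspan_finite[OF S(1,2)] gspan_closed[OF S(2)] by blast
  then show "fg_set R M (carrier M)" using S by (auto simp: fg_set_def)
next
  assume "fg_set R M (carrier M)"
  then obtain S where S: "finite S" "S \<subseteq> carrier M" "carrier M = gspan R M S"
    by (auto simp: fg_set_def)
  then show "finitely_generated R M"
    using gspan_finite[OF S(1,2)] by (auto simp: finitely_generated_def)
qed

lemma mod_cat_iff_fg_set:
  "V \<in> mod_cat R \<longleftrightarrow> left_module R V \<and> fg_set R V (carrier V)"
  using left_module.finitely_generated_iff_fg_set by (auto simp: mod_cat_def)

section \<open>Finiteness over a commutative artinian ring\<close>

definition noetherian_module :: "('r, 'a) ring_scheme \<Rightarrow> ('r, 'm, 'b) module_scheme \<Rightarrow> bool" where
  "noetherian_module R V \<longleftrightarrow> (\<forall>N. submod R V N \<longrightarrow> fg_set R V N)"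

definition regular_module :: "('r, 'a) ring_scheme \<Rightarrow> ('r, 'r) module" where
  "regular_module R =
     \<lparr>carrier = carrier R, monoid.mult = monoid.mult R, one = one R, ring.zero = ring.zero R,
      add = add R, smult = monoid.mult R\<rparr>"

lemma regular_module_simps [simp]:
  "carrier (regular_module R) = carrier R" "ring.zero (regular_module R) = ring.zero R"
  "add (regular_module R) = add R" "smult (regular_module R) = monoid.mult R"
  by (simp_all add: regular_module_def)

lemma abelian_group_cong:
  assumes "abelian_group G" "carrier H = carrier G" "ring.zero H = ring.zero G" "add H = add G"
  shows "abelian_group H"
proof -
  interpret abelian_group G by (rule assms)
  show ?thesis
  proof (rule abelian_groupI)
    fix x assume "x \<in> carrier H"
    then show "\<exists>y\<in>carrier H. y \<oplus>\<^bsub>H\<^esub> x = \<zero>\<^bsub>H\<^esub>"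
      using l_neg[of x] a_inv_closed[of x] unfolding assms(2-4) by blast
  qed (unfold assms(2-4), auto simp: a_ac)
qed

lemma (in ring) regular_left_module: "left_module R (regular_module R)"
  by (intro left_module.intro left_module_axioms.intro ring_axioms
      abelian_group_cong[OF abelian_group_axioms]) (auto simp: l_distr r_distr m_assoc)

text \<open>Turns the descending chain condition of \<open>artinian_ring\<close>, which is about
  ideals, into one about submodules of the regular module. Commutativity makes closure under the
  left action an absorption on both sides.\<close>

lemma (in cring) ideal_iff_submod: "ideal I R \<longleftrightarrow> submod R (regular_module R) I"
proof
  assume "ideal I R"
  then interpret ideal I R .
  show "submod R (regular_module R) I"
    using a_subset zero_closed a_closed I_l_closed by (auto simp: submod_def)
next
  interpret V: left_module R "regular_module R" by (rule regular_left_module)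
  assume I: "submod R (regular_module R) I"
  note sub = submodD[OF I, simplified]
  have mi: "\<ominus> x \<in> I" if "x \<in> I" for x
  proof -
    have "\<ominus> x = (\<ominus> \<one>) \<otimes> x" using that sub(1) by (simp add: l_minus subset_iff)
    then show ?thesis using sub(4)[of "\<ominus> \<one>" x] that by simp
  qed
  have "subgroup I (add_monoid R)"
    by (rule add.subgroupI) (use sub mi in \<open>auto simp: a_inv_def\<close>)
  moreover have "x \<otimes> a \<in> I" if "a \<in> I" "x \<in> carrier R" for a x using that sub by simp
  moreover from this have "a \<otimes> x \<in> I" if "a \<in> I" "x \<in> carrier R" for a x
    using that sub(1) m_comm[of a x] by auto
  ultimately show "ideal I R" by (intro idealI ring_axioms) auto
qed

context cring begin

interpretation V: left_module R "regular_module R" by (rule regular_left_module)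

text \<open>Let I be minimal among the ideals that are not finitely generated. For each scalar a either
  a I = I or a I = 0, so that I is a vector space over a residue field of R. All its proper
  subspaces are finite dimensional, and a complement of a line is one of them.\<close>

lemma artinian_imp_noetherian:
  assumes art: "artinian_ring R"
  shows "noetherian_module R (regular_module R)"
proof (rule ccontr)
  let ?V = "regular_module R"
  have DCC: "\<exists>n. \<forall>m\<ge>n. J m = J n" if "\<And>n::nat. submod R ?V (J n)" "\<And>n. J (Suc n) \<subseteq> J n" for J
    using art that unfolding artinian_ring_def ideal_iff_submod by blast
  assume "\<not> noetherian_module R ?V"
  then obtain I0 where I0: "submod R ?V I0" "\<not> fg_set R ?V I0"
    by (auto simp: noetherian_module_def)
  \<comment> \<open>A submodule minimal among those that are not finitely generated: otherwise
    \<open>next_I\<close> iterates to a strictly descending chain.\<close>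
  have "\<exists>I. submod R ?V I \<and> \<not> fg_set R ?V I \<and> (\<forall>J. submod R ?V J \<and> J \<subset> I \<longrightarrow> fg_set R ?V J)"
  proof (rule ccontr)
    assume neg: "\<not> ?thesis"
    define next_I where "next_I I = (SOME J. submod R ?V J \<and> \<not> fg_set R ?V J \<and> J \<subset> I)" for I
    have nx: "submod R ?V (next_I I) \<and> \<not> fg_set R ?V (next_I I) \<and> next_I I \<subset> I"
      if "submod R ?V I" "\<not> fg_set R ?V I" for I
      unfolding next_I_def by (rule someI_ex) (use neg that in blast)
    define J where "J n = (next_I ^^ n) I0" for n
    have J: "submod R ?V (J n) \<and> \<not> fg_set R ?V (J n)" for n
      by (induct n) (use I0 nx in \<open>auto simp: J_def\<close>)
    have "J (Suc n) \<subset> J n" for n using nx J by (simp add: J_def)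
    moreover from this obtain n where "\<forall>m\<ge>n. J m = J n" using DCC[of J] J by blast
    ultimately show False by (metis le_SucI le_refl psubset_eq)
  qed
  then obtain I where I: "submod R ?V I" and nfg: "\<not> fg_set R ?V I"
    and minI: "\<And>J. submod R ?V J \<Longrightarrow> J \<subset> I \<Longrightarrow> fg_set R ?V J" by blast
  note sub = submodD[OF I, simplified]
  have Icar: "x \<in> I \<Longrightarrow> x \<in> carrier R" for x using sub(1) by blast
  have lin_mult: "lin R ?V ?V (\<lambda>x. a \<otimes> x)" if "a \<in> carrier R" for a
    using that by (auto simp: lin_def r_distr m_lcomm)
  \<comment> \<open>If neither holds, kernel and image of multiplication by \<open>a\<close> on
    \<open>I\<close> are proper submodules of \<open>I\<close>, hence finitely generated, and so is
    \<open>I\<close> by \<open>fg_set_extension\<close>.\<close>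
  have dichotomy: "(\<forall>x\<in>I. a \<otimes> x = \<zero>) \<or> (\<lambda>x. a \<otimes> x) ` I = I" if a: "a \<in> carrier R" for a
  proof (rule ccontr)
    assume neg: "\<not> ?thesis"
    let ?K = "{x \<in> I. a \<otimes> x = \<zero>}" and ?J = "(\<lambda>x. a \<otimes> x) ` I"
    have "submod R ?V ?K"
      using sub Icar a by (auto simp: submod_def r_distr m_lcomm)
    moreover have "?K \<subset> I" using neg by blast
    moreover have "submod R ?V ?J"
      by (rule lin_image_submod[OF V.left_module_axioms V.left_module_axioms lin_mult[OF a] I])
    moreover have "?J \<subset> I" using neg sub(4) a by auto
    ultimately have "fg_set R ?V I"
      using fg_set_extension[OF V.left_module_axioms V.left_module_axioms lin_mult[OF a] I] minI
      by simp
    then show False using nfg by blast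
  qed
  have inv: "\<exists>b\<in>carrier R. \<forall>x\<in>I. (b \<otimes> a) \<otimes> x = x"
    if a: "a \<in> carrier R" and na: "\<not> (\<forall>x\<in>I. a \<otimes> x = \<zero>)" for a
  proof -
    \<comment> \<open>The chain of ideals a^n R becomes stationary, so that a^n = a^(n+1) b for some
      \<open>b\<close>. As a^n maps \<open>I\<close> onto itself, \<open>b\<close> inverts
      \<open>a\<close> on \<open>I\<close>.\<close>
    define J where "J n = (\<lambda>c. (a [^] n) \<otimes> c) ` carrier R" for n :: nat
    have "submod R ?V (J n)" for n
      unfolding J_def
      using lin_image_submod[OF V.left_module_axioms V.left_module_axioms lin_mult V.submod_carrier,
          of "a [^] n"] a by simp
    moreover have "J (Suc n) \<subseteq> J n" for n
      unfolding J_def using a by (auto simp: m_assoc)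
    ultimately obtain n where "J (Suc n) = J n" using DCC[of J] by (metis le_SucI le_refl)
    moreover have "a [^] n \<in> J n" unfolding J_def using a by (auto intro!: image_eqI[of _ _ \<one>])
    ultimately obtain b where b: "b \<in> carrier R" "a [^] n = a [^] (Suc n) \<otimes> b"
      by (auto simp: J_def)
    have surj: "x \<in> I \<Longrightarrow> \<exists>y\<in>I. x = a [^] m \<otimes> y" for x and m :: nat
    proof (induct m arbitrary: x)
      case 0 then show ?case using Icar by auto
    next
      case (Suc m)
      from dichotomy[OF a] na Suc(2) obtain y where y: "y \<in> I" "x = a \<otimes> y" by blast
      with Suc(1)[of y] obtain z where "z \<in> I" "y = a [^] m \<otimes> z" by blast
      with y show ?case using a Icar by (auto simp: m_ac intro!: bexI[of _ z])
    qed
    have "(b \<otimes> a) \<otimes> x = x" if x: "x \<in> I" for x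
    proof -
      obtain y where y: "y \<in> I" "x = a [^] n \<otimes> y" using surj[OF x] by blast
      have "(b \<otimes> a) \<otimes> (p \<otimes> y) = ((p \<otimes> a) \<otimes> b) \<otimes> y" if "p \<in> carrier R" for p
        using that a b(1) Icar[OF y(1)] by (simp add: m_ac)
      from this[of "a [^] n"] have "(b \<otimes> a) \<otimes> (a [^] n \<otimes> y) = (a [^] (Suc n) \<otimes> b) \<otimes> y"
        using a by simp
      then show ?thesis unfolding y(2) b(2)[symmetric] .
    qed
    with b show ?thesis by blast
  qed
  have "fg_set R ?V {\<zero>}"
  proof -
    have "gspan R ?V {} = {\<zero>}"
      using gspan_least[OF V.submod_zero, of "{}"] gspan.zero[of ?V R "{}"] by auto
    then show ?thesis by (auto simp: fg_set_def intro!: exI[of _ "{}"])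
  qed
  then have "I \<noteq> {\<zero>}" using nfg by blast
  then obtain x where x: "x \<in> I" "x \<noteq> \<zero>" using sub(2) by blast
  \<comment> \<open>A maximal submodule \<open>J\<close> of \<open>I\<close> that avoids
    \<open>x\<close> is a complement of the line through \<open>x\<close>; it is proper, hence
    finitely generated.\<close>
  define \<A> where "\<A> = {J. submod R ?V J \<and> J \<subseteq> I \<and> x \<notin> J}"
  have "\<exists>B\<in>\<A>. \<forall>D\<in>\<A>. B \<subseteq> D \<longrightarrow> D = B"
  proof (rule subset_Zorn_nonempty)
    show "\<A> \<noteq> {}" using V.submod_zero x sub(2) unfolding \<A>_def by auto
    fix C assume C: "C \<noteq> {}" "subset.chain \<A> C"
    then have CA: "C \<subseteq> \<A>" and tot: "\<And>D Y. D \<in> C \<Longrightarrow> Y \<in> C \<Longrightarrow> D \<subseteq> Y \<or> Y \<subseteq> D"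
      unfolding subset_chain_def by auto
    have "submod R ?V (\<Union>C)" unfolding submod_def
    proof (intro conjI ballI)
      show "\<Union>C \<subseteq> carrier ?V" using CA[unfolded \<A>_def] submodD(1)[of R ?V] by blast
      show "\<zero>\<^bsub>?V\<^esub> \<in> \<Union>C" using CA[unfolded \<A>_def] C(1) submodD(2)[of R ?V] by blast
      fix u assume "u \<in> \<Union>C"
      then obtain D where D: "D \<in> C" "u \<in> D" by blast
      { fix v assume "v \<in> \<Union>C"
        then obtain Y where Y: "Y \<in> C" "v \<in> Y" by blast
        obtain Z where "Z \<in> C" "u \<in> Z" "v \<in> Z" using tot[OF D(1) Y(1)] D Y by blast
        moreover from this have "submod R ?V Z" using CA[unfolded \<A>_def] by blast
        ultimately show "u \<oplus>\<^bsub>?V\<^esub> v \<in> \<Union>C" using submodD(3)[of R ?V Z u v] by blast }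
      fix a assume "a \<in> carrier R"
      moreover have "submod R ?V D" using CA[unfolded \<A>_def] D by blast
      ultimately show "a \<odot>\<^bsub>?V\<^esub> u \<in> \<Union>C" using submodD(4)[of R ?V D a u] D by blast
    qed
    then show "\<Union>C \<in> \<A>" unfolding \<A>_def using CA[unfolded \<A>_def] by blast
  qed
  then obtain J where JA: "J \<in> \<A>" and mA: "\<And>D. D \<in> \<A> \<Longrightarrow> J \<subseteq> D \<Longrightarrow> D = J" by blast
  have J: "submod R ?V J" "J \<subseteq> I" "x \<notin> J" using JA by (auto simp: \<A>_def)
  have maxJ: "D = J" if "submod R ?V D" "D \<subseteq> I" "x \<notin> D" "J \<subseteq> D" for D
    using mA[of D] that by (auto simp: \<A>_def)
  note subJ = submodD[OF J(1), simplified]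
  have "J \<subset> I" using J x by blast
  from minI[OF J(1) this] obtain T where T: "finite T" "T \<subseteq> carrier R" "J = gspan R ?V T"
    by (auto simp: fg_set_def)
  have "y \<in> gspan R ?V (insert x T)" if y: "y \<in> I" for y
  proof (cases "y \<in> J")
    case True then show ?thesis using T gspan_mono[of T "insert x T"] by blast
  next
    case False
    \<comment> \<open>The sum of \<open>J\<close> and the line through \<open>y\<close> is larger
      than \<open>J\<close>, hence contains \<open>x\<close>. In x = j + c y the scalar
      \<open>c\<close> acts nontrivially on \<open>I\<close>, since x is not in \<open>J\<close>,
      hence invertibly, and the equation can be solved for \<open>y\<close>.\<close>
    let ?X = "{j \<oplus> c \<otimes> y | j c. j \<in> J \<and> c \<in> carrier R}"
    have yc: "y \<in> carrier R" using y Icar by blast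
    have jc: "j \<in> J \<Longrightarrow> j \<in> carrier R" for j using J(2) Icar by blast
    have mem: "j \<oplus> c \<otimes> y \<in> ?X" if "j \<in> J" "c \<in> carrier R" for j c using that by blast
    have "submod R ?V ?X" unfolding submod_def
    proof (intro conjI ballI)
      show "?X \<subseteq> carrier ?V" using yc jc by auto
      show "\<zero>\<^bsub>?V\<^esub> \<in> ?X" using mem[of \<zero> \<zero>] subJ(2) yc by simp
      fix u assume "u \<in> ?X"
      then obtain j c where u: "u = j \<oplus> c \<otimes> y" "j \<in> J" "c \<in> carrier R" by blast
      { fix v assume "v \<in> ?X"
        then obtain i d where v: "v = i \<oplus> d \<otimes> y" "i \<in> J" "d \<in> carrier R" by blast
        have "u \<oplus> v = (j \<oplus> i) \<oplus> (c \<oplus> d) \<otimes> y"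
          using u v yc jc by (simp add: l_distr a_ac)
        then show "u \<oplus>\<^bsub>?V\<^esub> v \<in> ?X" using mem[of "j \<oplus> i" "c \<oplus> d"] u v subJ(3) by simp }
      fix a assume a: "a \<in> carrier R"
      have "a \<otimes> u = a \<otimes> j \<oplus> (a \<otimes> c) \<otimes> y"
        using u yc jc a by (simp add: r_distr m_assoc)
      then show "a \<odot>\<^bsub>?V\<^esub> u \<in> ?X" using mem[of "a \<otimes> j" "a \<otimes> c"] u a subJ(4) by simp
    qed
    moreover have "?X \<subseteq> I" using sub(3,4) y J(2) by auto
    moreover have "J \<subseteq> ?X"
    proof
      fix j assume "j \<in> J"
      then show "j \<in> ?X" using mem[of j \<zero>] yc jc by simp
    qed
    moreover have "y \<in> ?X" using mem[of \<zero> \<one>] yc subJ(2) by simp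
    ultimately have "x \<in> ?X" using maxJ[of ?X] False by blast
    then obtain j c where jcx: "x = j \<oplus> c \<otimes> y" "j \<in> J" "c \<in> carrier R" by blast
    have "\<not> (\<forall>z\<in>I. c \<otimes> z = \<zero>)" proof
      assume "\<forall>z\<in>I. c \<otimes> z = \<zero>"
      then have "x = j" using jcx y jc by simp
      then show False using J(3) jcx by simp
    qed
    from inv[OF jcx(3) this] obtain b where b: "b \<in> carrier R" "(b \<otimes> c) \<otimes> y = y" using y by blast
    have "c \<otimes> y = x \<oplus> \<ominus> \<one> \<otimes> j"
      using jcx yc jc by (simp add: l_minus a_ac r_neg1 r_neg2)
    then have "y = b \<otimes> (x \<oplus> \<ominus> \<one> \<otimes> j)" using b jcx yc by (simp add: m_assoc)
    moreover have "j \<in> gspan R ?V (insert x T)" using jcx T gspan_mono[of T "insert x T"] by blast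
    ultimately show ?thesis
      using gspan.smult[of b R "b \<otimes> x" ?V] gspan.smult[OF b(1) gspan.add[OF gspan.base[of x "insert x T"] gspan.smult[of "\<ominus> \<one>" R j ?V "insert x T"]]]
      by simp
  qed
  moreover have "gspan R ?V (insert x T) \<subseteq> I"
    by (rule gspan_least[OF I]) (use x T J gspan.base[of _ T R ?V] in auto)
  ultimately have "I = gspan R ?V (insert x T)" by blast
  then have "fg_set R ?V I"
    using T x Icar by (auto simp: fg_set_def intro!: exI[of _ "insert x T"])
  then show False using nfg by blast
qed

end

text \<open>Splits off the coefficient of one generator; the inductions on a finite set of
  generators rest on it.\<close>

lemma (in left_module) gspan_insertD:
  assumes s: "s \<in> carrier M" and S: "S \<subseteq> carrier M" and y: "y \<in> gspan R M (insert s S)"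
  shows "\<exists>c\<in>carrier R. \<exists>z\<in>gspan R M S. y = z \<oplus>\<^bsub>M\<^esub> c \<odot>\<^bsub>M\<^esub> s"
  using y
proof induct
  case zero
  then show ?case using s gspan.zero[of M R S]
    by (auto intro!: bexI[of _ "\<zero>\<^bsub>R\<^esub>"] bexI[of _ "\<zero>\<^bsub>M\<^esub>"])
next
  case (base x)
  show ?case
  proof (cases "x = s")
    case True
    then show ?thesis using s gspan.zero[of M R S]
      by (auto intro!: bexI[of _ "\<one>\<^bsub>R\<^esub>"] bexI[of _ "\<zero>\<^bsub>M\<^esub>"])
  next
    case False
    then have "x \<in> S" using base by blast
    then show ?thesis using s S gspan.base[of x S R M]
      by (auto intro!: bexI[of _ "\<zero>\<^bsub>R\<^esub>"] bexI[of _ x])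
  qed
next
  case (add x y)
  then obtain c z d w where *: "c \<in> carrier R" "z \<in> gspan R M S" "x = z \<oplus>\<^bsub>M\<^esub> c \<odot>\<^bsub>M\<^esub> s"
    "d \<in> carrier R" "w \<in> gspan R M S" "y = w \<oplus>\<^bsub>M\<^esub> d \<odot>\<^bsub>M\<^esub> s" by blast
  then have "x \<oplus>\<^bsub>M\<^esub> y = (z \<oplus>\<^bsub>M\<^esub> w) \<oplus>\<^bsub>M\<^esub> (c \<oplus>\<^bsub>R\<^esub> d) \<odot>\<^bsub>M\<^esub> s"
    using s gspan_closed[OF S] by (simp add: smult_l_distr M.a_ac)
  then show ?case using * gspan.add[of z R M S w] R.a_closed by blast
next
  case (smult a x)
  then obtain c z where *: "c \<in> carrier R" "z \<in> gspan R M S" "x = z \<oplus>\<^bsub>M\<^esub> c \<odot>\<^bsub>M\<^esub> s" by blast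
  then have "a \<odot>\<^bsub>M\<^esub> x = a \<odot>\<^bsub>M\<^esub> z \<oplus>\<^bsub>M\<^esub> (a \<otimes>\<^bsub>R\<^esub> c) \<odot>\<^bsub>M\<^esub> s"
    using smult s gspan_closed[OF S] by (simp add: smult_r_distr smult_assoc1)
  then show ?case using * smult gspan.smult[of a R z M S] R.m_closed by blast
qed

text \<open>Induction on the generators. The coefficients at the new generator \<open>s\<close> of
  elements of \<open>N\<close> form an ideal, which is finitely generated; the elements of
  \<open>N\<close> in the span of the old generators are covered by the induction
  hypothesis.\<close>

lemma noetherian_module_of_fg:
  assumes R: "noetherian_module R (regular_module R)" and V: "left_module R V"
    and fg: "fg_set R V (carrier V)"
  shows "noetherian_module R V"
proof -
  interpret V: left_module R V by (rule V)
  interpret L: left_module R "regular_module R" by (rule V.R.regular_left_module)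
  have "\<And>N. submod R V N \<Longrightarrow> N \<subseteq> gspan R V S \<Longrightarrow> fg_set R V N"
    if "finite S" "S \<subseteq> carrier V" for S using that
  proof (induct S)
    case empty
    have "gspan R V {} = {\<zero>\<^bsub>V\<^esub>}"
      using gspan_least[OF V.submod_zero, of "{}"] gspan.zero[of V R "{}"] by auto
    with empty have "N = gspan R V {}" using submodD(2)[OF empty(1)] by auto
    then show ?case by (auto simp: fg_set_def intro!: exI[of _ "{}"])
  next
    case (insert s S)
    note sub = submodD[OF insert(4)]
    have Ncar: "x \<in> N \<Longrightarrow> x \<in> carrier V" for x using sub(1) by blast
    have s: "s \<in> carrier V" and S: "S \<subseteq> carrier V" using insert by auto
    have Gcar: "z \<in> gspan R V S \<Longrightarrow> z \<in> carrier V" for z using V.gspan_closed[OF S] .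
    \<comment> \<open>\<open>?P c n\<close>: the element \<open>n\<close> of \<open>N\<close> admits
      \<open>c\<close> as a coefficient at \<open>s\<close>. Such a coefficient need not be unique,
      hence a relation.\<close>
    let ?P = "\<lambda>c n. n \<in> N \<and> (\<exists>z\<in>gspan R V S. n = z \<oplus>\<^bsub>V\<^esub> c \<odot>\<^bsub>V\<^esub> s)"
    let ?I = "{c \<in> carrier R. \<exists>n. ?P c n}"
    have Padd: "?P (c \<oplus>\<^bsub>R\<^esub> d) (n \<oplus>\<^bsub>V\<^esub> m)" if "?P c n" "?P d m" "c \<in> carrier R" "d \<in> carrier R" for c d n m
    proof -
      from that obtain z w where zw: "z \<in> gspan R V S" "w \<in> gspan R V S"
        "n = z \<oplus>\<^bsub>V\<^esub> c \<odot>\<^bsub>V\<^esub> s" "m = w \<oplus>\<^bsub>V\<^esub> d \<odot>\<^bsub>V\<^esub> s" by blast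
      then have "n \<oplus>\<^bsub>V\<^esub> m = (z \<oplus>\<^bsub>V\<^esub> w) \<oplus>\<^bsub>V\<^esub> (c \<oplus>\<^bsub>R\<^esub> d) \<odot>\<^bsub>V\<^esub> s"
        using that s Gcar by (simp add: V.smult_l_distr V.M.a_ac)
      then show ?thesis using that sub(3) gspan.add[OF zw(1,2)] by blast
    qed
    have Psm: "?P (a \<otimes>\<^bsub>R\<^esub> c) (a \<odot>\<^bsub>V\<^esub> n)" if "?P c n" "c \<in> carrier R" "a \<in> carrier R" for a c n
    proof -
      from that obtain z where z: "z \<in> gspan R V S" "n = z \<oplus>\<^bsub>V\<^esub> c \<odot>\<^bsub>V\<^esub> s" by blast
      then have "a \<odot>\<^bsub>V\<^esub> n = a \<odot>\<^bsub>V\<^esub> z \<oplus>\<^bsub>V\<^esub> (a \<otimes>\<^bsub>R\<^esub> c) \<odot>\<^bsub>V\<^esub> s"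
        using that s Gcar by (simp add: V.smult_r_distr V.smult_assoc1)
      then show ?thesis using that sub(4) gspan.smult[OF that(3) z(1)] by blast
    qed
    have P0: "?P \<zero>\<^bsub>R\<^esub> \<zero>\<^bsub>V\<^esub>" using sub(2) s gspan.zero[of V R S] by (auto intro!: bexI[of _ "\<zero>\<^bsub>V\<^esub>"])
    have I: "submod R (regular_module R) ?I"
      unfolding submod_def regular_module_simps
    proof (intro conjI ballI)
      show "\<zero>\<^bsub>R\<^esub> \<in> ?I" using P0 by blast
      fix c assume c: "c \<in> ?I"
      then obtain n where n: "?P c n" "c \<in> carrier R" by blast
      { fix d assume "d \<in> ?I"
        then obtain m where m: "?P d m" "d \<in> carrier R" by blast
        show "c \<oplus>\<^bsub>R\<^esub> d \<in> ?I" using Padd[OF n(1) m(1) n(2) m(2)] V.R.a_closed[OF n(2) m(2)] by blast }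
      fix a assume a: "a \<in> carrier R"
      show "a \<otimes>\<^bsub>R\<^esub> c \<in> ?I" using Psm[OF n a] V.R.m_closed[OF a n(2)] by blast
    qed blast
    then obtain T where T: "finite T" "T \<subseteq> carrier R" "?I = gspan R (regular_module R) T"
      using R by (auto simp: noetherian_module_def fg_set_def)
    have "\<forall>c\<in>T. \<exists>n. ?P c n" using T(3) gspan.base[of _ T R "regular_module R"] by blast
    then obtain n where n: "\<And>c. c \<in> T \<Longrightarrow> ?P c (n c)" by metis
    have nN: "n ` T \<subseteq> N" using n by blast
    have ex: "\<exists>m\<in>gspan R V (n ` T). ?P c m" if "c \<in> gspan R (regular_module R) T" for c
      using that
    proof induct
      case zero then show ?case using P0 gspan.zero[of V R "n ` T"] by auto
    next
      case (base x) then show ?case using n gspan.base[of "n x" "n ` T"] by blast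
    next
      case (add x y)
      then obtain m1 m2 where m: "m1 \<in> gspan R V (n ` T)" "m2 \<in> gspan R V (n ` T)" "?P x m1" "?P y m2" by blast
      moreover have "x \<in> carrier R" "y \<in> carrier R" using add T(3) by blast+
      ultimately show ?case using Padd[OF m(3,4)] gspan.add[OF m(1,2)] by (metis (no_types, lifting) regular_module_simps(3))
    next
      case (smult a x)
      then obtain m1 where m: "m1 \<in> gspan R V (n ` T)" "?P x m1" by blast
      moreover have "x \<in> carrier R" using smult T(3) by blast
      ultimately show ?case using Psm[OF m(2) _ smult(1)] gspan.smult[OF smult(1) m(1)] by (metis (no_types, lifting) regular_module_simps(4))
    qed
    let ?N' = "N \<inter> gspan R V S"
    have N': "submod R V ?N'" using insert(4) V.gspan_submod[OF S] by (auto simp: submod_def)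
    then obtain U where U: "finite U" "U \<subseteq> carrier V" "?N' = gspan R V U"
      using insert(3)[OF N' _ S] by (auto simp: fg_set_def)
    have UN: "U \<subseteq> N" using U(3) gspan.base[of _ U R V] by blast
    have "N = gspan R V (U \<union> n ` T)"
    proof
      show "gspan R V (U \<union> n ` T) \<subseteq> N" by (rule gspan_least[OF insert(4)]) (use UN nN in auto)
      show "N \<subseteq> gspan R V (U \<union> n ` T)"
      proof
        fix y assume y: "y \<in> N"
        then have "y \<in> gspan R V (insert s S)" using insert(5) by blast
        then have "\<exists>c\<in>carrier R. \<exists>z\<in>gspan R V S. y = z \<oplus>\<^bsub>V\<^esub> c \<odot>\<^bsub>V\<^esub> s"
          by (rule V.gspan_insertD[OF s S])
        then obtain c z where cz: "c \<in> carrier R" "z \<in> gspan R V S" "y = z \<oplus>\<^bsub>V\<^esub> c \<odot>\<^bsub>V\<^esub> s" by blast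
        then have "c \<in> ?I" using y by blast
        then obtain m w where m: "m \<in> gspan R V (n ` T)" "m \<in> N" "w \<in> gspan R V S" "m = w \<oplus>\<^bsub>V\<^esub> c \<odot>\<^bsub>V\<^esub> s"
          using ex[of c] T(3) by blast
        \<comment> \<open>\<open>m\<close> has the same coefficient \<open>c\<close> at
          \<open>s\<close>, so the \<open>s\<close>-terms cancel and the difference lies in the span
          of \<open>S\<close>.\<close>
        have "y \<ominus>\<^bsub>V\<^esub> m = z \<ominus>\<^bsub>V\<^esub> w"
          using cz m s Gcar by (simp add: V.add_diff_add V.M.minus_eq[of "c \<odot>\<^bsub>V\<^esub> s"] V.M.r_neg)
        then have "y \<ominus>\<^bsub>V\<^esub> m \<in> ?N'"
          using V.submod_minus[OF insert(4) y m(2)] V.submod_minus[OF V.gspan_submod[OF S] cz(2) m(3)]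
          by simp
        then have "y \<ominus>\<^bsub>V\<^esub> m \<in> gspan R V (U \<union> n ` T)" using U(3) gspan_mono[of U "U \<union> n ` T"] by blast
        moreover have "m \<in> gspan R V (U \<union> n ` T)" using m gspan_mono[of "n ` T" "U \<union> n ` T"] by blast
        ultimately have "(y \<ominus>\<^bsub>V\<^esub> m) \<oplus>\<^bsub>V\<^esub> m \<in> gspan R V (U \<union> n ` T)" by (rule gspan.add)
        then show "y \<in> gspan R V (U \<union> n ` T)" using y m(2) Ncar by (simp add: V.diff_add_cancel)
      qed
    qed
    then show ?case using U T nN Ncar by (auto simp: fg_set_def intro!: exI[of _ "U \<union> n ` T"])
  qed
  then show ?thesis
    using fg submodD(1) unfolding noetherian_module_def fg_set_def by metis
qed

section \<open>Finitely generated modules over an artin algebra\<close>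

definition restr :: "('k \<Rightarrow> 'r) \<Rightarrow> ('r, 'm, 'b) module_scheme \<Rightarrow> ('k, 'm) module" where
  "restr \<phi> V =
     \<lparr>carrier = carrier V, monoid.mult = monoid.mult V, one = one V, ring.zero = ring.zero V,
      add = add V, smult = (\<lambda>c x. \<phi> c \<odot>\<^bsub>V\<^esub> x)\<rparr>"

lemma restr_simps [simp]:
  "carrier (restr \<phi> V) = carrier V" "ring.zero (restr \<phi> V) = ring.zero V"
  "add (restr \<phi> V) = add V" "smult (restr \<phi> V) = (\<lambda>c x. \<phi> c \<odot>\<^bsub>V\<^esub> x)"
  by (simp_all add: restr_def)

lemma restrict_scalars_eq: "restrict_scalars \<phi> \<Lambda> = restr \<phi> (regular_module \<Lambda>)"
  by (simp add: restrict_scalars_def restr_def regular_module_def)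

text \<open>The groups Hom as modules over \<open>K\<close>. Multiplication by \<phi> c preserves
  \<Lambda>-linearity because \<phi> c is central; general scalars from \<Lambda> would destroy
  it.\<close>

definition hom_module ::
  "('k \<Rightarrow> 'r) \<Rightarrow> ('r, 'a) ring_scheme \<Rightarrow> ('r, 'm, 'b) module_scheme \<Rightarrow> ('r, 'n, 'c) module_scheme \<Rightarrow>
     ('k, 'm \<Rightarrow> 'n) module" where
  "hom_module \<phi> \<Lambda> V W =
     \<lparr>carrier = Hom_set \<Lambda> V W, monoid.mult = undefined, one = undefined,
      ring.zero = (\<lambda>x\<in>carrier V. \<zero>\<^bsub>W\<^esub>), add = (\<lambda>f g. \<lambda>x\<in>carrier V. f x \<oplus>\<^bsub>W\<^esub> g x),
      smult = (\<lambda>c f. \<lambda>x\<in>carrier V. \<phi> c \<odot>\<^bsub>W\<^esub> f x)\<rparr>"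

lemma hom_module_simps [simp]:
  "carrier (hom_module \<phi> \<Lambda> V W) = Hom_set \<Lambda> V W"
  "ring.zero (hom_module \<phi> \<Lambda> V W) = (\<lambda>x\<in>carrier V. \<zero>\<^bsub>W\<^esub>)"
  "add (hom_module \<phi> \<Lambda> V W) = (\<lambda>f g. \<lambda>x\<in>carrier V. f x \<oplus>\<^bsub>W\<^esub> g x)"
  "smult (hom_module \<phi> \<Lambda> V W) = (\<lambda>c f. \<lambda>x\<in>carrier V. \<phi> c \<odot>\<^bsub>W\<^esub> f x)"
  by (simp_all add: hom_module_def)

text \<open>\<open>lin\<close> is membership in \<open>Hom_set\<close> freed from extensionality, so
  that composites and sums of maps are linear without being restricted. This equivalence is the
  bridge back to the given definitions.\<close>

lemma Hom_set_iff: "f \<in> Hom_set \<Lambda> V W \<longleftrightarrow> lin \<Lambda> V W f \<and> f \<in> extensional (carrier V)"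
  by (auto simp: Hom_set_def lin_def PiE_def)

lemma lin_cong:
  assumes "lin \<Lambda> V W f" "left_module \<Lambda> V" "\<And>x. x \<in> carrier V \<Longrightarrow> g x = f x"
  shows "lin \<Lambda> V W g"
proof -
  interpret left_module \<Lambda> V by (rule assms)
  show ?thesis using assms(1,3) by (auto simp: lin_def)
qed

lemma restrict_Hom_set:
  assumes "lin \<Lambda> V W f" "left_module \<Lambda> V"
  shows "restrict f (carrier V) \<in> Hom_set \<Lambda> V W"
  using lin_cong[OF assms, of "restrict f (carrier V)"] by (simp add: Hom_set_iff)

locale artin_setup =
  fixes K :: "('k, 'a) ring_scheme" and \<phi> :: "'k \<Rightarrow> 'r" and \<Lambda> :: "('r, 'b) ring_scheme"
  assumes alg: "artin_algebra K \<phi> \<Lambda>"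
begin

lemma K_cring: "cring K" and \<Lambda>_ring: "ring \<Lambda>"
  and \<phi>_closed: "c \<in> carrier K \<Longrightarrow> \<phi> c \<in> carrier \<Lambda>"
  and \<phi>_central: "c \<in> carrier K \<Longrightarrow> x \<in> carrier \<Lambda> \<Longrightarrow> \<phi> c \<otimes>\<^bsub>\<Lambda>\<^esub> x = x \<otimes>\<^bsub>\<Lambda>\<^esub> \<phi> c"
  and \<phi>_hom: "\<phi> \<in> ring_hom K \<Lambda>"
  using alg by (auto simp: artin_algebra_def ring_hom_closed)

lemma K_noetherian: "noetherian_module K (regular_module K)"
  using alg cring.artinian_imp_noetherian by (auto simp: artin_algebra_def)

lemma \<phi>_smult_comm:
  assumes "left_module \<Lambda> V" "c \<in> carrier K" "a \<in> carrier \<Lambda>" "x \<in> carrier V"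
  shows "a \<odot>\<^bsub>V\<^esub> (\<phi> c \<odot>\<^bsub>V\<^esub> x) = \<phi> c \<odot>\<^bsub>V\<^esub> (a \<odot>\<^bsub>V\<^esub> x)"
proof -
  interpret left_module \<Lambda> V by (rule assms)
  show ?thesis using assms \<phi>_central[of c a] \<phi>_closed[of c] by (metis smult_assoc1)
qed

lemma restr_left_module:
  assumes "left_module \<Lambda> V" shows "left_module K (restr \<phi> V)"
proof -
  interpret V: left_module \<Lambda> V by (rule assms)
  interpret K: cring K by (rule K_cring)
  show ?thesis
    by (intro left_module.intro left_module_axioms.intro K.ring_axioms
        abelian_group_cong[OF V.M.abelian_group_axioms])
      (auto simp: \<phi>_closed ring_hom_add[OF \<phi>_hom] ring_hom_mult[OF \<phi>_hom] ring_hom_one[OF \<phi>_hom]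
        V.smult_l_distr V.smult_r_distr V.smult_assoc1)
qed

lemma gspan_restr_subset:
  assumes "left_module \<Lambda> V" shows "gspan K (restr \<phi> V) S \<subseteq> gspan \<Lambda> V S"
proof
  fix x assume "x \<in> gspan K (restr \<phi> V) S"
  then show "x \<in> gspan \<Lambda> V S"
    by induct (auto intro: gspan.intros \<phi>_closed)
qed

text \<open>If \<open>T\<close> generates \<Lambda> over \<open>K\<close> and \<open>S\<close>
  generates \<open>V\<close> over \<Lambda>, then the products t s generate \<open>V\<close> over
  \<open>K\<close>.\<close>

lemma fg_set_restr:
  assumes V: "left_module \<Lambda> V" and fg: "fg_set \<Lambda> V (carrier V)"
  shows "fg_set K (restr \<phi> V) (carrier V)"
proof -
  interpret V: left_module \<Lambda> V by (rule V)
  interpret L: left_module \<Lambda> "regular_module \<Lambda>" by (rule V.R.regular_left_module)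
  interpret RL: left_module K "restr \<phi> (regular_module \<Lambda>)"
    by (rule restr_left_module[OF L.left_module_axioms])
  interpret RV: left_module K "restr \<phi> V" by (rule restr_left_module[OF V])
  have "fg_set K (restr \<phi> (regular_module \<Lambda>)) (carrier \<Lambda>)"
    using alg RL.finitely_generated_iff_fg_set by (simp add: artin_algebra_def restrict_scalars_eq)
  then obtain T where T: "finite T" "T \<subseteq> carrier \<Lambda>" "carrier \<Lambda> = gspan K (restr \<phi> (regular_module \<Lambda>)) T"
    by (auto simp: fg_set_def)
  obtain S where S: "finite S" "S \<subseteq> carrier V" "carrier V = gspan \<Lambda> V S"
    using fg by (auto simp: fg_set_def)
  let ?U = "(\<lambda>(t, s). t \<odot>\<^bsub>V\<^esub> s) ` (T \<times> S)"
  let ?G = "gspan K (restr \<phi> V) ?U"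
  have U: "?U \<subseteq> carrier V" using T(2) S(2) by auto
  have Gcar: "x \<in> ?G \<Longrightarrow> x \<in> carrier V" for x using RV.gspan_closed[of ?U x] U by simp
  have as: "a \<odot>\<^bsub>V\<^esub> s \<in> ?G" if s: "s \<in> S" and a: "a \<in> carrier \<Lambda>" for a s
  proof -
    have sc: "s \<in> carrier V" using s S(2) by blast
    have "a \<in> gspan K (restr \<phi> (regular_module \<Lambda>)) T" using a T(3) by blast
    then show ?thesis
    proof induct
      case zero then show ?case using sc gspan.zero[of "restr \<phi> V" K ?U] by simp
    next
      case (base t) then show ?case using s by (auto intro!: gspan.base)
    next
      case (add x y)
      then have "x \<in> carrier \<Lambda>" "y \<in> carrier \<Lambda>" using T(3) by blast+
      then show ?case using sc add gspan.add[of "x \<odot>\<^bsub>V\<^esub> s" K "restr \<phi> V" ?U "y \<odot>\<^bsub>V\<^esub> s"]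
        by (simp add: V.smult_l_distr)
    next
      case (smult c x)
      then have "x \<in> carrier \<Lambda>" using T(3) by blast
      then show ?case using sc smult \<phi>_closed gspan.smult[of c K "x \<odot>\<^bsub>V\<^esub> s" "restr \<phi> V" ?U]
        by (simp add: V.smult_assoc1)
    qed
  qed
  have sm: "a \<odot>\<^bsub>V\<^esub> x \<in> ?G" if a: "a \<in> carrier \<Lambda>" and x: "x \<in> ?G" for a x
    using x
  proof induct
    case zero then show ?case using a gspan.zero[of "restr \<phi> V" K ?U] by simp
  next
    case (base x)
    then obtain t s where ts: "t \<in> T" "s \<in> S" "x = t \<odot>\<^bsub>V\<^esub> s" by auto
    then have "t \<in> carrier \<Lambda>" "s \<in> carrier V" using T(2) S(2) by auto
    then show ?case using as[OF ts(2), of "a \<otimes>\<^bsub>\<Lambda>\<^esub> t"] a ts by (simp add: V.smult_assoc1)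
  next
    case (add x y)
    then show ?case using gspan.add[OF add(2,4)] Gcar a by (simp add: V.smult_r_distr)
  next
    case (smult c x)
    then show ?case using gspan.smult[OF smult(1,3)] Gcar[of x] a
      by (simp add: \<phi>_smult_comm[OF V])
  qed
  have "carrier V \<subseteq> ?G"
  proof
    fix x assume "x \<in> carrier V"
    then have "x \<in> gspan \<Lambda> V S" using S(3) by blast
    then show "x \<in> ?G"
    proof induct
      case zero then show ?case using gspan.zero[of "restr \<phi> V" K ?U] by simp
    next
      case (base x) then show ?case using as[of x "\<one>\<^bsub>\<Lambda>\<^esub>"] S(2) by auto
    next
      case (add x y) then show ?case using gspan.add[OF add(2,4)] by simp
    next
      case (smult a x) then show ?case using sm by blast
    qed
  qed
  then have "carrier V = ?G" using Gcar by blast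
  then show ?thesis using T(1) S(1) U unfolding fg_set_def by (intro exI[of _ ?U]) auto
qed

text \<open>Over \<open>K\<close> the module \<open>V\<close> is noetherian, and generators of
  \<open>N\<close> over \<open>K\<close> generate it over \<Lambda> as well.\<close>

lemma submod_fg:
  assumes V: "left_module \<Lambda> V" and fg: "fg_set \<Lambda> V (carrier V)" and N: "submod \<Lambda> V N"
  shows "fg_set \<Lambda> V N"
proof -
  have "noetherian_module K (restr \<phi> V)"
    using noetherian_module_of_fg[OF K_noetherian restr_left_module[OF V]] fg_set_restr[OF V fg] by simp
  moreover have "submod K (restr \<phi> V) N"
    using N by (auto simp: submod_def \<phi>_closed)
  ultimately obtain S where S: "finite S" "S \<subseteq> carrier V" "N = gspan K (restr \<phi> V) S"
    by (auto simp: noetherian_module_def fg_set_def)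
  have "S \<subseteq> N" using S(3) by (auto intro: gspan.base)
  then have "N = gspan \<Lambda> V S"
    using S(3) gspan_restr_subset[OF V, of S] gspan_least[OF N, of S] by blast
  then show ?thesis using S by (auto simp: fg_set_def)
qed

lemma submod_mod_cat:
  assumes V: "V \<in> mod_cat \<Lambda>" and N: "submod \<Lambda> V N"
  shows "V\<lparr>carrier := N\<rparr> \<in> mod_cat \<Lambda>"
proof -
  have lV: "left_module \<Lambda> V" and "fg_set \<Lambda> V (carrier V)"
    using V by (auto simp: mod_cat_iff_fg_set)
  then obtain S where S: "finite S" "N = gspan \<Lambda> V S"
    using submod_fg[OF _ _ N] by (auto simp: fg_set_def)
  then have "fg_set \<Lambda> (V\<lparr>carrier := N\<rparr>) N"
    using gspan.base[of _ S \<Lambda> V] by (auto simp: fg_set_def intro!: exI[of _ S])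
  then show ?thesis using left_module.submod_left_module[OF lV N] by (simp add: mod_cat_iff_fg_set)
qed

lemma hom_module_left_module:
  assumes V: "left_module \<Lambda> V" and W: "left_module \<Lambda> W"
  shows "left_module K (hom_module \<phi> \<Lambda> V W)"
proof -
  interpret V: left_module \<Lambda> V by (rule V)
  interpret W: left_module \<Lambda> W by (rule W)
  interpret K: cring K by (rule K_cring)
  let ?H = "hom_module \<phi> \<Lambda> V W"
  have car: "f x \<in> carrier W" if "f \<in> Hom_set \<Lambda> V W" "x \<in> carrier V" for f x
    using that by (auto simp: Hom_set_iff lin_def)
  have eqI: "f = g" if "f \<in> Hom_set \<Lambda> V W" "g \<in> Hom_set \<Lambda> V W" "\<And>x. x \<in> carrier V \<Longrightarrow> f x = g x" for f g
    using that by (metis Hom_set_iff extensionalityI)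
  have add: "(\<lambda>x\<in>carrier V. f x \<oplus>\<^bsub>W\<^esub> g x) \<in> Hom_set \<Lambda> V W"
    if "f \<in> Hom_set \<Lambda> V W" "g \<in> Hom_set \<Lambda> V W" for f g
    using that by (auto simp: Hom_set_iff lin_def W.M.a_ac W.smult_r_distr)
  have sm: "(\<lambda>x\<in>carrier V. \<phi> c \<odot>\<^bsub>W\<^esub> f x) \<in> Hom_set \<Lambda> V W"
    if "f \<in> Hom_set \<Lambda> V W" "c \<in> carrier K" for f c
    using that by (auto simp: Hom_set_iff lin_def W.smult_r_distr \<phi>_closed \<phi>_smult_comm[OF W])
  have zero: "(\<lambda>x\<in>carrier V. \<zero>\<^bsub>W\<^esub>) \<in> Hom_set \<Lambda> V W"
    by (auto simp: Hom_set_iff lin_def)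
  have "abelian_group ?H"
  proof (rule abelian_groupI)
    fix f assume "f \<in> carrier ?H"
    then have f: "f \<in> Hom_set \<Lambda> V W" by simp
    let ?g = "\<lambda>x\<in>carrier V. \<phi> (\<ominus>\<^bsub>K\<^esub> \<one>\<^bsub>K\<^esub>) \<odot>\<^bsub>W\<^esub> f x"
    have g: "?g \<in> Hom_set \<Lambda> V W" by (rule sm[OF f]) simp
    have m1: "\<phi> (\<ominus>\<^bsub>K\<^esub> \<one>\<^bsub>K\<^esub>) = \<ominus>\<^bsub>\<Lambda>\<^esub> \<one>\<^bsub>\<Lambda>\<^esub>"
    proof -
      have "\<phi> (\<ominus>\<^bsub>K\<^esub> \<one>\<^bsub>K\<^esub>) \<oplus>\<^bsub>\<Lambda>\<^esub> \<one>\<^bsub>\<Lambda>\<^esub> = \<phi> (\<ominus>\<^bsub>K\<^esub> \<one>\<^bsub>K\<^esub> \<oplus>\<^bsub>K\<^esub> \<one>\<^bsub>K\<^esub>)"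
        using ring_hom_add[OF \<phi>_hom, of "\<ominus>\<^bsub>K\<^esub> \<one>\<^bsub>K\<^esub>" "\<one>\<^bsub>K\<^esub>"] ring_hom_one[OF \<phi>_hom] by simp
      also have "\<dots> = \<zero>\<^bsub>\<Lambda>\<^esub>"
        using ring_hom_zero[OF \<phi>_hom K.ring_axioms \<Lambda>_ring] by (simp add: K.l_neg)
      finally show ?thesis using \<phi>_closed[of "\<ominus>\<^bsub>K\<^esub> \<one>\<^bsub>K\<^esub>"] V.R.minus_equality[of _ "\<one>\<^bsub>\<Lambda>\<^esub>"] by simp
    qed
    have "(\<lambda>x\<in>carrier V. ?g x \<oplus>\<^bsub>W\<^esub> f x) = (\<lambda>x\<in>carrier V. \<zero>\<^bsub>W\<^esub>)"
      by (rule restrict_ext) (use car[OF f] in \<open>simp add: m1 W.smult_l_minus W.M.l_neg\<close>)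
    then show "\<exists>g\<in>carrier ?H. g \<oplus>\<^bsub>?H\<^esub> f = \<zero>\<^bsub>?H\<^esub>" using g by (intro bexI[of _ ?g]) auto
  next
    fix f g h assume "f \<in> carrier ?H" "g \<in> carrier ?H" "h \<in> carrier ?H"
    then show "f \<oplus>\<^bsub>?H\<^esub> g \<oplus>\<^bsub>?H\<^esub> h = f \<oplus>\<^bsub>?H\<^esub> (g \<oplus>\<^bsub>?H\<^esub> h)"
      by (auto intro!: restrict_ext simp: car W.M.a_assoc)
  next
    fix f g assume "f \<in> carrier ?H" "g \<in> carrier ?H"
    then show "f \<oplus>\<^bsub>?H\<^esub> g = g \<oplus>\<^bsub>?H\<^esub> f"
      by (auto intro!: restrict_ext simp: car W.M.a_comm)
  next
    fix f assume "f \<in> carrier ?H"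
    then have f: "f \<in> Hom_set \<Lambda> V W" by simp
    show "\<zero>\<^bsub>?H\<^esub> \<oplus>\<^bsub>?H\<^esub> f = f"
      using add[OF zero f] by (intro eqI) (auto simp: car f)
  qed (use add zero in auto)
  moreover have "\<one>\<^bsub>K\<^esub> \<odot>\<^bsub>?H\<^esub> f = f" if "f \<in> carrier ?H" for f
    using that sm[of f "\<one>\<^bsub>K\<^esub>"] by (intro eqI) (auto simp: car ring_hom_one[OF \<phi>_hom])
  ultimately show ?thesis
    by (intro left_module.intro left_module_axioms.intro K.ring_axioms)
      (auto intro!: restrict_ext simp: sm car \<phi>_closed ring_hom_add[OF \<phi>_hom]
        ring_hom_mult[OF \<phi>_hom] W.smult_l_distr W.smult_r_distr W.smult_assoc1)
qed

text \<open>A homomorphism is determined by its values on finitely many generators of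
  \<open>V\<close>, so Hom embeds into a finite power of \<open>W\<close>, which is noetherian over
  \<open>K\<close>. Instead of forming the power, the generators are treated one at a time by
  evaluation.\<close>

lemma Hom_set_fg:
  assumes V: "V \<in> mod_cat \<Lambda>" and W: "W \<in> mod_cat \<Lambda>"
  obtains H where "finite H" "H \<subseteq> Hom_set \<Lambda> V W" "Hom_set \<Lambda> V W = gspan K (hom_module \<phi> \<Lambda> V W) H"
proof -
  have lV: "left_module \<Lambda> V" and lW: "left_module \<Lambda> W" and fgW: "fg_set \<Lambda> W (carrier W)"
    using V W by (auto simp: mod_cat_iff_fg_set)
  interpret V: left_module \<Lambda> V by (rule lV)
  interpret W: left_module \<Lambda> W by (rule lW)
  let ?H = "hom_module \<phi> \<Lambda> V W"
  interpret H: left_module K ?H by (rule hom_module_left_module[OF lV lW])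
  interpret RW: left_module K "restr \<phi> W" by (rule restr_left_module[OF lW])
  obtain S where S: "finite S" "S \<subseteq> carrier V" "carrier V = gspan \<Lambda> V S"
    using V by (auto simp: mod_cat_iff_fg_set fg_set_def)
  have noeth: "noetherian_module K (restr \<phi> W)"
    using noetherian_module_of_fg[OF K_noetherian RW.left_module_axioms] fg_set_restr[OF lW fgW] by simp
  \<comment> \<open>\<open>T\<close> contains the generators of \<open>V\<close> on which maps in
    \<open>N\<close> may be nonzero. Evaluation at a new generator \<open>t\<close> has its image in
    the noetherian module \<open>W\<close>, and its kernel falls under the case of
    \<open>T\<close>.\<close>
  have "\<And>N. submod K ?H N \<Longrightarrow> (\<forall>h\<in>N. \<forall>s\<in>S - T. h s = \<zero>\<^bsub>W\<^esub>) \<Longrightarrow> fg_set K ?H N" if "finite T" for T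
    using that
  proof (induct T)
    case empty
    have "h = (\<lambda>x\<in>carrier V. \<zero>\<^bsub>W\<^esub>)" if "h \<in> N" for h
    proof -
      have h: "lin \<Lambda> V W h" "h \<in> extensional (carrier V)"
        using that submodD(1)[OF empty(1)] by (auto simp: Hom_set_iff)
      have "h x = \<zero>\<^bsub>W\<^esub>" if "x \<in> gspan \<Lambda> V S" for x
        using that
      proof induct
        case zero then show ?case using lin_zero[OF lV lW h(1)] .
      next
        case (base x) then show ?case using empty(2) \<open>h \<in> N\<close> by auto
      next
        case (add x y) then show ?case using lin_add[OF h(1)] S(3) by auto
      next
        case (smult a x) then show ?case using lin_smult[OF h(1)] S(3) by auto
      qed
      then show ?thesis using h(2) S(3) by (intro extensionalityI[OF h(2)]) auto
    qed
    then have "N = {\<zero>\<^bsub>?H\<^esub>}" using submodD(2)[OF empty(1)] unfolding hom_module_simps by blast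
    moreover have "gspan K ?H {} = {\<zero>\<^bsub>?H\<^esub>}"
      using gspan_least[OF H.submod_zero, of "{}"] gspan.zero[of ?H K "{}"] by auto
    ultimately have "N = gspan K ?H {}" by simp
    then show ?case unfolding fg_set_def by (intro exI[of _ "{}"]) auto
  next
    case (insert t T)
    show ?case
    proof (cases "t \<in> S")
      case False
      then have "S - insert t T = S - T" by auto
      then show ?thesis using insert by metis
    next
      case True
      then have t: "t \<in> carrier V" using S by blast
      let ?ev = "\<lambda>h. h t"
      have ev: "lin K ?H (restr \<phi> W) ?ev"
        using t by (auto simp: lin_def Hom_set_iff)
      let ?K = "{h \<in> N. ?ev h = \<zero>\<^bsub>restr \<phi> W\<^esub>}"
      have "submod K ?H ?K"
        using submodD[OF insert(4)] t \<phi>_closed by (auto simp: submod_def)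
      moreover have "\<forall>h\<in>?K. \<forall>s\<in>S - T. h s = \<zero>\<^bsub>W\<^esub>" using insert(5) by auto
      ultimately have "fg_set K ?H ?K" using insert(3) by blast
      moreover have "fg_set K (restr \<phi> W) (?ev ` N)"
        using noeth lin_image_submod[OF H.left_module_axioms RW.left_module_axioms ev insert(4)]
        by (auto simp: noetherian_module_def)
      ultimately show ?thesis
        by (rule fg_set_extension[OF H.left_module_axioms RW.left_module_axioms ev insert(4)])
    qed
  qed
  from this[OF S(1) H.submod_carrier] have "fg_set K ?H (carrier ?H)" by simp
  then show thesis using that by (auto simp: fg_set_def)
qed

end

subsection \<open>Direct sums, quotients and submodules\<close>

text \<open>A direct sum in terms of its structure maps. The pairs of \<open>direct_sum\<close> live
  in a product type, whereas here \<open>W\<close> may be any module, in particular one over the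
  same carrier type as \<open>U\<close> and \<open>V\<close>.\<close>

definition biprod where
  "biprod \<Lambda> U V W i j p q \<longleftrightarrow> lin \<Lambda> U W i \<and> lin \<Lambda> V W j \<and> lin \<Lambda> W U p \<and> lin \<Lambda> W V q \<and>
     (\<forall>x\<in>carrier U. p (i x) = x \<and> q (i x) = \<zero>\<^bsub>V\<^esub>) \<and>
     (\<forall>y\<in>carrier V. q (j y) = y \<and> p (j y) = \<zero>\<^bsub>U\<^esub>) \<and>
     (\<forall>w\<in>carrier W. i (p w) \<oplus>\<^bsub>W\<^esub> j (q w) = w)"

lemma direct_sum_simps [simp]:
  "carrier (direct_sum V W) = carrier V \<times> carrier W"
  "\<zero>\<^bsub>direct_sum V W\<^esub> = (\<zero>\<^bsub>V\<^esub>, \<zero>\<^bsub>W\<^esub>)"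
  "u \<oplus>\<^bsub>direct_sum V W\<^esub> v = (fst u \<oplus>\<^bsub>V\<^esub> fst v, snd u \<oplus>\<^bsub>W\<^esub> snd v)"
  "a \<odot>\<^bsub>direct_sum V W\<^esub> u = (a \<odot>\<^bsub>V\<^esub> fst u, a \<odot>\<^bsub>W\<^esub> snd u)"
  by (simp_all add: direct_sum_def)

lemma direct_sum_left_module:
  assumes "left_module \<Lambda> V" "left_module \<Lambda> W"
  shows "left_module \<Lambda> (direct_sum V W)"
proof -
  interpret V: left_module \<Lambda> V by (rule assms)
  interpret W: left_module \<Lambda> W by (rule assms)
  have "abelian_group (direct_sum V W)"
  proof (rule abelian_groupI)
    fix u assume "u \<in> carrier (direct_sum V W)"
    then show "\<exists>v\<in>carrier (direct_sum V W). v \<oplus>\<^bsub>direct_sum V W\<^esub> u = \<zero>\<^bsub>direct_sum V W\<^esub>"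
      by (auto intro!: bexI[of _ "(\<ominus>\<^bsub>V\<^esub> fst u, \<ominus>\<^bsub>W\<^esub> snd u)"] simp: V.M.l_neg W.M.l_neg)
  qed (auto simp: V.M.a_ac W.M.a_ac)
  then show ?thesis
    by (intro left_module.intro left_module_axioms.intro V.R.ring_axioms)
      (auto simp: V.smult_l_distr W.smult_l_distr V.smult_r_distr W.smult_r_distr
        V.smult_assoc1 W.smult_assoc1)
qed

lemma direct_sum_biprod:
  assumes "left_module \<Lambda> V" "left_module \<Lambda> W"
  shows "biprod \<Lambda> V W (direct_sum V W) (\<lambda>x. (x, \<zero>\<^bsub>W\<^esub>)) (\<lambda>y. (\<zero>\<^bsub>V\<^esub>, y)) fst snd"
proof -
  interpret V: left_module \<Lambda> V by (rule assms)
  interpret W: left_module \<Lambda> W by (rule assms)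
  show ?thesis by (auto simp: biprod_def lin_def)
qed

lemma direct_sum_mod_cat:
  assumes "V \<in> mod_cat \<Lambda>" "W \<in> mod_cat \<Lambda>"
  shows "direct_sum V W \<in> mod_cat \<Lambda>"
proof -
  have l: "left_module \<Lambda> V" "left_module \<Lambda> W" and fg: "fg_set \<Lambda> V (carrier V)" "fg_set \<Lambda> W (carrier W)"
    using assms by (auto simp: mod_cat_iff_fg_set)
  interpret V: left_module \<Lambda> V by (rule l)
  interpret W: left_module \<Lambda> W by (rule l)
  interpret D: left_module \<Lambda> "direct_sum V W" by (rule direct_sum_left_module[OF l])
  have b: "lin \<Lambda> W (direct_sum V W) (\<lambda>y. (\<zero>\<^bsub>V\<^esub>, y))" "lin \<Lambda> (direct_sum V W) V fst"
    using direct_sum_biprod[OF l] by (auto simp: biprod_def)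
  have "{u \<in> carrier (direct_sum V W). fst u = \<zero>\<^bsub>V\<^esub>} = (\<lambda>y. (\<zero>\<^bsub>V\<^esub>, y)) ` carrier W"
    by auto
  moreover have "fst ` carrier (direct_sum V W) = carrier V"
    using W.M.zero_closed by force
  ultimately have "fg_set \<Lambda> (direct_sum V W) (carrier (direct_sum V W))"
    using fg_set_extension[OF D.left_module_axioms l(1) b(2) D.submod_carrier]
      fg_set_image[OF l(2) D.left_module_axioms b(1) fg(2)] fg by simp
  then show ?thesis by (simp add: mod_cat_iff_fg_set D.left_module_axioms)
qed

text \<open>The quotient is carried by a set of representatives, so that it lives in the same type.\<close>

lemma quotient_exists:
  fixes V :: "('r, 'm) module"
  assumes V: "V \<in> mod_cat \<Lambda>" and N: "submod \<Lambda> V N"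
  obtains Q :: "('r, 'm) module" and p where "Q \<in> mod_cat \<Lambda>" "lin \<Lambda> V Q p" "p ` carrier V = carrier Q"
    "\<And>x. x \<in> carrier V \<Longrightarrow> p x = \<zero>\<^bsub>Q\<^esub> \<longleftrightarrow> x \<in> N"
proof -
  have lV: "left_module \<Lambda> V" and fg: "fg_set \<Lambda> V (carrier V)" using V by (auto simp: mod_cat_iff_fg_set)
  interpret V: left_module \<Lambda> V by (rule lV)
  note sub = submodD[OF N]
  have Ncar: "x \<in> N \<Longrightarrow> x \<in> carrier V" for x using sub(1) by blast
  define r where "r x = (SOME y. y \<in> carrier V \<and> y \<ominus>\<^bsub>V\<^esub> x \<in> N)" for x
  have r: "r x \<in> carrier V \<and> r x \<ominus>\<^bsub>V\<^esub> x \<in> N" if "x \<in> carrier V" for x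
    unfolding r_def by (rule someI[of _ x]) (use that sub(2) V.diff_eq_zero_iff[of x x] in auto)
  have trans: "a \<ominus>\<^bsub>V\<^esub> c \<in> N" if "a \<ominus>\<^bsub>V\<^esub> b \<in> N" "b \<ominus>\<^bsub>V\<^esub> c \<in> N" "a \<in> carrier V" "b \<in> carrier V" "c \<in> carrier V" for a b c
  proof -
    have "a \<ominus>\<^bsub>V\<^esub> c = (a \<ominus>\<^bsub>V\<^esub> b) \<oplus>\<^bsub>V\<^esub> (b \<ominus>\<^bsub>V\<^esub> c)"
      using that by (simp add: V.M.minus_eq V.M.a_ac V.M.r_neg1 V.M.r_neg2)
    then show ?thesis using that sub(3) by simp
  qed
  have symm: "b \<ominus>\<^bsub>V\<^esub> a \<in> N" if "a \<ominus>\<^bsub>V\<^esub> b \<in> N" "a \<in> carrier V" "b \<in> carrier V" for a b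
  proof -
    have "b \<ominus>\<^bsub>V\<^esub> a = \<ominus>\<^bsub>V\<^esub> (a \<ominus>\<^bsub>V\<^esub> b)"
      using that by (simp add: V.M.minus_eq V.M.minus_add V.M.a_ac)
    then show ?thesis using that V.submod_uminus[OF N] by simp
  qed
  \<comment> \<open>Congruent elements give equivalent descriptions, hence \<open>SOME\<close> picks
    the same representative: \<open>r\<close> is constant on cosets.\<close>
  have req: "r x = r y" if "x \<ominus>\<^bsub>V\<^esub> y \<in> N" "x \<in> carrier V" "y \<in> carrier V" for x y
  proof -
    have "(z \<in> carrier V \<and> z \<ominus>\<^bsub>V\<^esub> x \<in> N) = (z \<in> carrier V \<and> z \<ominus>\<^bsub>V\<^esub> y \<in> N)" for z
      using that trans[of z x y] trans[of z y x] symm[of x y] by blast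
    then show ?thesis by (simp add: r_def)
  qed
  have radd: "r (r x \<oplus>\<^bsub>V\<^esub> r y) = r (x \<oplus>\<^bsub>V\<^esub> y)" if "x \<in> carrier V" "y \<in> carrier V" for x y
    using that r[of x] r[of y] sub(3) by (intro req) (auto simp: V.add_diff_add)
  have radd1: "r (r x \<oplus>\<^bsub>V\<^esub> y) = r (x \<oplus>\<^bsub>V\<^esub> y)" if "x \<in> carrier V" "y \<in> carrier V" for x y
    using that r[of x] sub V.diff_eq_zero_iff[of y y] by (intro req) (auto simp: V.add_diff_add)
  have radd2: "r (x \<oplus>\<^bsub>V\<^esub> r y) = r (x \<oplus>\<^bsub>V\<^esub> y)" if "x \<in> carrier V" "y \<in> carrier V" for x y
    using that radd1[of y x] r[of y] by (simp add: V.M.a_comm)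
  have radd3: "r (x \<oplus>\<^bsub>V\<^esub> (y \<oplus>\<^bsub>V\<^esub> r z)) = r (x \<oplus>\<^bsub>V\<^esub> (y \<oplus>\<^bsub>V\<^esub> z))"
    if "x \<in> carrier V" "y \<in> carrier V" "z \<in> carrier V" for x y z
    using that radd2[of "x \<oplus>\<^bsub>V\<^esub> y" z] r[of z] by (simp add: V.M.a_assoc)
  have rsm: "r (a \<odot>\<^bsub>V\<^esub> r x) = r (a \<odot>\<^bsub>V\<^esub> x)" if "x \<in> carrier V" "a \<in> carrier \<Lambda>" for x a
    using that r[of x] sub(4) by (intro req) (auto simp: V.smult_diff[symmetric])
  have rsm2: "r (a \<odot>\<^bsub>V\<^esub> r x \<oplus>\<^bsub>V\<^esub> b \<odot>\<^bsub>V\<^esub> r x) = r (a \<odot>\<^bsub>V\<^esub> x \<oplus>\<^bsub>V\<^esub> b \<odot>\<^bsub>V\<^esub> x)"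
    "r (a \<odot>\<^bsub>V\<^esub> (b \<odot>\<^bsub>V\<^esub> r x)) = r (a \<odot>\<^bsub>V\<^esub> (b \<odot>\<^bsub>V\<^esub> x))"
    if "x \<in> carrier V" "a \<in> carrier \<Lambda>" "b \<in> carrier \<Lambda>" for x a b
    using that rsm[of x "a \<oplus>\<^bsub>\<Lambda>\<^esub> b"] rsm[of x "a \<otimes>\<^bsub>\<Lambda>\<^esub> b"] r[of x]
    by (simp_all add: V.smult_l_distr V.smult_assoc1)
  have rr: "r (r x) = r x" if "x \<in> carrier V" for x
    using that r[of x] by (intro req) auto
  define Q :: "('r, 'm) module" where "Q = \<lparr>carrier = r ` carrier V, monoid.mult = undefined, one = undefined,
      ring.zero = r \<zero>\<^bsub>V\<^esub>, add = (\<lambda>x y. r (x \<oplus>\<^bsub>V\<^esub> y)), smult = (\<lambda>a x. r (a \<odot>\<^bsub>V\<^esub> x))\<rparr>"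
  have Q [simp]: "carrier Q = r ` carrier V" "\<zero>\<^bsub>Q\<^esub> = r \<zero>\<^bsub>V\<^esub>" "x \<oplus>\<^bsub>Q\<^esub> y = r (x \<oplus>\<^bsub>V\<^esub> y)"
    "a \<odot>\<^bsub>Q\<^esub> x = r (a \<odot>\<^bsub>V\<^esub> x)" for x y a
    by (simp_all add: Q_def)
  have rc: "x \<in> carrier V \<Longrightarrow> r x \<in> carrier V" for x using r by blast
  have "abelian_group Q"
  proof (rule abelian_groupI)
    fix x assume "x \<in> carrier Q"
    then obtain u where "u \<in> carrier V" "x = r u" by auto
    then show "\<exists>y\<in>carrier Q. y \<oplus>\<^bsub>Q\<^esub> x = \<zero>\<^bsub>Q\<^esub>"
      by (auto intro!: bexI[of _ "\<ominus>\<^bsub>V\<^esub> u"] simp: radd V.M.l_neg)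
  qed (auto simp: rc radd radd1 radd2 radd3 rr V.M.a_ac)
  then have lQ: "left_module \<Lambda> Q"
    by (intro left_module.intro left_module_axioms.intro V.R.ring_axioms)
      (auto simp: rc radd radd1 radd2 rr rsm rsm2 V.smult_l_distr V.smult_r_distr V.smult_assoc1)
  have lin: "lin \<Lambda> V Q r" by (auto simp: lin_def radd rsm)
  have "fg_set \<Lambda> Q (carrier Q)" using fg_set_image[OF lV lQ lin fg] by simp
  then have "Q \<in> mod_cat \<Lambda>" using lQ by (simp add: mod_cat_iff_fg_set)
  moreover have "r x = \<zero>\<^bsub>Q\<^esub> \<longleftrightarrow> x \<in> N" if x: "x \<in> carrier V" for x
  proof
    assume "x \<in> N" then show "r x = \<zero>\<^bsub>Q\<^esub>" using x by (auto intro!: req)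
  next
    assume "r x = \<zero>\<^bsub>Q\<^esub>"
    then have "r x \<ominus>\<^bsub>V\<^esub> \<zero>\<^bsub>V\<^esub> \<in> N" using r[OF V.M.zero_closed] Q(2) by metis
    then have "x \<ominus>\<^bsub>V\<^esub> \<zero>\<^bsub>V\<^esub> \<in> N" using trans[of x "r x" "\<zero>\<^bsub>V\<^esub>"] symm[of "r x" x] r[OF x] x by simp
    then show "x \<in> N" using x by simp
  qed
  ultimately show thesis using that[of Q r] lin by simp
qed

section \<open>Short exact sequences in the module category\<close>

lemma mod_catD: "V \<in> mod_cat \<Lambda> \<Longrightarrow> left_module \<Lambda> V"
  by (simp add: mod_cat_def)

text \<open>\<open>all_ses\<close> with \<open>lin\<close> in place of \<open>Hom_set\<close>, so
  that maps need not be extensional; in particular inclusions can be written as \<lambda>x.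
  x.\<close>

definition ses ::
  "('r, 'a) ring_scheme \<Rightarrow> ('r, 'm) module \<Rightarrow> ('m \<Rightarrow> 'm) \<Rightarrow> ('r, 'm) module \<Rightarrow> ('m \<Rightarrow> 'm) \<Rightarrow>
     ('r, 'm) module \<Rightarrow> bool" where
  "ses \<Lambda> A f B g C \<longleftrightarrow> A \<in> mod_cat \<Lambda> \<and> B \<in> mod_cat \<Lambda> \<and> C \<in> mod_cat \<Lambda> \<and> lin \<Lambda> A B f \<and> lin \<Lambda> B C g \<and>
     inj_on f (carrier A) \<and> f ` carrier A = {y \<in> carrier B. g y = \<zero>\<^bsub>C\<^esub>} \<and> g ` carrier B = carrier C"

definition projective :: "('r, 'a) ring_scheme \<Rightarrow> ('r, 'm) module \<Rightarrow> bool" where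
  "projective \<Lambda> P \<longleftrightarrow> P \<in> mod_cat \<Lambda> \<and>
     (\<forall>(B :: ('r, 'm) module) (C :: ('r, 'm) module) g h.
        B \<in> mod_cat \<Lambda> \<and> C \<in> mod_cat \<Lambda> \<and> lin \<Lambda> B C g \<and> g ` carrier B = carrier C \<and> lin \<Lambda> P C h \<longrightarrow>
        (\<exists>k. lin \<Lambda> P B k \<and> (\<forall>x\<in>carrier P. g (k x) = h x)))"

lemma sesD:
  assumes "ses \<Lambda> A f B g C"
  shows "A \<in> mod_cat \<Lambda>" "B \<in> mod_cat \<Lambda>" "C \<in> mod_cat \<Lambda>" "lin \<Lambda> A B f" "lin \<Lambda> B C g"
    "inj_on f (carrier A)" "f ` carrier A = {y \<in> carrier B. g y = \<zero>\<^bsub>C\<^esub>}" "g ` carrier B = carrier C"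
    "left_module \<Lambda> A" "left_module \<Lambda> B" "left_module \<Lambda> C"
  using assms by (auto simp: ses_def mod_cat_def)

lemma ses_comp_zero: "ses \<Lambda> A f B g C \<Longrightarrow> x \<in> carrier A \<Longrightarrow> g (f x) = \<zero>\<^bsub>C\<^esub>"
  by (auto simp: ses_def)

lemma ses_inj: "ses \<Lambda> A f B g C \<Longrightarrow> f x = f y \<Longrightarrow> x \<in> carrier A \<Longrightarrow> y \<in> carrier A \<Longrightarrow> x = y"
  by (auto simp: ses_def dest: inj_onD)

lemma ses_kerE:
  assumes "ses \<Lambda> A f B g C" "y \<in> carrier B" "g y = \<zero>\<^bsub>C\<^esub>"
  obtains x where "x \<in> carrier A" "y = f x"
  using assms by (auto simp: ses_def)

lemma ses_surjE:
  assumes "ses \<Lambda> A f B g C" "z \<in> carrier C"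
  obtains y where "y \<in> carrier B" "g y = z"
proof -
  have "z \<in> g ` carrier B" using assms by (auto simp: ses_def)
  then show thesis using that by blast
qed

lemma lin_comp: "lin \<Lambda> U V f \<Longrightarrow> lin \<Lambda> V W g \<Longrightarrow> lin \<Lambda> U W (\<lambda>x. g (f x))"
  by (simp add: lin_def)

lemma lin_id: "lin \<Lambda> V V (\<lambda>x. x)"
  by (simp add: lin_def)

lemma lin_const_zero: "left_module \<Lambda> W \<Longrightarrow> lin \<Lambda> V W (\<lambda>x. \<zero>\<^bsub>W\<^esub>)"
  by (auto simp: lin_def left_module.smult_r_zero abelian_monoid.l_zero
      left_module_def abelian_group_def abelian_monoid.zero_closed)

lemma lin_sum:
  assumes W: "left_module \<Lambda> W" and f: "lin \<Lambda> V W f" and g: "lin \<Lambda> V W g"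
  shows "lin \<Lambda> V W (\<lambda>x. f x \<oplus>\<^bsub>W\<^esub> g x)"
proof -
  interpret W: left_module \<Lambda> W by (rule W)
  show ?thesis using f g by (auto simp: lin_def W.M.a_ac W.smult_r_distr)
qed

lemma lin_diff:
  assumes W: "left_module \<Lambda> W" and f: "lin \<Lambda> V W f" and g: "lin \<Lambda> V W g"
  shows "lin \<Lambda> V W (\<lambda>x. f x \<ominus>\<^bsub>W\<^esub> g x)"
proof -
  interpret W: left_module \<Lambda> W by (rule W)
  show ?thesis using f g by (auto simp: lin_def W.add_diff_add W.smult_diff)
qed

lemma projectiveE:
  fixes B C :: "('r, 'm) module" and P :: "('r, 'm) module"
  assumes "projective \<Lambda> P" "B \<in> mod_cat \<Lambda>" "C \<in> mod_cat \<Lambda>" "lin \<Lambda> B C g" "g ` carrier B = carrier C" "lin \<Lambda> P C h"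
  obtains k where "lin \<Lambda> P B k" "\<And>x. x \<in> carrier P \<Longrightarrow> g (k x) = h x"
  using assms unfolding projective_def by blast

lemma projective_lift:
  fixes P B :: "('r, 'm) module"
  assumes "projective \<Lambda> P" "ses \<Lambda> A f B g C" "lin \<Lambda> P C h"
  obtains k where "lin \<Lambda> P B k" "\<And>x. x \<in> carrier P \<Longrightarrow> g (k x) = h x"
  using projectiveE[OF assms(1) _ _ _ _ assms(3), of B g] sesD[OF assms(2)] by blast

text \<open>The universal property of the kernel, with \<open>f\<close> as kernel of
  \<open>g\<close>.\<close>

lemma lin_corestrict:
  assumes A: "ses \<Lambda> A f B g C" and h: "lin \<Lambda> V B h"
    and z: "\<And>x. x \<in> carrier V \<Longrightarrow> g (h x) = \<zero>\<^bsub>C\<^esub>"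
  obtains k where "lin \<Lambda> V A k" "\<And>x. x \<in> carrier V \<Longrightarrow> f (k x) = h x"
proof -
  note s = sesD[OF A]
  interpret A: left_module \<Lambda> A by (rule s)
  define k where "k x = inv_into (carrier A) f (h x)" for x
  have im: "h x \<in> f ` carrier A" if "x \<in> carrier V" for x
    using that z lin_closed[OF h] s(7) by blast
  have fk: "f (k x) = h x" "k x \<in> carrier A" if "x \<in> carrier V" for x
    using im[OF that] by (auto simp: k_def f_inv_into_f inv_into_into)
  have kf: "k x = a" if "a \<in> carrier A" "h x = f a" for a x
    using that s(6) by (simp add: k_def)
  have "lin \<Lambda> V A k"
  proof (rule linI)
    fix x y assume "x \<in> carrier V" "y \<in> carrier V"
    then show "k (x \<oplus>\<^bsub>V\<^esub> y) = k x \<oplus>\<^bsub>A\<^esub> k y"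
      using fk by (intro kf) (auto simp: lin_add[OF h] lin_add[OF s(4)])
  next
    fix a x assume "a \<in> carrier \<Lambda>" "x \<in> carrier V"
    then show "k (a \<odot>\<^bsub>V\<^esub> x) = a \<odot>\<^bsub>A\<^esub> k x"
      using fk by (intro kf) (auto simp: lin_smult[OF h] lin_smult[OF s(4)])
  qed (rule fk)
  then show thesis using that fk by blast
qed

text \<open>The universal property of the cokernel, with \<open>g\<close> as cokernel of
  \<open>f\<close>. Values are read off at chosen preimages; \<open>eq\<close> gives independence of
  the choice.\<close>

lemma lin_factor:
  assumes A: "ses \<Lambda> A f B g C" and h: "lin \<Lambda> B Y h" and Y: "left_module \<Lambda> Y"
    and z: "\<And>x. x \<in> carrier A \<Longrightarrow> h (f x) = \<zero>\<^bsub>Y\<^esub>"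
  obtains k where "lin \<Lambda> C Y k" "\<And>x. x \<in> carrier B \<Longrightarrow> k (g x) = h x"
proof -
  note s = sesD[OF A]
  interpret B: left_module \<Lambda> B by (rule s)
  interpret C: left_module \<Lambda> C by (rule s)
  interpret Y: left_module \<Lambda> Y by (rule Y)
  have eq: "h x = h y" if xy: "x \<in> carrier B" "y \<in> carrier B" "g x = g y" for x y
  proof -
    have "g (x \<ominus>\<^bsub>B\<^esub> y) = \<zero>\<^bsub>C\<^esub>"
      using that lin_closed[OF s(5)] by (simp add: lin_minus[OF s(10,11,5)] C.diff_eq_zero_iff)
    then obtain a where "a \<in> carrier A" "x \<ominus>\<^bsub>B\<^esub> y = f a"
      by (rule ses_kerE[OF A B.M.minus_closed[OF xy(1,2)]])
    then have "h (x \<ominus>\<^bsub>B\<^esub> y) = \<zero>\<^bsub>Y\<^esub>" using z by simp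
    then show ?thesis
      using that lin_closed[OF h] by (simp add: lin_minus[OF s(10) Y h] Y.diff_eq_zero_iff)
  qed
  define k where "k c = h (SOME b. b \<in> carrier B \<and> g b = c)" for c
  have kg: "k (g b) = h b" if "b \<in> carrier B" for b
  proof -
    have "(SOME b'. b' \<in> carrier B \<and> g b' = g b) \<in> carrier B \<and> g (SOME b'. b' \<in> carrier B \<and> g b' = g b) = g b"
      by (rule someI[of _ b]) (use that in auto)
    then show ?thesis unfolding k_def by (metis eq that)
  qed
  have "lin \<Lambda> C Y k"
  proof (rule linI)
    fix x assume "x \<in> carrier C"
    then obtain b where b: "b \<in> carrier B" "g b = x" using ses_surjE[OF A] by blast
    then show "k x \<in> carrier Y" using kg[OF b(1)] lin_closed[OF h b(1)] by simp
    { fix y assume "y \<in> carrier C"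
      then obtain b' where b': "b' \<in> carrier B" "g b' = y" using ses_surjE[OF A] by blast
      show "k (x \<oplus>\<^bsub>C\<^esub> y) = k x \<oplus>\<^bsub>Y\<^esub> k y"
        using b b' kg[of "b \<oplus>\<^bsub>B\<^esub> b'"] kg[of b] kg[of b'] by (simp add: lin_add[OF s(5)] lin_add[OF h]) }
    fix a assume "a \<in> carrier \<Lambda>"
    then show "k (a \<odot>\<^bsub>C\<^esub> x) = a \<odot>\<^bsub>Y\<^esub> k x"
      using b kg[of "a \<odot>\<^bsub>B\<^esub> b"] kg[of b] by (simp add: lin_smult[OF s(5)] lin_smult[OF h])
  qed
  then show thesis using that kg by blast
qed

text \<open>\<open>carrier_type\<close> ties the type variable \<open>'m\<close> to the locale,
  whose size assumptions speak of that type.\<close>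

locale artin_modules = artin_setup K \<phi> \<Lambda>
  for K :: "('k, 'a) ring_scheme" and \<phi> :: "'k \<Rightarrow> 'r" and \<Lambda> :: "('r, 'b) ring_scheme" +
  fixes carrier_type :: "'m itself"
  assumes infinite_type: "infinite (UNIV :: 'm set)"
    and ring_lepoll_type: "carrier \<Lambda> \<lesssim> (UNIV :: 'm set)"
begin

abbreviation mods :: "('r, 'm) module set" where "mods \<equiv> mod_cat \<Lambda>"

text \<open>With one more generator the span is covered by the product of \<Lambda> and the previous
  span, and an infinite type absorbs products of two sets.\<close>

lemma gspan_lepoll:
  assumes V: "left_module \<Lambda> V" and "finite S" "S \<subseteq> carrier V"
  shows "gspan \<Lambda> V S \<lesssim> (UNIV :: 'm set)"
  using assms(2,3)
proof (induct S)
  interpret V: left_module \<Lambda> V by (rule V)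
  case empty
  have "gspan \<Lambda> V {} = {\<zero>\<^bsub>V\<^esub>}"
    using gspan_least[OF V.submod_zero, of "{}"] gspan.zero[of V \<Lambda> "{}"] by auto
  then show ?case by (simp add: infinite_type finite_lepoll_infinite)
next
  interpret V: left_module \<Lambda> V by (rule V)
  case (insert s S)
  let ?f = "\<lambda>(a, z). z \<oplus>\<^bsub>V\<^esub> a \<odot>\<^bsub>V\<^esub> s"
  have "gspan \<Lambda> V (insert s S) \<subseteq> ?f ` (carrier \<Lambda> \<times> gspan \<Lambda> V S)"
    using V.gspan_insertD[of s S] insert by force
  then have "gspan \<Lambda> V (insert s S) \<lesssim> carrier \<Lambda> \<times> gspan \<Lambda> V S"
    by (rule subset_image_lepoll)
  also have "\<dots> \<lesssim> (UNIV :: 'm set) \<times> (UNIV :: 'm set)"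
    using insert ring_lepoll_type by (intro times_lepoll_mono) auto
  also have "\<dots> \<approx> (UNIV :: 'm set)"
    using card_of_Times_same_infinite[OF infinite_type] by (simp add: eqpoll_iff_card_of_ordIso)
  finally show ?case .
qed

text \<open>Transports the structure along an injection of the carrier into \<open>'m\<close>.
  Constructions that live in other types, such as \<open>direct_sum\<close> and
  \<open>regular_module\<close>, return to \<open>mods\<close> in this way.\<close>

lemma realize:
  fixes V :: "('r, 'n) module"
  assumes V: "V \<in> mod_cat \<Lambda>"
  obtains V' :: "('r, 'm) module" and f g where "V' \<in> mod_cat \<Lambda>" "lin \<Lambda> V V' f" "lin \<Lambda> V' V g"
    "\<And>x. x \<in> carrier V \<Longrightarrow> g (f x) = x" "\<And>y. y \<in> carrier V' \<Longrightarrow> f (g y) = y"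
proof -
  interpret V: left_module \<Lambda> V using V by (rule mod_catD)
  have "carrier V \<lesssim> (UNIV :: 'm set)"
    using V gspan_lepoll[OF V.left_module_axioms] by (auto simp: mod_cat_iff_fg_set fg_set_def)
  then obtain e :: "'n \<Rightarrow> 'm" where e: "inj_on e (carrier V)" by (auto simp: lepoll_def)
  define g where "g = inv_into (carrier V) e"
  have ge [simp]: "g (e x) = x" if "x \<in> carrier V" for x using e that by (simp add: g_def)
  define V' :: "('r, 'm) module" where "V' = \<lparr>carrier = e ` carrier V, monoid.mult = undefined, one = undefined,
      ring.zero = e \<zero>\<^bsub>V\<^esub>, add = (\<lambda>x y. e (g x \<oplus>\<^bsub>V\<^esub> g y)), smult = (\<lambda>a x. e (a \<odot>\<^bsub>V\<^esub> g x))\<rparr>"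
  have V' [simp]: "carrier V' = e ` carrier V" "\<zero>\<^bsub>V'\<^esub> = e \<zero>\<^bsub>V\<^esub>" "x \<oplus>\<^bsub>V'\<^esub> y = e (g x \<oplus>\<^bsub>V\<^esub> g y)"
    "a \<odot>\<^bsub>V'\<^esub> x = e (a \<odot>\<^bsub>V\<^esub> g x)" for x y a
    by (simp_all add: V'_def)
  have "abelian_group V'"
  proof (rule abelian_groupI)
    fix x assume "x \<in> carrier V'"
    then obtain u where "u \<in> carrier V" "x = e u" by auto
    then show "\<exists>y\<in>carrier V'. y \<oplus>\<^bsub>V'\<^esub> x = \<zero>\<^bsub>V'\<^esub>"
      by (auto intro!: bexI[of _ "\<ominus>\<^bsub>V\<^esub> u"] simp: V.M.l_neg)
  qed (auto simp: V.M.a_ac)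
  then have lV': "left_module \<Lambda> V'"
    by (intro left_module.intro left_module_axioms.intro V.R.ring_axioms)
      (auto simp: V.smult_l_distr V.smult_r_distr V.smult_assoc1)
  have lin: "lin \<Lambda> V V' e" "lin \<Lambda> V' V g" by (auto simp: lin_def)
  have "fg_set \<Lambda> V' (carrier V')"
    using fg_set_image[OF V.left_module_axioms lV' lin(1)] V by (simp add: mod_cat_iff_fg_set)
  then have "V' \<in> mod_cat \<Lambda>" using lV' by (simp add: mod_cat_iff_fg_set)
  moreover have "g (e x) = x" if "x \<in> carrier V" for x using that by simp
  moreover have "e (g y) = y" if "y \<in> carrier V'" for y using that by auto
  ultimately show thesis using that lin by blast
qed

section \<open>Direct sums, kernels, cokernels, pullbacks and pushouts in
  \<open>mods\<close>\<close>

lemma biprod_exists: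
  fixes U V :: "('r, 'm) module"
  assumes "U \<in> mods" "V \<in> mods"
  obtains W i j p q where "W \<in> mods" "biprod \<Lambda> U V W i j p q"
proof -
  note l = mod_catD[OF assms(1)] mod_catD[OF assms(2)]
  interpret U: left_module \<Lambda> U by (rule l)
  interpret V: left_module \<Lambda> V by (rule l)
  obtain W :: "('r, 'm) module" and f g where W: "W \<in> mod_cat \<Lambda>" "lin \<Lambda> (direct_sum U V) W f" "lin \<Lambda> W (direct_sum U V) g"
    "\<And>x. x \<in> carrier (direct_sum U V) \<Longrightarrow> g (f x) = x" "\<And>y. y \<in> carrier W \<Longrightarrow> f (g y) = y"
    using realize[OF direct_sum_mod_cat[OF assms]] by metis
  note b = direct_sum_biprod[OF l, unfolded biprod_def]
  have "biprod \<Lambda> U V W (\<lambda>x. f (x, \<zero>\<^bsub>V\<^esub>)) (\<lambda>y. f (\<zero>\<^bsub>U\<^esub>, y)) (\<lambda>w. fst (g w)) (\<lambda>w. snd (g w))"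
    unfolding biprod_def
  proof (intro conjI ballI)
    show "lin \<Lambda> U W (\<lambda>x. f (x, \<zero>\<^bsub>V\<^esub>))" "lin \<Lambda> V W (\<lambda>y. f (\<zero>\<^bsub>U\<^esub>, y))"
      "lin \<Lambda> W U (\<lambda>w. fst (g w))" "lin \<Lambda> W V (\<lambda>w. snd (g w))"
      using b lin_comp[OF _ W(2)] lin_comp[OF W(3)] by blast+
    fix w assume w: "w \<in> carrier W"
    then have gw: "g w \<in> carrier (direct_sum U V)" using lin_closed[OF W(3)] by blast
    then have "f (fst (g w), \<zero>\<^bsub>V\<^esub>) \<oplus>\<^bsub>W\<^esub> f (\<zero>\<^bsub>U\<^esub>, snd (g w)) = f ((fst (g w), \<zero>\<^bsub>V\<^esub>) \<oplus>\<^bsub>direct_sum U V\<^esub> (\<zero>\<^bsub>U\<^esub>, snd (g w)))"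
      using b by (intro lin_add[OF W(2), symmetric]) (auto simp: lin_def)
    also have "(fst (g w), \<zero>\<^bsub>V\<^esub>) \<oplus>\<^bsub>direct_sum U V\<^esub> (\<zero>\<^bsub>U\<^esub>, snd (g w)) = g w"
      using b gw by auto
    finally show "f (fst (g w), \<zero>\<^bsub>V\<^esub>) \<oplus>\<^bsub>W\<^esub> f (\<zero>\<^bsub>U\<^esub>, snd (g w)) = w" using W(5) w by simp
  next
    fix x assume "x \<in> carrier U"
    then show "fst (g (f (x, \<zero>\<^bsub>V\<^esub>))) = x" "snd (g (f (x, \<zero>\<^bsub>V\<^esub>))) = \<zero>\<^bsub>V\<^esub>"
      using W(4)[of "(x, \<zero>\<^bsub>V\<^esub>)"] V.M.zero_closed by auto
  next
    fix y assume "y \<in> carrier V"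
    then show "snd (g (f (\<zero>\<^bsub>U\<^esub>, y))) = y" "fst (g (f (\<zero>\<^bsub>U\<^esub>, y))) = \<zero>\<^bsub>U\<^esub>"
      using W(4)[of "(\<zero>\<^bsub>U\<^esub>, y)"] U.M.zero_closed by auto
  qed
  then show thesis using that W(1) by blast
qed

lemma kernel_ses:
  fixes B C :: "('r, 'm) module"
  assumes "B \<in> mods" "C \<in> mods" "lin \<Lambda> B C g" "g ` carrier B = carrier C"
  shows "ses \<Lambda> (B\<lparr>carrier := {y \<in> carrier B. g y = \<zero>\<^bsub>C\<^esub>}\<rparr>) (\<lambda>x. x) B g C"
  using submod_mod_cat[OF assms(1) lin_kernel_submod[OF mod_catD mod_catD assms(3)]] assms
  by (auto simp: ses_def lin_def)

lemma cokernel_ses: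
  fixes A B :: "('r, 'm) module"
  assumes "A \<in> mods" "B \<in> mods" "lin \<Lambda> A B f" "inj_on f (carrier A)"
  obtains C g where "ses \<Lambda> A f B g C"
proof -
  have sub: "submod \<Lambda> B (f ` carrier A)"
    by (rule lin_image_submod[OF _ _ assms(3) left_module.submod_carrier]) (use assms mod_catD in blast)+
  obtain Q :: "('r, 'm) module" and p where "Q \<in> mod_cat \<Lambda>" "lin \<Lambda> B Q p" "p ` carrier B = carrier Q"
    "\<And>x. x \<in> carrier B \<Longrightarrow> p x = \<zero>\<^bsub>Q\<^esub> \<longleftrightarrow> x \<in> f ` carrier A"
    using quotient_exists[OF assms(2) sub] by metis
  then have "ses \<Lambda> A f B p Q"
    using assms submodD(1)[OF sub] by (auto simp: ses_def)
  then show thesis by (rule that)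
qed

lemma biprod_ses:
  assumes "biprod \<Lambda> U V W i j p q" "U \<in> mods" "V \<in> mods" "W \<in> mods"
  shows "ses \<Lambda> U i W q V" "ses \<Lambda> V j W p U"
proof -
  interpret U: left_module \<Lambda> U using assms mod_catD by blast
  interpret V: left_module \<Lambda> V using assms mod_catD by blast
  interpret W: left_module \<Lambda> W using assms mod_catD by blast
  note b = assms(1)[unfolded biprod_def]
  have i0: "i \<zero>\<^bsub>U\<^esub> = \<zero>\<^bsub>W\<^esub>" and j0: "j \<zero>\<^bsub>V\<^esub> = \<zero>\<^bsub>W\<^esub>"
    using b lin_zero[OF U.left_module_axioms W.left_module_axioms, of i]
      lin_zero[OF V.left_module_axioms W.left_module_axioms, of j] by auto
  have c: "x \<in> carrier U \<Longrightarrow> i x \<in> carrier W" "y \<in> carrier V \<Longrightarrow> j y \<in> carrier W"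
    "w \<in> carrier W \<Longrightarrow> p w \<in> carrier U" "w \<in> carrier W \<Longrightarrow> q w \<in> carrier V" for x y w
    using b by (auto simp: lin_def)
  have inj: "inj_on i (carrier U)" "inj_on j (carrier V)"
    using b by (metis inj_onI)+
  have k1: "i ` carrier U = {w \<in> carrier W. q w = \<zero>\<^bsub>V\<^esub>}"
  proof (intro subset_antisym subsetI)
    fix w assume "w \<in> {w \<in> carrier W. q w = \<zero>\<^bsub>V\<^esub>}"
    then have w: "w \<in> carrier W" "q w = \<zero>\<^bsub>V\<^esub>" by auto
    then have "i (p w) \<oplus>\<^bsub>W\<^esub> \<zero>\<^bsub>W\<^esub> = w" using b j0 by metis
    then have "w = i (p w)" using c(1)[OF c(3)[OF w(1)]] by simp
    then show "w \<in> i ` carrier U" using c(3)[OF w(1)] by blast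
  qed (use b c in auto)
  have k2: "j ` carrier V = {w \<in> carrier W. p w = \<zero>\<^bsub>U\<^esub>}"
  proof (intro subset_antisym subsetI)
    fix w assume "w \<in> {w \<in> carrier W. p w = \<zero>\<^bsub>U\<^esub>}"
    then have w: "w \<in> carrier W" "p w = \<zero>\<^bsub>U\<^esub>" by auto
    then have "\<zero>\<^bsub>W\<^esub> \<oplus>\<^bsub>W\<^esub> j (q w) = w" using b i0 by metis
    then have "w = j (q w)" using c(2)[OF c(4)[OF w(1)]] by simp
    then show "w \<in> j ` carrier V" using c(4)[OF w(1)] by blast
  qed (use b c in auto)
  have s: "q ` carrier W = carrier V" "p ` carrier W = carrier U"
  proof -
    have "y \<in> q ` carrier W" if "y \<in> carrier V" for y using b c(2)[OF that] that by (metis imageI)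
    then show "q ` carrier W = carrier V" using c(4) by blast
    have "x \<in> p ` carrier W" if "x \<in> carrier U" for x using b c(1)[OF that] that by (metis imageI)
    then show "p ` carrier W = carrier U" using c(3) by blast
  qed
  show "ses \<Lambda> U i W q V" "ses \<Lambda> V j W p U"
    using assms b inj k1 k2 s by (auto simp: ses_def)
qed

text \<open>The kernel of g a - p b on a direct sum of \<open>B\<close> and \<open>P\<close>. The
  last two conclusions say, without pairs, that \<open>W\<close> consists of the compatible pairs:
  the two coordinates separate points, and every compatible pair occurs.\<close>

lemma pullback_exists:
  fixes B P C :: "('r, 'm) module"
  assumes B: "B \<in> mods" and P: "P \<in> mods" and C: "C \<in> mods"
    and g: "lin \<Lambda> B C g" and p: "lin \<Lambda> P C p"
  obtains W a b where "W \<in> mods" "lin \<Lambda> W B a" "lin \<Lambda> W P b" "\<And>w. w \<in> carrier W \<Longrightarrow> g (a w) = p (b w)"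
    "\<And>w. w \<in> carrier W \<Longrightarrow> a w = \<zero>\<^bsub>B\<^esub> \<Longrightarrow> b w = \<zero>\<^bsub>P\<^esub> \<Longrightarrow> w = \<zero>\<^bsub>W\<^esub>"
    "\<And>x y. x \<in> carrier B \<Longrightarrow> y \<in> carrier P \<Longrightarrow> g x = p y \<Longrightarrow> \<exists>w\<in>carrier W. a w = x \<and> b w = y"
proof -
  interpret B: left_module \<Lambda> B using B by (rule mod_catD)
  interpret P: left_module \<Lambda> P using P by (rule mod_catD)
  interpret C: left_module \<Lambda> C using C by (rule mod_catD)
  obtain D i j a b where D: "D \<in> mods" "biprod \<Lambda> B P D i j a b" using biprod_exists[OF B P] by metis
  interpret D: left_module \<Lambda> D using D(1) by (rule mod_catD)
  note d = D(2)[unfolded biprod_def]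
  have la: "lin \<Lambda> D B a" and lb: "lin \<Lambda> D P b" using d by auto
  let ?h = "\<lambda>w. g (a w) \<ominus>\<^bsub>C\<^esub> p (b w)"
  have h: "lin \<Lambda> D C ?h"
    by (intro lin_diff C.left_module_axioms lin_comp[OF la g] lin_comp[OF lb p])
  let ?N = "{w \<in> carrier D. ?h w = \<zero>\<^bsub>C\<^esub>}"
  let ?W = "D\<lparr>carrier := ?N\<rparr>"
  have hz: "?h w = \<zero>\<^bsub>C\<^esub> \<longleftrightarrow> g (a w) = p (b w)" if "w \<in> carrier D" for w
    using that lin_closed[OF lin_comp[OF la g]] lin_closed[OF lin_comp[OF lb p]] by (simp add: C.diff_eq_zero_iff)
  have W: "?W \<in> mods"
    by (rule submod_mod_cat[OF D(1) lin_kernel_submod[OF D.left_module_axioms C.left_module_axioms h]])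
  show thesis
  proof (rule that[of ?W a b])
    show "lin \<Lambda> ?W B a" "lin \<Lambda> ?W P b" using la lb by (auto simp: lin_def)
    show "g (a w) = p (b w)" if "w \<in> carrier ?W" for w
      using that hz[of w] by simp
    show "w = \<zero>\<^bsub>?W\<^esub>" if w: "w \<in> carrier ?W" "a w = \<zero>\<^bsub>B\<^esub>" "b w = \<zero>\<^bsub>P\<^esub>" for w
    proof -
      have "w = i \<zero>\<^bsub>B\<^esub> \<oplus>\<^bsub>D\<^esub> j \<zero>\<^bsub>P\<^esub>" using d w by force
      then show ?thesis
        using d lin_zero[OF B.left_module_axioms D.left_module_axioms, of i]
          lin_zero[OF P.left_module_axioms D.left_module_axioms, of j] by simp
    qed
    fix x y assume xy: "x \<in> carrier B" "y \<in> carrier P" "g x = p y"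
    let ?w = "i x \<oplus>\<^bsub>D\<^esub> j y"
    have c: "i x \<in> carrier D" "j y \<in> carrier D" using d xy by (auto simp: lin_def)
    have "a ?w = x" "b ?w = y"
      using d xy c by (auto simp: lin_add[OF la] lin_add[OF lb])
    then show "\<exists>w\<in>carrier ?W. a w = x \<and> b w = y"
      using xy c hz[of ?w] by (intro bexI[of _ ?w]) auto
  qed (rule W)
qed

text \<open>Pulling either sequence back along the surjection of the other keeps its kernel, so
  \<open>W\<close> is an extension of \<open>P\<close> by \<open>A\<close> and of \<open>B\<close>
  by \<open>Z\<close>. With \<open>P\<close> projective this compares an arbitrary extension ending
  in \<open>C\<close> with a projective presentation of \<open>C\<close>.\<close>

lemma pullback_ses:
  assumes A: "ses \<Lambda> A f B g C" and Z: "ses \<Lambda> Z z P p (C :: ('r, 'm) module)"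
  obtains W a b u v where "ses \<Lambda> A u W b P" "ses \<Lambda> Z v W a B"
    "\<And>x. x \<in> carrier A \<Longrightarrow> a (u x) = f x" "\<And>x. x \<in> carrier Z \<Longrightarrow> b (v x) = z x"
    "\<And>w. w \<in> carrier W \<Longrightarrow> g (a w) = p (b w)"
proof -
  note s = sesD[OF A] and t = sesD[OF Z]
  interpret A: left_module \<Lambda> A by (rule s)
  interpret B: left_module \<Lambda> B by (rule s)
  interpret C: left_module \<Lambda> C by (rule s)
  interpret Z: left_module \<Lambda> Z by (rule t)
  interpret P: left_module \<Lambda> P by (rule t)
  obtain W a b where W: "W \<in> mods" and la: "lin \<Lambda> W B a" and lb: "lin \<Lambda> W P b"
    and eq: "\<And>w. w \<in> carrier W \<Longrightarrow> g (a w) = p (b w)"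
    and inj: "\<And>w. w \<in> carrier W \<Longrightarrow> a w = \<zero>\<^bsub>B\<^esub> \<Longrightarrow> b w = \<zero>\<^bsub>P\<^esub> \<Longrightarrow> w = \<zero>\<^bsub>W\<^esub>"
    and ex: "\<And>x y. x \<in> carrier B \<Longrightarrow> y \<in> carrier P \<Longrightarrow> g x = p y \<Longrightarrow> \<exists>w\<in>carrier W. a w = x \<and> b w = y"
    by (rule pullback_exists[OF s(2) t(2) s(3) s(5) t(5)]) blast
  interpret W: left_module \<Lambda> W using W by (rule mod_catD)
  have surj_a: "a ` carrier W = carrier B"
  proof (intro subset_antisym subsetI)
    fix x assume x: "x \<in> carrier B"
    then obtain y where "y \<in> carrier P" "p y = g x" using ses_surjE[OF Z] lin_closed[OF s(5)] by blast
    then show "x \<in> a ` carrier W" using ex[of x y] x by auto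
  qed (use lin_closed[OF la] in blast)
  have surj_b: "b ` carrier W = carrier P"
  proof (intro subset_antisym subsetI)
    fix y assume y: "y \<in> carrier P"
    then obtain x where "x \<in> carrier B" "g x = p y" using ses_surjE[OF A] lin_closed[OF t(5)] by blast
    then show "y \<in> b ` carrier W" using ex[of x y] y by auto
  qed (use lin_closed[OF lb] in blast)
  have jinj: "w = w'" if "w \<in> carrier W" "w' \<in> carrier W" "a w = a w'" "b w = b w'" for w w'
  proof -
    have "w \<ominus>\<^bsub>W\<^esub> w' = \<zero>\<^bsub>W\<^esub>"
      using that lin_closed[OF la] lin_closed[OF lb]
      by (intro inj) (auto simp: lin_minus[OF W.left_module_axioms B.left_module_axioms la]
          lin_minus[OF W.left_module_axioms P.left_module_axioms lb] B.diff_eq_zero_iff P.diff_eq_zero_iff)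
    then show ?thesis using that by (simp add: W.diff_eq_zero_iff)
  qed
  note g0 = lin_zero[OF s(10,11,5)] and p0 = lin_zero[OF t(10,11,5)]
  note fc = lin_closed[OF s(4)] and zc = lin_closed[OF t(4)]
  \<comment> \<open>The element with coordinates (f x, 0). It is unique by \<open>jinj\<close>,
    which also yields that \<open>u\<close> is linear.\<close>
  define u where "u x = (SOME w. w \<in> carrier W \<and> a w = f x \<and> b w = \<zero>\<^bsub>P\<^esub>)" for x
  have u: "u x \<in> carrier W \<and> a (u x) = f x \<and> b (u x) = \<zero>\<^bsub>P\<^esub>" if "x \<in> carrier A" for x
    unfolding u_def by (rule someI_ex)
      (use ex[OF fc[OF that] P.M.zero_closed] ses_comp_zero[OF A that] p0 in metis)
  have u': "u x \<in> carrier W" "a (u x) = f x" "b (u x) = \<zero>\<^bsub>P\<^esub>" if "x \<in> carrier A" for x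
    using u[OF that] by auto
  have lu: "lin \<Lambda> A W u"
  proof (rule linI)
    fix x y assume xy: "x \<in> carrier A" "y \<in> carrier A"
    show "u (x \<oplus>\<^bsub>A\<^esub> y) = u x \<oplus>\<^bsub>W\<^esub> u y"
      by (rule jinj) (simp_all add: xy u' lin_add[OF la] lin_add[OF lb] lin_add[OF s(4)])
  next
    fix c x assume xy: "c \<in> carrier \<Lambda>" "x \<in> carrier A"
    show "u (c \<odot>\<^bsub>A\<^esub> x) = c \<odot>\<^bsub>W\<^esub> u x"
      by (rule jinj) (simp_all add: xy u' lin_smult[OF la] lin_smult[OF lb] lin_smult[OF s(4)])
  qed (use u in blast)
  define v where "v x = (SOME w. w \<in> carrier W \<and> a w = \<zero>\<^bsub>B\<^esub> \<and> b w = z x)" for x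
  have v: "v x \<in> carrier W \<and> a (v x) = \<zero>\<^bsub>B\<^esub> \<and> b (v x) = z x" if "x \<in> carrier Z" for x
    unfolding v_def by (rule someI_ex)
      (use ex[OF B.M.zero_closed zc[OF that]] ses_comp_zero[OF Z that] g0 in metis)
  have v': "v x \<in> carrier W" "a (v x) = \<zero>\<^bsub>B\<^esub>" "b (v x) = z x" if "x \<in> carrier Z" for x
    using v[OF that] by auto
  have lv: "lin \<Lambda> Z W v"
  proof (rule linI)
    fix x y assume xy: "x \<in> carrier Z" "y \<in> carrier Z"
    show "v (x \<oplus>\<^bsub>Z\<^esub> y) = v x \<oplus>\<^bsub>W\<^esub> v y"
      by (rule jinj) (simp_all add: xy v' lin_add[OF la] lin_add[OF lb] lin_add[OF t(4)])
  next
    fix c x assume xy: "c \<in> carrier \<Lambda>" "x \<in> carrier Z"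
    show "v (c \<odot>\<^bsub>Z\<^esub> x) = c \<odot>\<^bsub>W\<^esub> v x"
      by (rule jinj) (simp_all add: xy v' lin_smult[OF la] lin_smult[OF lb] lin_smult[OF t(4)])
  qed (use v in blast)
  have "ses \<Lambda> A u W b P" unfolding ses_def
  proof (intro conjI)
    show "inj_on u (carrier A)" using u ses_inj[OF A] by (metis inj_onI)
    show "u ` carrier A = {y \<in> carrier W. b y = \<zero>\<^bsub>P\<^esub>}"
    proof (intro subset_antisym subsetI)
      fix w assume w: "w \<in> {y \<in> carrier W. b y = \<zero>\<^bsub>P\<^esub>}"
      then have "g (a w) = \<zero>\<^bsub>C\<^esub>" using eq[of w] p0 by auto
      then obtain x where "x \<in> carrier A" "a w = f x" using ses_kerE[OF A, of "a w"] w lin_closed[OF la] by blast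
      then show "w \<in> u ` carrier A" using w u jinj[of w "u x"] by auto
    qed (use u in auto)
  qed (use s t W lu lb surj_b in auto)
  moreover have "ses \<Lambda> Z v W a B" unfolding ses_def
  proof (intro conjI)
    show "inj_on v (carrier Z)" using v ses_inj[OF Z] by (metis inj_onI)
    show "v ` carrier Z = {y \<in> carrier W. a y = \<zero>\<^bsub>B\<^esub>}"
    proof (intro subset_antisym subsetI)
      fix w assume w: "w \<in> {y \<in> carrier W. a y = \<zero>\<^bsub>B\<^esub>}"
      then have "p (b w) = \<zero>\<^bsub>C\<^esub>" using eq[of w] g0 by auto
      then obtain x where "x \<in> carrier Z" "b w = z x" using ses_kerE[OF Z, of "b w"] w lin_closed[OF lb] by blast
      then show "w \<in> v ` carrier Z" using w v jinj[of w "v x"] by auto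
    qed (use v in auto)
  qed (use s t W lv la surj_a in auto)
  ultimately show thesis using that u v eq by blast
qed

text \<open>The cokernel of x \<mapsto> (h x, - f x) from \<open>A\<close> to a direct sum of
  \<open>Y\<close> and \<open>P\<close>. The sign makes the square commute; injectivity of
  \<open>f\<close> gives that of \<open>u\<close>.\<close>

lemma pushout_ses:
  assumes A: "ses \<Lambda> A f P p (Z :: ('r, 'm) module)" and Y: "Y \<in> mods" and h: "lin \<Lambda> A Y h"
  obtains Y' u e q where "ses \<Lambda> Y u Y' q Z" "lin \<Lambda> P Y' e"
    "\<And>x. x \<in> carrier A \<Longrightarrow> e (f x) = u (h x)" "\<And>x. x \<in> carrier P \<Longrightarrow> q (e x) = p x"
proof -
  note s = sesD[OF A]
  interpret A: left_module \<Lambda> A by (rule s)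
  interpret P: left_module \<Lambda> P by (rule s)
  interpret Z: left_module \<Lambda> Z by (rule s)
  interpret Y: left_module \<Lambda> Y using Y by (rule mod_catD)
  obtain D i j a b where D: "D \<in> mods" "biprod \<Lambda> Y P D i j a b" using biprod_exists[OF Y s(2)] by metis
  interpret D: left_module \<Lambda> D using D(1) by (rule mod_catD)
  note d = D(2)[unfolded biprod_def]
  have li: "lin \<Lambda> Y D i" and lj: "lin \<Lambda> P D j" and la: "lin \<Lambda> D Y a" and lb: "lin \<Lambda> D P b" using d by auto
  let ?k = "\<lambda>x. i (h x) \<ominus>\<^bsub>D\<^esub> j (f x)"
  have lk: "lin \<Lambda> A D ?k"
    by (intro lin_diff D.left_module_axioms lin_comp[OF h li] lin_comp[OF s(4) lj])
  note cl = lin_closed[OF li] lin_closed[OF lj]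
  note hc = lin_closed[OF h] and fc = lin_closed[OF s(4)]
  have bk: "b (?k x) = \<ominus>\<^bsub>P\<^esub> f x" and ak: "a (?k x) = h x" if "x \<in> carrier A" for x
  proof -
    have *: "i (h x) \<in> carrier D" "j (f x) \<in> carrier D" using that cl hc fc by auto
    show "b (?k x) = \<ominus>\<^bsub>P\<^esub> f x" "a (?k x) = h x"
      using d * hc[OF that] fc[OF that]
      by (auto simp: lin_minus[OF D.left_module_axioms P.left_module_axioms lb]
          lin_minus[OF D.left_module_axioms Y.left_module_axioms la] P.M.minus_eq)
  qed
  have "inj_on ?k (carrier A)"
    using bk fc ses_inj[OF A] by (intro inj_onI) (metis P.M.minus_minus)
  then obtain Y' c where Y': "ses \<Lambda> A ?k D c Y'" using cokernel_ses[OF s(1) D(1) lk] by blast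
  note t = sesD[OF Y']
  interpret Y': left_module \<Lambda> Y' by (rule t)
  have pb: "lin \<Lambda> D Z (\<lambda>w. p (b w))" by (rule lin_comp[OF lb s(5)])
  have pbk: "p (b (?k x)) = \<zero>\<^bsub>Z\<^esub>" if "x \<in> carrier A" for x
    using bk[OF that] fc[OF that] ses_comp_zero[OF A that]
    by (simp add: lin_uminus[OF s(10,11,5)])
  obtain q where q: "lin \<Lambda> Y' Z q" "\<And>x. x \<in> carrier D \<Longrightarrow> q (c x) = p (b x)"
    using lin_factor[OF Y' pb s(11)] pbk by blast
  let ?u = "\<lambda>y. c (i y)" and ?e = "\<lambda>x. c (j x)"
  have lu: "lin \<Lambda> Y Y' ?u" and le: "lin \<Lambda> P Y' ?e"
    by (rule lin_comp[OF li t(5)] lin_comp[OF lj t(5)])+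
  have ef: "?e (f x) = ?u (h x)" if "x \<in> carrier A" for x
  proof -
    have *: "i (h x) \<in> carrier D" "j (f x) \<in> carrier D" using that cl hc fc by auto
    have "c (i (h x)) \<ominus>\<^bsub>Y'\<^esub> c (j (f x)) = \<zero>\<^bsub>Y'\<^esub>"
      using ses_comp_zero[OF Y' that] * by (simp add: lin_minus[OF t(10,11,5)])
    then show ?thesis using * lin_closed[OF t(5)] by (simp add: Y'.diff_eq_zero_iff)
  qed
  have inju: "inj_on ?u (carrier Y)"
    unfolding lin_inj_iff[OF Y.left_module_axioms Y'.left_module_axioms lu]
  proof (intro ballI impI)
    fix y assume y: "y \<in> carrier Y" "c (i y) = \<zero>\<^bsub>Y'\<^esub>"
    then have iy: "i y \<in> carrier D" using cl by blast
    from ses_kerE[OF Y' iy y(2)] obtain x where x: "x \<in> carrier A" "i y = ?k x" by metis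
    then have "\<zero>\<^bsub>P\<^esub> = \<ominus>\<^bsub>P\<^esub> f x" using bk[of x] d y(1) by metis
    then have "f x = \<zero>\<^bsub>P\<^esub>" 
      using fc[OF x(1)] P.diff_eq_zero_iff[of "\<zero>\<^bsub>P\<^esub>" "f x"] by (simp add: P.M.minus_eq)
    then have "x = \<zero>\<^bsub>A\<^esub>" using ses_inj[OF A, of x "\<zero>\<^bsub>A\<^esub>"] x lin_zero[OF s(9,10,4)] by simp
    then have "h x = \<zero>\<^bsub>Y\<^esub>" using lin_zero[OF s(9) Y.left_module_axioms h] by simp
    moreover have "y = h x" using ak[OF x(1)] x(2) d y(1) by metis
    ultimately show "y = \<zero>\<^bsub>Y\<^esub>" by simp
  qed
  have "ses \<Lambda> Y ?u Y' q Z" unfolding ses_def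
  proof (intro conjI)
    show "?u ` carrier Y = {y \<in> carrier Y'. q y = \<zero>\<^bsub>Z\<^esub>}"
    proof (intro subset_antisym subsetI)
      fix w assume "w \<in> ?u ` carrier Y"
      then obtain y where y: "y \<in> carrier Y" "w = c (i y)" by blast
      then have "q w = p \<zero>\<^bsub>P\<^esub>" using q(2)[of "i y"] cl(1)[OF y(1)] d by auto
      then show "w \<in> {y \<in> carrier Y'. q y = \<zero>\<^bsub>Z\<^esub>}"
        using y lin_closed[OF lu] lin_zero[OF s(10,11,5)] by simp
    next
      fix w assume "w \<in> {y \<in> carrier Y'. q y = \<zero>\<^bsub>Z\<^esub>}"
      then have w: "w \<in> carrier Y'" "q w = \<zero>\<^bsub>Z\<^esub>" by auto
      then obtain x where x: "x \<in> carrier D" "c x = w" using ses_surjE[OF Y'] by blast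
      have bx: "b x \<in> carrier P" and ax: "a x \<in> carrier Y" using x lin_closed[OF lb] lin_closed[OF la] by auto
      have "p (b x) = \<zero>\<^bsub>Z\<^esub>" using q(2)[OF x(1)] x w by simp
      then obtain r where r: "r \<in> carrier A" "b x = f r" using ses_kerE[OF A bx] by metis
      have "w = c (i (a x) \<oplus>\<^bsub>D\<^esub> j (f r))" using x d r by force
      also have "\<dots> = ?u (a x) \<oplus>\<^bsub>Y'\<^esub> ?u (h r)"
        using ax r fc cl ef[OF r(1)] by (simp add: lin_add[OF t(5)])
      also have "\<dots> = ?u (a x \<oplus>\<^bsub>Y\<^esub> h r)" using ax hc[OF r(1)] by (simp add: lin_add[OF lu])
      finally show "w \<in> ?u ` carrier Y" using ax hc[OF r(1)] by blast
    qed
    show "q ` carrier Y' = carrier Z"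
    proof (intro subset_antisym subsetI)
      fix x assume "x \<in> carrier Z"
      then obtain y where y: "y \<in> carrier P" "p y = x" using ses_surjE[OF A] by blast
      then have "q (c (j y)) = x" using q(2)[of "j y"] cl(2)[OF y(1)] d by auto
      then show "x \<in> q ` carrier Y'" using lin_closed[OF le y(1)] by blast
    qed (use lin_closed[OF q(1)] in blast)
  qed (use Y t s lu q inju in auto)
  moreover have "q (?e x) = p x" if "x \<in> carrier P" for x
    using q(2)[of "j x"] cl(2)[OF that] d that by auto
  ultimately show thesis using that le ef by blast
qed

subsection \<open>Projective modules\<close>

lemma projective_biprod:
  fixes U V W :: "('r, 'm) module"
  assumes P: "projective \<Lambda> U" "projective \<Lambda> V" and b: "biprod \<Lambda> U V W i j p q" and W: "W \<in> mods"
  shows "projective \<Lambda> W"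
  unfolding projective_def
proof (intro conjI allI impI)
  fix B C :: "('r, 'm) module" and g h
  assume *: "B \<in> mods \<and> C \<in> mods \<and> lin \<Lambda> B C g \<and> g ` carrier B = carrier C \<and> lin \<Lambda> W C h"
  interpret B: left_module \<Lambda> B using * mod_catD by blast
  note d = b[unfolded biprod_def]
  have lp: "lin \<Lambda> W U p" and lq: "lin \<Lambda> W V q" and li: "lin \<Lambda> U W i" and lj: "lin \<Lambda> V W j" using d by auto
  have h: "lin \<Lambda> W C h" and g: "lin \<Lambda> B C g" using * by auto
  obtain k where k: "lin \<Lambda> U B k" "\<And>x. x \<in> carrier U \<Longrightarrow> g (k x) = h (i x)"
    using projectiveE[OF P(1) _ _ _ _ lin_comp[OF li h], of B g] * by blast
  obtain l where l: "lin \<Lambda> V B l" "\<And>x. x \<in> carrier V \<Longrightarrow> g (l x) = h (j x)"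
    using projectiveE[OF P(2) _ _ _ _ lin_comp[OF lj h], of B g] * by blast
  let ?m = "\<lambda>w. k (p w) \<oplus>\<^bsub>B\<^esub> l (q w)"
  have "lin \<Lambda> W B ?m"
    by (intro lin_sum B.left_module_axioms lin_comp[OF lp k(1)] lin_comp[OF lq l(1)])
  moreover have "g (?m w) = h w" if w: "w \<in> carrier W" for w
  proof -
    have "g (?m w) = h (i (p w)) \<oplus>\<^bsub>C\<^esub> h (j (q w))"
      using w lin_closed[OF lp] lin_closed[OF lq] lin_closed[OF k(1)] lin_closed[OF l(1)]
      by (simp add: lin_add[OF g] k l)
    also have "\<dots> = h (i (p w) \<oplus>\<^bsub>W\<^esub> j (q w))"
      using w lin_closed[OF lp] lin_closed[OF lq] lin_closed[OF li] lin_closed[OF lj]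
      by (simp add: lin_add[OF h])
    finally show ?thesis using d w by simp
  qed
  ultimately show "\<exists>k. lin \<Lambda> W B k \<and> (\<forall>x\<in>carrier W. g (k x) = h x)" by blast
qed (rule W)

text \<open>\<open>U\<close> is a direct summand of \<open>Y\<close> up to isomorphism; the
  complement is left unnamed.\<close>

definition retract :: "('r, 'm) module \<Rightarrow> ('r, 'm) module \<Rightarrow> bool" where
  "retract U Y \<longleftrightarrow> U \<in> mods \<and> Y \<in> mods \<and>
     (\<exists>s r. lin \<Lambda> U Y s \<and> lin \<Lambda> Y U r \<and> (\<forall>x\<in>carrier U. r (s x) = x))"

lemma projective_retract:
  assumes P: "projective \<Lambda> Y" and r: "retract U Y"
  shows "projective \<Lambda> U"
  unfolding projective_def
proof (intro conjI allI impI)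
  obtain s r where sr: "lin \<Lambda> U Y s" "lin \<Lambda> Y U r" "\<forall>x\<in>carrier U. r (s x) = x"
    using r by (auto simp: retract_def)
  fix B C :: "('r, 'm) module" and g h
  assume *: "B \<in> mods \<and> C \<in> mods \<and> lin \<Lambda> B C g \<and> g ` carrier B = carrier C \<and> lin \<Lambda> U C h"
  then have h: "lin \<Lambda> U C h" by blast
  obtain k where k: "lin \<Lambda> Y B k" "\<And>x. x \<in> carrier Y \<Longrightarrow> g (k x) = h (r x)"
    using projectiveE[OF P _ _ _ _ lin_comp[OF sr(2) h], of B g] * by blast
  have "lin \<Lambda> U B (\<lambda>x. k (s x))" by (rule lin_comp[OF sr(1) k(1)])
  moreover have "\<forall>x\<in>carrier U. g (k (s x)) = h x" using k(2) sr lin_closed[OF sr(1)] by simp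
  ultimately show "\<exists>k. lin \<Lambda> U B k \<and> (\<forall>x\<in>carrier U. g (k x) = h x)" by blast
qed (use r in \<open>auto simp: retract_def\<close>)

text \<open>The free module of rank one, moved to the type \<open>'m\<close>. Freeness at
  \<open>e\<close> is expressed by the existence of maps with prescribed value at \<open>e\<close>;
  that \<open>e\<close> generates \<open>L\<close> is used inside, for projectivity.\<close>

lemma regular_module_copy:
  obtains L :: "('r, 'm) module" and e where "projective \<Lambda> L" "e \<in> carrier L"
    "\<And>V x. left_module \<Lambda> V \<Longrightarrow> x \<in> carrier V \<Longrightarrow> \<exists>f. lin \<Lambda> L (V :: ('r, 'm) module) f \<and> f e = x"
proof -
  interpret \<Lambda>: ring \<Lambda> by (rule \<Lambda>_ring)
  interpret R: left_module \<Lambda> "regular_module \<Lambda>" by (rule \<Lambda>.regular_left_module)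
  have "fg_set \<Lambda> (regular_module \<Lambda>) (carrier (regular_module \<Lambda>))"
  proof -
    have "x \<in> gspan \<Lambda> (regular_module \<Lambda>) {\<one>\<^bsub>\<Lambda>\<^esub>}" if "x \<in> carrier \<Lambda>" for x
      using gspan.smult[OF that gspan.base[of "\<one>\<^bsub>\<Lambda>\<^esub>" "{\<one>\<^bsub>\<Lambda>\<^esub>}" \<Lambda> "regular_module \<Lambda>"]] that by simp
    then have "carrier (regular_module \<Lambda>) = gspan \<Lambda> (regular_module \<Lambda>) {\<one>\<^bsub>\<Lambda>\<^esub>}"
      using R.gspan_closed[of "{\<one>\<^bsub>\<Lambda>\<^esub>}"] by auto
    then show ?thesis unfolding fg_set_def by (intro exI[of _ "{\<one>\<^bsub>\<Lambda>\<^esub>}"]) auto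
  qed
  then have "regular_module \<Lambda> \<in> mod_cat \<Lambda>" by (simp add: mod_cat_iff_fg_set R.left_module_axioms)
  then obtain L :: "('r, 'm) module" and f g where L: "L \<in> mod_cat \<Lambda>" "lin \<Lambda> (regular_module \<Lambda>) L f"
    "lin \<Lambda> L (regular_module \<Lambda>) g" "\<And>x. x \<in> carrier (regular_module \<Lambda>) \<Longrightarrow> g (f x) = x"
    "\<And>y. y \<in> carrier L \<Longrightarrow> f (g y) = y"
    using realize[of "regular_module \<Lambda>"] by metis
  interpret L: left_module \<Lambda> L using L(1) by (rule mod_catD)
  let ?e = "f \<one>\<^bsub>\<Lambda>\<^esub>"
  have e: "?e \<in> carrier L" using lin_closed[OF L(2)] by simp
  have ex: "\<exists>f'. lin \<Lambda> L V f' \<and> f' ?e = x" if V: "left_module \<Lambda> V" and x: "x \<in> carrier V" for V :: "('r, 'm) module" and x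
  proof -
    interpret V: left_module \<Lambda> V by (rule V)
    have "lin \<Lambda> (regular_module \<Lambda>) V (\<lambda>a. a \<odot>\<^bsub>V\<^esub> x)"
      using x by (auto simp: lin_def V.smult_l_distr V.smult_assoc1)
    then have "lin \<Lambda> L V (\<lambda>y. g y \<odot>\<^bsub>V\<^esub> x)" using lin_comp[OF L(3)] by blast
    then show ?thesis using x L(4) by (intro exI[of _ "\<lambda>y. g y \<odot>\<^bsub>V\<^esub> x"]) auto
  qed
  have gen: "y = g y \<odot>\<^bsub>L\<^esub> ?e" "g y \<in> carrier \<Lambda>" if "y \<in> carrier L" for y
  proof -
    show gy: "g y \<in> carrier \<Lambda>" using lin_closed[OF L(3) that] by simp
    have "f (g y \<otimes>\<^bsub>\<Lambda>\<^esub> \<one>\<^bsub>\<Lambda>\<^esub>) = g y \<odot>\<^bsub>L\<^esub> ?e" using lin_smult[OF L(2), of "g y" "\<one>\<^bsub>\<Lambda>\<^esub>"] gy by simp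
    then show "y = g y \<odot>\<^bsub>L\<^esub> ?e" using L(5)[OF that] gy by simp
  qed
  have "projective \<Lambda> L" unfolding projective_def
  proof (intro conjI allI impI)
    fix B C :: "('r, 'm) module" and g' h
    assume *: "B \<in> mods \<and> C \<in> mods \<and> lin \<Lambda> B C g' \<and> g' ` carrier B = carrier C \<and> lin \<Lambda> L C h"
    then have h: "lin \<Lambda> L C h" and g': "lin \<Lambda> B C g'" by auto
    obtain b where b: "b \<in> carrier B" "g' b = h ?e" using * lin_closed[OF h e] by (metis imageE)
    obtain k where k: "lin \<Lambda> L B k" "k ?e = b" using ex[of B b] * b mod_catD by blast
    have "g' (k y) = h y" if y: "y \<in> carrier L" for y
    proof -
      have "k y = g y \<odot>\<^bsub>B\<^esub> b" "h y = g y \<odot>\<^bsub>C\<^esub> h ?e"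
        using lin_smult[OF k(1) gen(2)[OF y] e] lin_smult[OF h gen(2)[OF y] e] gen(1)[OF y] k(2) by auto
      then show ?thesis using lin_smult[OF g' gen(2)[OF y] b(1)] b(2) by simp
    qed
    then show "\<exists>k. lin \<Lambda> L B k \<and> (\<forall>x\<in>carrier L. g' (k x) = h x)" using k by blast
  qed (rule L(1))
  then show thesis using that[of L ?e] e ex by blast
qed

text \<open>One free summand per generator, put together with binary direct sums.\<close>

lemma enough_projectives:
  fixes V :: "('r, 'm) module"
  assumes V: "V \<in> mods"
  obtains A f P p where "projective \<Lambda> P" "ses \<Lambda> A f P p V"
proof -
  interpret V: left_module \<Lambda> V using V by (rule mod_catD)
  obtain L :: "('r, 'm) module" and e where L: "projective \<Lambda> L" "e \<in> carrier L"
    "\<And>V x. left_module \<Lambda> V \<Longrightarrow> x \<in> carrier V \<Longrightarrow> \<exists>f. lin \<Lambda> L (V :: ('r, 'm) module) f \<and> f e = x"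
    using regular_module_copy by blast
  have Lm: "L \<in> mods" using L(1) by (simp add: projective_def)
  interpret L: left_module \<Lambda> L using Lm by (rule mod_catD)
  have gen: "\<exists>(P :: ('r, 'm) module) p. projective \<Lambda> P \<and> lin \<Lambda> P V p \<and> S \<subseteq> p ` carrier P" if "finite S" "S \<subseteq> carrier V" for S
    using that
  proof (induct S)
    case empty
    show ?case using L(1) lin_const_zero[OF V.left_module_axioms, of L]
      by (intro exI[of _ L] exI[of _ "\<lambda>_. \<zero>\<^bsub>V\<^esub>"]) simp
  next
    case (insert s S)
    then obtain P :: "('r, 'm) module" and p where P: "projective \<Lambda> P" "lin \<Lambda> P V p" "S \<subseteq> p ` carrier P" by auto
    have Pm: "P \<in> mods" using P(1) by (simp add: projective_def)
    interpret P: left_module \<Lambda> P using Pm by (rule mod_catD)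
    obtain f where f: "lin \<Lambda> L V f" "f e = s" using L(3)[OF V.left_module_axioms, of s] insert by auto
    obtain W i j a b where W: "W \<in> mods" "biprod \<Lambda> P L W i j a b" using biprod_exists[OF Pm Lm] by metis
    note d = W(2)[unfolded biprod_def]
    have la: "lin \<Lambda> W P a" and lb: "lin \<Lambda> W L b" and li: "lin \<Lambda> P W i" and lj: "lin \<Lambda> L W j" using d by auto
    let ?p = "\<lambda>w. p (a w) \<oplus>\<^bsub>V\<^esub> f (b w)"
    have lp: "lin \<Lambda> W V ?p"
      by (intro lin_sum V.left_module_axioms lin_comp[OF la P(2)] lin_comp[OF lb f(1)])
    have p0: "p \<zero>\<^bsub>P\<^esub> = \<zero>\<^bsub>V\<^esub>" "f \<zero>\<^bsub>L\<^esub> = \<zero>\<^bsub>V\<^esub>"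
      using lin_zero[OF P.left_module_axioms V.left_module_axioms P(2)]
        lin_zero[OF L.left_module_axioms V.left_module_axioms f(1)] by auto
    have "?p (j e) = s" using d L(2) f(2) p0 insert by auto
    then have "s \<in> ?p ` carrier W" using lin_closed[OF lj L(2)] by blast
    moreover have "S \<subseteq> ?p ` carrier W"
    proof
      fix x assume "x \<in> S"
      then obtain y where y: "y \<in> carrier P" "x = p y" using P(3) by blast
      then have "?p (i y) = x" using d p0 lin_closed[OF P(2)] by auto
      then show "x \<in> ?p ` carrier W" using lin_closed[OF li y(1)] by blast
    qed
    ultimately have "insert s S \<subseteq> ?p ` carrier W" by simp
    then show ?case using projective_biprod[OF P(1) L(1) W(2,1)] lp by blast
  qed
  obtain S where S: "finite S" "S \<subseteq> carrier V" "carrier V = gspan \<Lambda> V S"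
    using V by (auto simp: mod_cat_iff_fg_set fg_set_def)
  from gen[OF S(1,2)] obtain P :: "('r, 'm) module" and p where P: "projective \<Lambda> P" "lin \<Lambda> P V p" "S \<subseteq> p ` carrier P" by blast
  have Pm: "P \<in> mods" using P(1) by (simp add: projective_def)
  interpret P: left_module \<Lambda> P using Pm by (rule mod_catD)
  have "carrier V \<subseteq> p ` carrier P"
    using gspan_least[OF lin_image_submod[OF P.left_module_axioms V.left_module_axioms P(2) P.submod_carrier] P(3)] S(3)
    by simp
  then have "p ` carrier P = carrier V" using lin_closed[OF P(2)] by blast
  from kernel_ses[OF Pm V P(2) this] P(1) show thesis using that by blast
qed

end

section \<open>Vanishing of Ext\<close>

lemma ses_lin_zero:
  assumes "ses \<Lambda> A f B g C" shows "f \<zero>\<^bsub>A\<^esub> = \<zero>\<^bsub>B\<^esub>" "g \<zero>\<^bsub>B\<^esub> = \<zero>\<^bsub>C\<^esub>"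
  using lin_zero[OF sesD(9,10,4)[OF assms]] lin_zero[OF sesD(10,11,5)[OF assms]] by auto

lemma ses_closed:
  assumes "ses \<Lambda> A f B g C"
  shows "x \<in> carrier A \<Longrightarrow> f x \<in> carrier B" "y \<in> carrier B \<Longrightarrow> g y \<in> carrier C"
  using lin_closed[OF sesD(4)[OF assms]] lin_closed[OF sesD(5)[OF assms]] by auto

context artin_modules begin

text \<open>The index is shifted: \<open>Ext_van n\<close> stands for the vanishing of $\mathrm{Ext}^{n+1}$.\<close>

primrec Ext_van :: "nat \<Rightarrow> ('r, 'm) module \<Rightarrow> ('r, 'm) module \<Rightarrow> bool" where
  "Ext_van 0 U Y \<longleftrightarrow> (\<forall>A f P p h. projective \<Lambda> P \<and> ses \<Lambda> A f P p U \<and> lin \<Lambda> A Y h \<longrightarrow>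
     (\<exists>e. lin \<Lambda> P Y e \<and> (\<forall>x\<in>carrier A. e (f x) = h x)))"
| "Ext_van (Suc n) U Y \<longleftrightarrow> (\<forall>A f P p. projective \<Lambda> P \<and> ses \<Lambda> A f P p U \<longrightarrow> Ext_van n A Y)"

lemma Ext_van_0E:
  assumes "Ext_van 0 U Y" "projective \<Lambda> P" "ses \<Lambda> A f P p U" "lin \<Lambda> A Y h"
  obtains e where "lin \<Lambda> P Y e" "\<And>x. x \<in> carrier A \<Longrightarrow> e (f x) = h x"
proof -
  have "\<exists>e. lin \<Lambda> P Y e \<and> (\<forall>x\<in>carrier A. e (f x) = h x)"
    using assms unfolding Ext_van.simps(1) by blast
  then show thesis using that by blast
qed

lemma Ext_van_SucD:
  "Ext_van (Suc n) U Y \<Longrightarrow> projective \<Lambda> P \<Longrightarrow> ses \<Lambda> A f P p U \<Longrightarrow> Ext_van n A Y"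
  unfolding Ext_van.simps(2) by blast

text \<open>The element w - s (b w) lies in the kernel of \<open>b\<close>, and its preimage under
  \<open>u\<close> defines the retraction \<open>r\<close>.\<close>

lemma ses_split:
  assumes A: "ses \<Lambda> A u W b (P :: ('r, 'm) module)" and s: "lin \<Lambda> P W s" and bs: "\<And>y. y \<in> carrier P \<Longrightarrow> b (s y) = y"
  obtains r where "biprod \<Lambda> A P W u s r b"
proof -
  note t = sesD[OF A]
  interpret A: left_module \<Lambda> A by (rule t)
  interpret W: left_module \<Lambda> W by (rule t)
  interpret P: left_module \<Lambda> P by (rule t)
  note cl = ses_closed[OF A] and sc = lin_closed[OF s]
  have l: "lin \<Lambda> W W (\<lambda>w. w \<ominus>\<^bsub>W\<^esub> s (b w))"
    by (intro lin_diff W.left_module_axioms lin_id lin_comp[OF t(5) s])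
  have z: "b (w \<ominus>\<^bsub>W\<^esub> s (b w)) = \<zero>\<^bsub>P\<^esub>" if "w \<in> carrier W" for w
    using that cl sc bs by (simp add: lin_minus[OF t(10,11,5)] P.diff_eq_zero_iff)
  obtain r where r: "lin \<Lambda> W A r" "\<And>w. w \<in> carrier W \<Longrightarrow> u (r w) = w \<ominus>\<^bsub>W\<^esub> s (b w)"
    using lin_corestrict[OF A l z] by blast
  note rc = lin_closed[OF r(1)]
  have s0: "s \<zero>\<^bsub>P\<^esub> = \<zero>\<^bsub>W\<^esub>" by (rule lin_zero[OF t(11,10) s])
  have ru: "r (u x) = x" if "x \<in> carrier A" for x
  proof (rule ses_inj[OF A])
    show "u (r (u x)) = u x" using that cl r(2) s0 ses_comp_zero[OF A that] by simp
  qed (use that cl rc in auto)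
  have rs: "r (s y) = \<zero>\<^bsub>A\<^esub>" if "y \<in> carrier P" for y
  proof (rule ses_inj[OF A])
    show "u (r (s y)) = u \<zero>\<^bsub>A\<^esub>"
      using that sc[OF that] r(2)[of "s y"] bs[OF that] ses_lin_zero[OF A] by (simp add: W.diff_eq_zero_iff)
  qed (use that sc rc in auto)
  have "u (r w) \<oplus>\<^bsub>W\<^esub> s (b w) = w" if "w \<in> carrier W" for w
    using that r(2)[OF that] cl sc by (simp add: W.diff_add_cancel)
  then have "biprod \<Lambda> A P W u s r b"
    using t s r ru rs bs ses_comp_zero[OF A] unfolding biprod_def by blast
  then show thesis by (rule that)
qed

lemma projective_split:
  fixes P :: "('r, 'm) module"
  assumes P: "projective \<Lambda> P" and A: "ses \<Lambda> A u W b P"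
  obtains s r where "biprod \<Lambda> A P W u s r b"
proof -
  obtain s where s: "lin \<Lambda> P W s" "\<And>y. y \<in> carrier P \<Longrightarrow> b (s y) = y"
    using projective_lift[OF P A lin_id] by blast
  obtain r where "biprod \<Lambda> A P W u s r b" using ses_split[OF A s] by blast
  then show thesis by (rule that)
qed

text \<open>Frees the definition of \<open>Ext_van 0\<close> from projective presentations: any
  monomorphism with cokernel \<open>U\<close> will do. The pullback with a projective presentation
  splits over \<open>P\<close>, which transfers the extension problem from \<open>A\<close> in
  \<open>B\<close> to \<open>Z\<close> in \<open>P\<close>.\<close>

lemma Ext_van_0_extend:
  assumes E: "Ext_van 0 U Y" and Y: "Y \<in> mods" and A: "ses \<Lambda> A f B g U" and h: "lin \<Lambda> A Y h"
  obtains e where "lin \<Lambda> B Y e" "\<And>x. x \<in> carrier A \<Longrightarrow> e (f x) = h x"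
proof -
  obtain Z z P p where P: "projective \<Lambda> P" "ses \<Lambda> Z z P p U"
    using enough_projectives[OF sesD(3)[OF A]] by metis
  obtain W a b u v where W: "ses \<Lambda> A u W b P" "ses \<Lambda> Z v W a B"
    "\<And>x. x \<in> carrier A \<Longrightarrow> a (u x) = f x" "\<And>x. x \<in> carrier Z \<Longrightarrow> b (v x) = z x"
    "\<And>w. w \<in> carrier W \<Longrightarrow> g (a w) = p (b w)"
    by (rule pullback_ses[OF A P(2)]) blast
  interpret Y: left_module \<Lambda> Y using Y by (rule mod_catD)
  obtain s r where "biprod \<Lambda> A P W u s r b" using projective_split[OF P(1) W(1)] by blast
  then have r: "lin \<Lambda> W A r" "\<And>x. x \<in> carrier A \<Longrightarrow> r (u x) = x" by (auto simp: biprod_def)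
  have hr: "lin \<Lambda> W Y (\<lambda>w. h (r w))" by (rule lin_comp[OF r(1) h])
  obtain e where e: "lin \<Lambda> P Y e" "\<And>x. x \<in> carrier Z \<Longrightarrow> e (z x) = h (r (v x))"
    using Ext_van_0E[OF E P lin_comp[OF sesD(4)[OF W(2)] hr]] by blast
  \<comment> \<open>On \<open>Z\<close> both terms agree, so the difference descends along
    \<open>a\<close> to \<open>B\<close>; on \<open>A\<close> the second term vanishes and the first
    is \<open>h\<close>.\<close>
  have m: "lin \<Lambda> W Y (\<lambda>w. h (r w) \<ominus>\<^bsub>Y\<^esub> e (b w))"
    by (intro lin_diff Y.left_module_axioms hr lin_comp[OF sesD(5)[OF W(1)] e(1)])
  have m0: "h (r (v x)) \<ominus>\<^bsub>Y\<^esub> e (b (v x)) = \<zero>\<^bsub>Y\<^esub>" if "x \<in> carrier Z" for x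
    using that e(2)[OF that] W(4)[OF that] lin_closed[OF hr ses_closed(1)[OF W(2) that]]
    by (simp add: Y.diff_eq_zero_iff)
  obtain k where k: "lin \<Lambda> B Y k" "\<And>w. w \<in> carrier W \<Longrightarrow> k (a w) = h (r w) \<ominus>\<^bsub>Y\<^esub> e (b w)"
    using lin_factor[OF W(2) m Y.left_module_axioms m0] by blast
  have "k (f x) = h x" if "x \<in> carrier A" for x
    using k(2)[OF ses_closed(1)[OF W(1) that]] W(3)[OF that] r(2)[OF that] ses_comp_zero[OF W(1) that]
      lin_zero[OF sesD(11)[OF W(1)] Y.left_module_axioms e(1)] lin_closed[OF h that] by simp
  then show thesis using that k by blast
qed

subsection \<open>The second variable\<close>

text \<open>The fragments of the long exact sequence are named after the position of the concluded
  term in the short exact sequence, and then after the variable. In the second variable the step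
  from n to n + 1 merely replaces \<open>U\<close> by its syzygies, so the case 0 carries the
  content. Here the composite of \<open>h\<close> with \<open>g\<close> is extended to
  \<open>P\<close> and lifted back to \<open>B\<close>; subtracting the lift leaves a map into
  \<open>A\<close>.\<close>

lemma Ext_van_middle_right:
  assumes B: "ses \<Lambda> A f B g C"
  shows "Ext_van n U A \<Longrightarrow> Ext_van n U C \<Longrightarrow> Ext_van n U B"
proof (induct n arbitrary: U)
  case 0
  interpret B: left_module \<Lambda> B by (rule sesD[OF B])
  have "\<exists>e. lin \<Lambda> P B e \<and> (\<forall>x\<in>carrier Z. e (z x) = h x)"
    if P: "projective \<Lambda> P" "ses \<Lambda> Z z P p U" "lin \<Lambda> Z B h" for Z z P p h
  proof -
    obtain e where e: "lin \<Lambda> P C e" "\<And>x. x \<in> carrier Z \<Longrightarrow> e (z x) = g (h x)"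
      using Ext_van_0E[OF 0(2) P(1,2) lin_comp[OF P(3) sesD(5)[OF B]]] by blast
    obtain k where k: "lin \<Lambda> P B k" "\<And>x. x \<in> carrier P \<Longrightarrow> g (k x) = e x"
      using projective_lift[OF P(1) B e(1)] by blast
    note zc = ses_closed(1)[OF P(2)] and hc = lin_closed[OF P(3)] and kc = lin_closed[OF k(1)]
    have l: "lin \<Lambda> Z B (\<lambda>x. h x \<ominus>\<^bsub>B\<^esub> k (z x))"
      by (intro lin_diff B.left_module_axioms P(3) lin_comp[OF sesD(4)[OF P(2)] k(1)])
    have l0: "g (h x \<ominus>\<^bsub>B\<^esub> k (z x)) = \<zero>\<^bsub>C\<^esub>" if "x \<in> carrier Z" for x
      using that zc hc kc k(2) e(2) ses_closed(2)[OF B]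
      by (simp add: lin_minus[OF sesD(10,11,5)[OF B]] left_module.diff_eq_zero_iff[OF sesD(11)[OF B]])
    obtain m where m: "lin \<Lambda> Z A m" "\<And>x. x \<in> carrier Z \<Longrightarrow> f (m x) = h x \<ominus>\<^bsub>B\<^esub> k (z x)"
      using lin_corestrict[OF B l l0] by blast
    obtain t where t: "lin \<Lambda> P A t" "\<And>x. x \<in> carrier Z \<Longrightarrow> t (z x) = m x"
      using Ext_van_0E[OF 0(1) P(1,2) m(1)] by blast
    have "lin \<Lambda> P B (\<lambda>x. f (t x) \<oplus>\<^bsub>B\<^esub> k x)"
      by (intro lin_sum B.left_module_axioms lin_comp[OF t(1) sesD(4)[OF B]] k(1))
    moreover have "\<forall>x\<in>carrier Z. f (t (z x)) \<oplus>\<^bsub>B\<^esub> k (z x) = h x"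
      using t(2) m(2) hc kc zc by (simp add: B.diff_add_cancel)
    ultimately show ?thesis by (intro exI[of _ "\<lambda>x. f (t x) \<oplus>\<^bsub>B\<^esub> k x"]) simp
  qed
  then show ?case by auto
next
  case (Suc n)
  then show ?case by (metis Ext_van.simps(2))
qed

text \<open>A map from the syzygy \<open>Z\<close> to \<open>C\<close> lifts to \<open>B\<close>
  because the obstruction lies in Ext^1(Z,A), which is Ext^2(U,A) when n = 0; the lift then extends
  to \<open>P\<close>. The obstruction is \<open>m\<close>, the restriction to \<open>Z2\<close> of
  a lift \<open>k\<close> over the cover \<open>P2\<close> of \<open>Z\<close>.\<close>

lemma Ext_van_right_right:
  assumes B: "ses \<Lambda> A f B g C"
  shows "Ext_van n U B \<Longrightarrow> Ext_van (Suc n) U A \<Longrightarrow> Ext_van n U C"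
proof (induct n arbitrary: U)
  case 0
  interpret B: left_module \<Lambda> B by (rule sesD[OF B])
  interpret C: left_module \<Lambda> C by (rule sesD[OF B])
  have "\<exists>e. lin \<Lambda> P C e \<and> (\<forall>x\<in>carrier Z. e (z x) = h x)"
    if P: "projective \<Lambda> P" "ses \<Lambda> Z z P p U" "lin \<Lambda> Z C h" for Z z P p h
  proof -
    obtain Z2 z2 P2 p2 where P2: "projective \<Lambda> P2" "ses \<Lambda> Z2 z2 P2 p2 Z"
      using enough_projectives[OF sesD(1)[OF P(2)]] by metis
    obtain k where k: "lin \<Lambda> P2 B k" "\<And>x. x \<in> carrier P2 \<Longrightarrow> g (k x) = h (p2 x)"
      using projective_lift[OF P2(1) B lin_comp[OF sesD(5)[OF P2(2)] P(3)]] by blast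
    note kc = lin_closed[OF k(1)]
    have kz: "g (k (z2 x)) = \<zero>\<^bsub>C\<^esub>" if "x \<in> carrier Z2" for x
      using k(2)[OF ses_closed(1)[OF P2(2) that]] ses_comp_zero[OF P2(2) that]
        lin_zero[OF sesD(11)[OF P2(2)] C.left_module_axioms P(3)] by simp
    obtain m where m: "lin \<Lambda> Z2 A m" "\<And>x. x \<in> carrier Z2 \<Longrightarrow> f (m x) = k (z2 x)"
      using lin_corestrict[OF B lin_comp[OF sesD(4)[OF P2(2)] k(1)] kz] by blast
    obtain e where e: "lin \<Lambda> P2 A e" "\<And>x. x \<in> carrier Z2 \<Longrightarrow> e (z2 x) = m x"
      using Ext_van_0E[OF Ext_van_SucD[OF 0(2) P(1,2)] P2 m(1)] by blast
    note fe = lin_comp[OF e(1) sesD(4)[OF B]]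
    have d: "lin \<Lambda> P2 B (\<lambda>x. k x \<ominus>\<^bsub>B\<^esub> f (e x))"
      by (intro lin_diff B.left_module_axioms k(1) fe)
    have d0: "k (z2 x) \<ominus>\<^bsub>B\<^esub> f (e (z2 x)) = \<zero>\<^bsub>B\<^esub>" if "x \<in> carrier Z2" for x
      using that e(2) m(2) kc ses_closed(1)[OF P2(2)] by (simp add: B.diff_eq_zero_iff)
    obtain l where l: "lin \<Lambda> Z B l" "\<And>x. x \<in> carrier P2 \<Longrightarrow> l (p2 x) = k x \<ominus>\<^bsub>B\<^esub> f (e x)"
      using lin_factor[OF P2(2) d B.left_module_axioms d0] by blast
    have gl: "g (l y) = h y" if y: "y \<in> carrier Z" for y
    proof -
      obtain x where x: "x \<in> carrier P2" "p2 x = y" by (rule ses_surjE[OF P2(2) y])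
      then have "g (l y) = h y \<ominus>\<^bsub>C\<^esub> g (f (e x))"
        using l(2)[OF x(1)] k(2)[OF x(1)] kc[OF x(1)] lin_closed[OF fe x(1)]
        by (simp add: lin_minus[OF sesD(10,11,5)[OF B]])
      then show ?thesis
        using ses_comp_zero[OF B lin_closed[OF e(1) x(1)]] lin_closed[OF P(3) y] by simp
    qed
    obtain t where t: "lin \<Lambda> P B t" "\<And>x. x \<in> carrier Z \<Longrightarrow> t (z x) = l x"
      using Ext_van_0E[OF 0(1) P(1,2) l(1)] by blast
    show ?thesis using lin_comp[OF t(1) sesD(5)[OF B]] t(2) gl
      by (intro exI[of _ "\<lambda>x. g (t x)"]) simp
  qed
  then show ?case by auto
next
  case (Suc n)
  then show ?case by (metis Ext_van.simps(2))
qed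

text \<open>Extend f h to e: P2 \<rightarrow> B. The map that g e induces on \<open>Z\<close>
  extends to \<open>P\<close> and lifts to \<open>k\<close>; subtracting \<open>k\<close> along P2
  \<rightarrow> Z \<rightarrow> P moves \<open>e\<close> into \<open>A\<close> and leaves it
  unchanged on \<open>Z2\<close>.\<close>

lemma Ext_van_left_right:
  assumes B: "ses \<Lambda> A f B g C"
  shows "Ext_van n U C \<Longrightarrow> Ext_van (Suc n) U B \<Longrightarrow> Ext_van (Suc n) U A"
proof (induct n arbitrary: U)
  case 0
  interpret B: left_module \<Lambda> B by (rule sesD[OF B])
  interpret C: left_module \<Lambda> C by (rule sesD[OF B])
  have "\<exists>e. lin \<Lambda> P2 A e \<and> (\<forall>x\<in>carrier Z2. e (z2 x) = h x)"
    if P: "projective \<Lambda> P" "ses \<Lambda> Z z P p U" and P2: "projective \<Lambda> P2" "ses \<Lambda> Z2 z2 P2 p2 Z"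
      and h: "lin \<Lambda> Z2 A h" for Z z P p Z2 z2 P2 p2 h
  proof -
    obtain e where e: "lin \<Lambda> P2 B e" "\<And>x. x \<in> carrier Z2 \<Longrightarrow> e (z2 x) = f (h x)"
      using Ext_van_0E[OF Ext_van_SucD[OF 0(2) P] P2 lin_comp[OF h sesD(4)[OF B]]] by blast
    note ec = lin_closed[OF e(1)]
    have ez: "g (e (z2 x)) = \<zero>\<^bsub>C\<^esub>" if "x \<in> carrier Z2" for x
      using e(2)[OF that] ses_comp_zero[OF B lin_closed[OF h that]] by simp
    obtain l where l: "lin \<Lambda> Z C l" "\<And>x. x \<in> carrier P2 \<Longrightarrow> l (p2 x) = g (e x)"
      using lin_factor[OF P2(2) lin_comp[OF e(1) sesD(5)[OF B]] C.left_module_axioms ez] by blast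
    obtain t where t: "lin \<Lambda> P C t" "\<And>x. x \<in> carrier Z \<Longrightarrow> t (z x) = l x"
      using Ext_van_0E[OF 0(1) P l(1)] by blast
    obtain k where k: "lin \<Lambda> P B k" "\<And>x. x \<in> carrier P \<Longrightarrow> g (k x) = t x"
      using projective_lift[OF P(1) B t(1)] by blast
    have kzp: "lin \<Lambda> P2 B (\<lambda>x. k (z (p2 x)))"
      by (rule lin_comp[OF lin_comp[OF sesD(5)[OF P2(2)] sesD(4)[OF P(2)]] k(1)])
    have m: "lin \<Lambda> P2 B (\<lambda>x. e x \<ominus>\<^bsub>B\<^esub> k (z (p2 x)))"
      by (intro lin_diff B.left_module_axioms e(1) kzp)
    have m0: "g (e x \<ominus>\<^bsub>B\<^esub> k (z (p2 x))) = \<zero>\<^bsub>C\<^esub>" if x: "x \<in> carrier P2" for x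
    proof -
      have px: "p2 x \<in> carrier Z" "z (p2 x) \<in> carrier P"
        using x ses_closed(2)[OF P2(2)] ses_closed(1)[OF P(2)] by auto
      have "g (e x) = g (k (z (p2 x)))" using l(2)[OF x] t(2)[OF px(1)] k(2)[OF px(2)] by simp
      then show ?thesis using ec[OF x] lin_closed[OF kzp x] ses_closed(2)[OF B]
        by (simp add: lin_minus[OF sesD(10,11,5)[OF B]] C.diff_eq_zero_iff)
    qed
    obtain q where q: "lin \<Lambda> P2 A q" "\<And>x. x \<in> carrier P2 \<Longrightarrow> f (q x) = e x \<ominus>\<^bsub>B\<^esub> k (z (p2 x))"
      using lin_corestrict[OF B m m0] by blast
    have "q (z2 x) = h x" if x: "x \<in> carrier Z2" for x
    proof (rule ses_inj[OF B])
      note zc = ses_closed(1)[OF P2(2) x]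
      show "f (q (z2 x)) = f (h x)"
        using q(2)[OF zc] e(2)[OF x] ses_comp_zero[OF P2(2) x] ses_lin_zero(1)[OF P(2)]
          lin_zero[OF sesD(10)[OF P(2)] B.left_module_axioms k(1)] ses_closed(1)[OF B lin_closed[OF h x]] by simp
      show "q (z2 x) \<in> carrier A" by (rule lin_closed[OF q(1) zc])
      show "h x \<in> carrier A" by (rule lin_closed[OF h x])
    qed
    then show ?thesis using q(1) by blast
  qed
  then show ?case by auto
next
  case (Suc n)
  then show ?case by (metis Ext_van.simps(2))
qed

text \<open>The start of the long exact sequence: surjectivity of Hom(U,B) \<rightarrow> Hom(U,C),
  which F_M-exactness supplies for U = M, takes the place of vanishing in the preceding
  degree.\<close>

lemma Ext_van_left_right_0:
  assumes B: "ses \<Lambda> A f B g C" and U: "U \<in> mods" and E: "Ext_van 0 U B"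
    and onto: "\<And>c. lin \<Lambda> U C c \<Longrightarrow> \<exists>b. lin \<Lambda> U B b \<and> (\<forall>x\<in>carrier U. g (b x) = c x)"
  shows "Ext_van 0 U A"
proof -
  interpret B: left_module \<Lambda> B by (rule sesD[OF B])
  interpret C: left_module \<Lambda> C by (rule sesD[OF B])
  interpret U: left_module \<Lambda> U using U by (rule mod_catD)
  have "\<exists>e. lin \<Lambda> P A e \<and> (\<forall>x\<in>carrier Z. e (z x) = h x)"
    if P: "projective \<Lambda> P" "ses \<Lambda> Z z P p U" and h: "lin \<Lambda> Z A h" for Z z P p h
  proof -
    obtain e where e: "lin \<Lambda> P B e" "\<And>x. x \<in> carrier Z \<Longrightarrow> e (z x) = f (h x)"
      using Ext_van_0E[OF E P lin_comp[OF h sesD(4)[OF B]]] by blast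
    note ec = lin_closed[OF e(1)]
    have ez: "g (e (z x)) = \<zero>\<^bsub>C\<^esub>" if "x \<in> carrier Z" for x
      using e(2)[OF that] ses_comp_zero[OF B lin_closed[OF h that]] by simp
    obtain l where l: "lin \<Lambda> U C l" "\<And>x. x \<in> carrier P \<Longrightarrow> l (p x) = g (e x)"
      using lin_factor[OF P(2) lin_comp[OF e(1) sesD(5)[OF B]] C.left_module_axioms ez] by blast
    obtain b where b: "lin \<Lambda> U B b" "\<And>x. x \<in> carrier U \<Longrightarrow> g (b x) = l x" using onto[OF l(1)] by blast
    note bp = lin_comp[OF sesD(5)[OF P(2)] b(1)]
    have m: "lin \<Lambda> P B (\<lambda>x. e x \<ominus>\<^bsub>B\<^esub> b (p x))"
      by (intro lin_diff B.left_module_axioms e(1) bp)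
    have m0: "g (e x \<ominus>\<^bsub>B\<^esub> b (p x)) = \<zero>\<^bsub>C\<^esub>" if x: "x \<in> carrier P" for x
      using l(2)[OF x] b(2)[OF ses_closed(2)[OF P(2) x]] ec[OF x] lin_closed[OF bp x] ses_closed(2)[OF B]
      by (simp add: lin_minus[OF sesD(10,11,5)[OF B]] C.diff_eq_zero_iff)
    obtain q where q: "lin \<Lambda> P A q" "\<And>x. x \<in> carrier P \<Longrightarrow> f (q x) = e x \<ominus>\<^bsub>B\<^esub> b (p x)"
      using lin_corestrict[OF B m m0] by blast
    have "q (z x) = h x" if x: "x \<in> carrier Z" for x
    proof (rule ses_inj[OF B])
      note zc = ses_closed(1)[OF P(2) x]
      show "f (q (z x)) = f (h x)"
        using q(2)[OF zc] e(2)[OF x] ses_comp_zero[OF P(2) x]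
          lin_zero[OF U.left_module_axioms B.left_module_axioms b(1)] ses_closed(1)[OF B lin_closed[OF h x]] by simp
      show "q (z x) \<in> carrier A" by (rule lin_closed[OF q(1) zc])
      show "h x \<in> carrier A" by (rule lin_closed[OF h x])
    qed
    then show ?thesis using q(1) by blast
  qed
  then show ?thesis by auto
qed

lemma Ext_van_retract_right:
  assumes "retract Y Y'" shows "Ext_van n U Y' \<Longrightarrow> Ext_van n U Y"
proof (induct n arbitrary: U)
  case 0
  obtain s r where sr: "lin \<Lambda> Y Y' s" "lin \<Lambda> Y' Y r" "\<And>x. x \<in> carrier Y \<Longrightarrow> r (s x) = x"
    using assms by (auto simp: retract_def)
  have "\<exists>e. lin \<Lambda> P Y e \<and> (\<forall>x\<in>carrier Z. e (z x) = h x)"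
    if P: "projective \<Lambda> P" "ses \<Lambda> Z z P p U" and h: "lin \<Lambda> Z Y h" for Z z P p h
  proof -
    obtain e where e: "lin \<Lambda> P Y' e" "\<And>x. x \<in> carrier Z \<Longrightarrow> e (z x) = s (h x)"
      using Ext_van_0E[OF 0 P lin_comp[OF h sr(1)]] by blast
    show ?thesis using lin_comp[OF e(1) sr(2)] e(2) sr(3) lin_closed[OF h]
      by (intro exI[of _ "\<lambda>x. r (e x)"]) simp
  qed
  then show ?case by auto
next
  case (Suc n)
  then show ?case by (metis Ext_van.simps(2))
qed

subsection \<open>The first variable\<close>

text \<open>\<open>R\<close> is a direct sum of \<open>P\<close> and \<open>Q\<close>, mapped to
  \<open>B\<close> by f p on \<open>P\<close> and by a lift of \<open>q\<close> through
  \<open>g\<close> on \<open>Q\<close>. The last two conclusions record how \<open>Z\<close> sits in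
  \<open>P\<close> and in \<open>R\<close>, so that an extension to \<open>R\<close> restricts to
  one on \<open>P\<close>.\<close>

lemma horseshoe:
  fixes A P U :: "('r, 'm) module"
  assumes A: "ses \<Lambda> A f B g C" and P: "projective \<Lambda> P" "ses \<Lambda> Z z P p A"
    and Q: "projective \<Lambda> Q" "ses \<Lambda> U t Q q C"
  obtains R V v r a b i where "projective \<Lambda> R" "ses \<Lambda> V v R r B" "ses \<Lambda> Z a V b U" "lin \<Lambda> P R i"
    "\<And>x. x \<in> carrier Z \<Longrightarrow> v (a x) = i (z x)"
proof -
  interpret A: left_module \<Lambda> A by (rule sesD[OF A])
  interpret B: left_module \<Lambda> B by (rule sesD[OF A])
  interpret C: left_module \<Lambda> C by (rule sesD[OF A])
  interpret P: left_module \<Lambda> P by (rule sesD[OF P(2)])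
  interpret Q: left_module \<Lambda> Q by (rule sesD[OF Q(2)])
  interpret U: left_module \<Lambda> U by (rule sesD[OF Q(2)])
  obtain q' where q': "lin \<Lambda> Q B q'" "\<And>x. x \<in> carrier Q \<Longrightarrow> g (q' x) = q x"
    using projective_lift[OF Q(1) A sesD(5)[OF Q(2)]] by blast
  obtain R i j \<pi> \<rho> where R: "R \<in> mods" "biprod \<Lambda> P Q R i j \<pi> \<rho>"
    using biprod_exists[OF sesD(2)[OF P(2)] sesD(2)[OF Q(2)]] by metis
  interpret R: left_module \<Lambda> R using R(1) by (rule mod_catD)
  have i: "lin \<Lambda> P R i" and j: "lin \<Lambda> Q R j" and \<pi>: "lin \<Lambda> R P \<pi>" and \<rho>: "lin \<Lambda> R Q \<rho>"
    and pi: "\<And>x. x \<in> carrier P \<Longrightarrow> \<pi> (i x) = x" "\<And>x. x \<in> carrier P \<Longrightarrow> \<rho> (i x) = \<zero>\<^bsub>Q\<^esub>"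
    and rh: "\<And>x. x \<in> carrier Q \<Longrightarrow> \<rho> (j x) = x" "\<And>x. x \<in> carrier Q \<Longrightarrow> \<pi> (j x) = \<zero>\<^bsub>P\<^esub>"
    and dec: "\<And>w. w \<in> carrier R \<Longrightarrow> i (\<pi> w) \<oplus>\<^bsub>R\<^esub> j (\<rho> w) = w"
    using R(2) by (auto simp: biprod_def)
  note ic = lin_closed[OF i] and jc = lin_closed[OF j] and \<pi>c = lin_closed[OF \<pi>] and \<rho>c = lin_closed[OF \<rho>]
    and pc = ses_closed(2)[OF P(2)] and zc = ses_closed(1)[OF P(2)] and fc = ses_closed(1)[OF A]
    and q'c = lin_closed[OF q'(1)] and tc = ses_closed(1)[OF Q(2)] and gc = ses_closed(2)[OF A]
  let ?r = "\<lambda>w. f (p (\<pi> w)) \<oplus>\<^bsub>B\<^esub> q' (\<rho> w)"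
  have r: "lin \<Lambda> R B ?r"
    by (intro lin_sum B.left_module_axioms lin_comp[OF lin_comp[OF \<pi> sesD(5)[OF P(2)]] sesD(4)[OF A]]
        lin_comp[OF \<rho> q'(1)])
  have q0: "q' \<zero>\<^bsub>Q\<^esub> = \<zero>\<^bsub>B\<^esub>" by (rule lin_zero[OF Q.left_module_axioms B.left_module_axioms q'(1)])
  note f0 = ses_lin_zero(1)[OF A] and p0 = ses_lin_zero(2)[OF P(2)]
  have ri: "?r (i x) = f (p x)" if "x \<in> carrier P" for x
    using that q0 fc pc by (simp add: pi)
  have rj: "?r (j x) = q' x" if "x \<in> carrier Q" for x
    using that f0 p0 q'c by (simp add: rh)
  have gr: "g (?r w) = q (\<rho> w)" if "w \<in> carrier R" for w
    using that fc pc \<pi>c \<rho>c q'c q'(2) ses_comp_zero[OF A] ses_closed(2)[OF Q(2)]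
    by (simp add: lin_add[OF sesD(5)[OF A]])
  have surj: "?r ` carrier R = carrier B"
  proof (intro subset_antisym subsetI)
    fix y assume y: "y \<in> carrier B"
    obtain x where x: "x \<in> carrier Q" "q x = g y" by (rule ses_surjE[OF Q(2) gc[OF y]])
    have "g (y \<ominus>\<^bsub>B\<^esub> q' x) = \<zero>\<^bsub>C\<^esub>"
      using x y q'c q'(2) gc by (simp add: lin_minus[OF sesD(10,11,5)[OF A]] C.diff_eq_zero_iff)
    then obtain a where a: "a \<in> carrier A" "y \<ominus>\<^bsub>B\<^esub> q' x = f a"
      using ses_kerE[OF A B.M.minus_closed[OF y q'c[OF x(1)]]] by blast
    obtain x' where x': "x' \<in> carrier P" "p x' = a" by (rule ses_surjE[OF P(2) a(1)])
    have "?r (i x' \<oplus>\<^bsub>R\<^esub> j x) = f a \<oplus>\<^bsub>B\<^esub> q' x"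
      using lin_add[OF r ic[OF x'(1)] jc[OF x(1)]] ri[OF x'(1)] rj[OF x(1)] x' by simp
    also have "\<dots> = y" using a(2)[symmetric] y q'c[OF x(1)] by (simp add: B.diff_add_cancel)
    finally show "y \<in> ?r ` carrier R"
      using R.M.a_closed[OF ic[OF x'(1)] jc[OF x(1)]] by (rule image_eqI[OF sym])
  qed (use lin_closed[OF r] in blast)
  let ?V = "R\<lparr>carrier := {w \<in> carrier R. ?r w = \<zero>\<^bsub>B\<^esub>}\<rparr>"
  have V: "ses \<Lambda> ?V (\<lambda>w. w) R ?r B"
    by (rule kernel_ses[OF R(1) sesD(2)[OF A] r surj])
  have Vc: "w \<in> carrier ?V \<Longrightarrow> w \<in> carrier R" "w \<in> carrier ?V \<Longrightarrow> ?r w = \<zero>\<^bsub>B\<^esub>" for w by auto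
  have l\<rho>: "lin \<Lambda> ?V Q \<rho>" using lin_comp[OF sesD(4)[OF V] \<rho>] by simp
  have \<rho>0: "q (\<rho> w) = \<zero>\<^bsub>C\<^esub>" if "w \<in> carrier ?V" for w
    using gr[OF Vc(1)[OF that]] Vc(2)[OF that] ses_lin_zero(2)[OF A] by simp
  obtain b where b: "lin \<Lambda> ?V U b" "\<And>w. w \<in> carrier ?V \<Longrightarrow> t (b w) = \<rho> w"
    using lin_corestrict[OF Q(2) l\<rho> \<rho>0] by blast
  have liz: "lin \<Lambda> Z R (\<lambda>x. i (z x))" by (rule lin_comp[OF sesD(4)[OF P(2)] i])
  have iz0: "?r (i (z x)) = \<zero>\<^bsub>B\<^esub>" if "x \<in> carrier Z" for x
    using ri[OF zc[OF that]] ses_comp_zero[OF P(2) that] f0 by simp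
  obtain a where a: "lin \<Lambda> Z ?V a" "\<And>x. x \<in> carrier Z \<Longrightarrow> a x = i (z x)"
    using lin_corestrict[OF V liz iz0] by blast
  note bc = lin_closed[OF b(1)] and ac = lin_closed[OF a(1)]
  have "ses \<Lambda> Z a ?V b U" unfolding ses_def
  proof (intro conjI)
    show "inj_on a (carrier Z)"
    proof (rule inj_onI)
      fix x y assume xy: "x \<in> carrier Z" "y \<in> carrier Z" "a x = a y"
      then have "z x = z y" using a(2) pi(1) zc by metis
      then show "x = y" using ses_inj[OF P(2)] xy by blast
    qed
    show "a ` carrier Z = {w \<in> carrier ?V. b w = \<zero>\<^bsub>U\<^esub>}"
    proof (intro subset_antisym subsetI)
      fix w assume "w \<in> a ` carrier Z"
      then obtain x where x: "x \<in> carrier Z" "w = a x" by blast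
      have "t (b w) = t \<zero>\<^bsub>U\<^esub>"
        using x b(2)[OF ac[OF x(1)]] a(2)[OF x(1)] pi(2)[OF zc[OF x(1)]] ses_lin_zero(1)[OF Q(2)] by simp
      then have "b w = \<zero>\<^bsub>U\<^esub>" using ses_inj[OF Q(2) _ bc[OF ac[OF x(1)]] U.M.zero_closed] x by simp
      then show "w \<in> {w \<in> carrier ?V. b w = \<zero>\<^bsub>U\<^esub>}" using ac[OF x(1)] x by simp
    next
      fix w assume "w \<in> {w \<in> carrier ?V. b w = \<zero>\<^bsub>U\<^esub>}"
      then have w: "w \<in> carrier ?V" "b w = \<zero>\<^bsub>U\<^esub>" by auto
      note wR = Vc(1)[OF w(1)]
      have \<rho>w: "\<rho> w = \<zero>\<^bsub>Q\<^esub>" using b(2)[OF w(1)] w(2) ses_lin_zero(1)[OF Q(2)] by simp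
      have wi: "w = i (\<pi> w)"
        using dec[OF wR] \<rho>w lin_zero[OF Q.left_module_axioms R.left_module_axioms j] ic[OF \<pi>c[OF wR]] by simp
      have "f (p (\<pi> w)) = f \<zero>\<^bsub>A\<^esub>" using Vc(2)[OF w(1)] \<rho>w q0 f0 fc[OF pc[OF \<pi>c[OF wR]]] by simp
      then have "p (\<pi> w) = \<zero>\<^bsub>A\<^esub>" using ses_inj[OF A _ pc[OF \<pi>c[OF wR]] A.M.zero_closed] by simp
      then obtain x where x: "x \<in> carrier Z" "\<pi> w = z x" using ses_kerE[OF P(2) \<pi>c[OF wR]] by blast
      then show "w \<in> a ` carrier Z" using wi a(2)[OF x(1)] by (metis imageI)
    qed
    show "b ` carrier ?V = carrier U"
    proof (intro subset_antisym subsetI)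
      fix y assume y: "y \<in> carrier U"
      have "g (q' (t y)) = \<zero>\<^bsub>C\<^esub>" using q'(2)[OF tc[OF y]] ses_comp_zero[OF Q(2) y] by simp
      then obtain x where x: "x \<in> carrier A" "q' (t y) = f x" using ses_kerE[OF A q'c[OF tc[OF y]]] by blast
      obtain x' where x': "x' \<in> carrier P" "p x' = x" by (rule ses_surjE[OF P(2) x(1)])
      \<comment> \<open>The value q' (t y) need not vanish, but it comes from \<open>A\<close>;
        subtracting a preimage in \<open>P\<close> gives an element of \<open>V\<close> over
        \<open>y\<close>.\<close>
      let ?w = "j (t y) \<ominus>\<^bsub>R\<^esub> i x'"
      note c = jc[OF tc[OF y]] ic[OF x'(1)]
      have "?r ?w = ?r (j (t y)) \<ominus>\<^bsub>B\<^esub> ?r (i x')"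
        by (rule lin_minus[OF R.left_module_axioms B.left_module_axioms r c])
      also have "\<dots> = \<zero>\<^bsub>B\<^esub>"
        unfolding ri[OF x'(1)] rj[OF tc[OF y]] using x x' fc[OF x(1)] by (simp add: B.diff_eq_zero_iff)
      finally have w: "?w \<in> carrier ?V" using c by simp
      have "\<rho> ?w = \<rho> (j (t y)) \<ominus>\<^bsub>Q\<^esub> \<rho> (i x')"
        by (rule lin_minus[OF R.left_module_axioms Q.left_module_axioms \<rho> c])
      then have "t (b ?w) = t y"
        using b(2)[OF w] rh(1)[OF tc[OF y]] pi(2)[OF x'(1)] tc[OF y] by simp
      then have "b ?w = y" using ses_inj[OF Q(2) _ bc[OF w] y] by simp
      from this[symmetric] w show "y \<in> b ` carrier ?V" by (rule image_eqI)
    qed (use bc in blast)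
  qed (use sesD[OF P(2)] sesD[OF Q(2)] sesD[OF V] a b in auto)
  moreover have "projective \<Lambda> R" by (rule projective_biprod[OF P(1) Q(1) R(2,1)])
  ultimately show thesis using that[of R ?V "\<lambda>w. w" ?r a b i] V i a(2) by simp
qed

text \<open>By the horseshoe, a map on \<open>Z\<close> extends to \<open>V\<close> since Ext^1(U,Y)
  is Ext^2(C,Y), then to \<open>R\<close> since Ext^1(B,Y) vanishes, and restricts to
  \<open>P\<close>. In higher degrees the horseshoe supplies the sequence of syzygies for the
  induction.\<close>

lemma Ext_van_left_left:
  assumes "ses \<Lambda> A f B g C" "Y \<in> mods" "Ext_van n B Y" "Ext_van (Suc n) C Y"
  shows "Ext_van n A Y"
  using assms
proof (induct n arbitrary: A f B g C)
  case 0
  note A = 0(1) and Y = 0(2)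
  have "\<exists>e. lin \<Lambda> P Y e \<and> (\<forall>x\<in>carrier Z. e (z x) = h x)"
    if P: "projective \<Lambda> P" "ses \<Lambda> Z z P p A" and h: "lin \<Lambda> Z Y h" for Z z P p h
  proof -
    obtain U t Q q where Q: "projective \<Lambda> Q" "ses \<Lambda> U t Q q C"
      using enough_projectives[OF sesD(3)[OF A]] by metis
    obtain R V v r a b i where R: "projective \<Lambda> R" "ses \<Lambda> V v R r B" "ses \<Lambda> Z a V b U" "lin \<Lambda> P R i"
      "\<And>x. x \<in> carrier Z \<Longrightarrow> v (a x) = i (z x)"
      by (rule horseshoe[OF A P Q]) blast
    obtain e where e: "lin \<Lambda> V Y e" "\<And>x. x \<in> carrier Z \<Longrightarrow> e (a x) = h x"
      using Ext_van_0_extend[OF Ext_van_SucD[OF 0(4) Q] Y R(3) h] by blast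
    obtain d where d: "lin \<Lambda> R Y d" "\<And>x. x \<in> carrier V \<Longrightarrow> d (v x) = e x"
      using Ext_van_0E[OF 0(3) R(1,2) e(1)] by blast
    have "d (i (z x)) = h x" if "x \<in> carrier Z" for x
      using R(5)[OF that] d(2)[OF ses_closed(1)[OF R(3) that]] e(2)[OF that] by simp
    then show ?thesis using lin_comp[OF R(4) d(1)] by (intro exI[of _ "\<lambda>x. d (i x)"]) simp
  qed
  then show ?case by auto
next
  case (Suc n)
  have "Ext_van n Z Y" if P: "projective \<Lambda> P" "ses \<Lambda> Z z P p A" for Z z P p
  proof -
    obtain U t Q q where Q: "projective \<Lambda> Q" "ses \<Lambda> U t Q q C"
      using enough_projectives[OF sesD(3)[OF Suc(2)]] by metis
    obtain R V v r a b i where R: "projective \<Lambda> R" "ses \<Lambda> V v R r B" "ses \<Lambda> Z a V b U"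
      by (rule horseshoe[OF Suc(2) P Q]) blast
    show ?thesis
      by (rule Suc(1)[OF R(3) Suc(3) Ext_van_SucD[OF Suc(4) R(1,2)] Ext_van_SucD[OF Suc(5) Q]])
  qed
  then show ?case by auto
qed

text \<open>The cover \<open>P\<close> of \<open>B\<close> also covers \<open>C\<close>; its kernel
  over \<open>C\<close> is an extension of \<open>A\<close> by its kernel over
  \<open>B\<close>.\<close>

lemma kernel_comp_ses:
  fixes A Z :: "('r, 'm) module"
  assumes A: "ses \<Lambda> A f B g C" and P: "ses \<Lambda> Z z P p B"
  obtains A' t a b where "ses \<Lambda> A' t P (\<lambda>x. g (p x)) C" "ses \<Lambda> Z a A' b A"
    "\<And>x. x \<in> carrier Z \<Longrightarrow> t (a x) = z x"
proof -
  interpret A: left_module \<Lambda> A by (rule sesD[OF A])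
  have gp: "lin \<Lambda> P C (\<lambda>x. g (p x))" by (rule lin_comp[OF sesD(5)[OF P] sesD(5)[OF A]])
  have "(\<lambda>x. g (p x)) ` carrier P = carrier C"
    using sesD(8)[OF A] sesD(8)[OF P] by (metis image_image)
  from kernel_ses[OF sesD(2)[OF P] sesD(3)[OF A] gp this]
  obtain A' t where A': "ses \<Lambda> A' t P (\<lambda>x. g (p x)) C" by blast
  have z0: "g (p (z x)) = \<zero>\<^bsub>C\<^esub>" if "x \<in> carrier Z" for x
    using ses_comp_zero[OF P that] ses_lin_zero(2)[OF A] by simp
  obtain a where a: "lin \<Lambda> Z A' a" "\<And>x. x \<in> carrier Z \<Longrightarrow> t (a x) = z x"
    using lin_corestrict[OF A' sesD(4)[OF P] z0] by blast
  have p0: "g (p (t x)) = \<zero>\<^bsub>C\<^esub>" if "x \<in> carrier A'" for x using ses_comp_zero[OF A' that] .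
  obtain b where b: "lin \<Lambda> A' A b" "\<And>x. x \<in> carrier A' \<Longrightarrow> f (b x) = p (t x)"
    using lin_corestrict[OF A lin_comp[OF sesD(4)[OF A'] sesD(5)[OF P]] p0] by blast
  note ac = lin_closed[OF a(1)] and bc = lin_closed[OF b(1)] and tc = ses_closed(1)[OF A']
  have "ses \<Lambda> Z a A' b A" unfolding ses_def
  proof (intro conjI)
    show "inj_on a (carrier Z)"
    proof (rule inj_onI)
      fix x y assume xy: "x \<in> carrier Z" "y \<in> carrier Z" "a x = a y"
      then have "z x = z y" using a(2) by metis
      then show "x = y" using ses_inj[OF P] xy by blast
    qed
    show "a ` carrier Z = {w \<in> carrier A'. b w = \<zero>\<^bsub>A\<^esub>}"
    proof (intro subset_antisym subsetI)
      fix w assume "w \<in> a ` carrier Z"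
      then obtain x where x: "x \<in> carrier Z" "w = a x" by blast
      have "f (b w) = f \<zero>\<^bsub>A\<^esub>"
        using x b(2)[OF ac[OF x(1)]] a(2)[OF x(1)] ses_comp_zero[OF P x(1)] ses_lin_zero(1)[OF A] by simp
      then have "b w = \<zero>\<^bsub>A\<^esub>" using ses_inj[OF A _ bc[OF ac[OF x(1)]] A.M.zero_closed] x by simp
      then show "w \<in> {w \<in> carrier A'. b w = \<zero>\<^bsub>A\<^esub>}" using ac[OF x(1)] x by simp
    next
      fix w assume "w \<in> {w \<in> carrier A'. b w = \<zero>\<^bsub>A\<^esub>}"
      then have w: "w \<in> carrier A'" "b w = \<zero>\<^bsub>A\<^esub>" by auto
      then have "p (t w) = \<zero>\<^bsub>B\<^esub>" using b(2)[OF w(1)] ses_lin_zero(1)[OF A] by simp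
      then obtain x where x: "x \<in> carrier Z" "t w = z x" using ses_kerE[OF P tc[OF w(1)]] by blast
      then have "w = a x" using ses_inj[OF A' _ w(1) ac[OF x(1)]] a(2)[OF x(1)] by simp
      then show "w \<in> a ` carrier Z" using x by blast
    qed
    show "b ` carrier A' = carrier A"
    proof (intro subset_antisym subsetI)
      fix y assume y: "y \<in> carrier A"
      obtain x where x: "x \<in> carrier P" "p x = f y" by (rule ses_surjE[OF P ses_closed(1)[OF A y]])
      have "g (p x) = \<zero>\<^bsub>C\<^esub>" using x ses_comp_zero[OF A y] by simp
      then obtain w where w: "w \<in> carrier A'" "x = t w" using ses_kerE[OF A' x(1)] by blast
      have "b w = y" using ses_inj[OF A _ bc[OF w(1)] y] b(2)[OF w(1)] w x by simp
      then show "y \<in> b ` carrier A'" using w by blast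
    qed (use bc in blast)
  qed (use sesD[OF P] sesD[OF A] sesD[OF A'] a b in auto)
  then show thesis using that A' a(2) by blast
qed

text \<open>\<open>Z\<close> sits in \<open>A'\<close> with quotient \<open>A\<close>, and
  \<open>A'\<close> in \<open>P\<close> with quotient \<open>C\<close>, so for n = 0 a map on
  \<open>Z\<close> is extended in two steps. For n = m + 1 the sequence from \<open>Z\<close> to
  \<open>A\<close> is handled by \<open>Ext_van_left_left\<close>.\<close>

lemma Ext_van_middle_left:
  assumes A: "ses \<Lambda> A f B g C" and Y: "Y \<in> mods" and "Ext_van n A Y" "Ext_van n C Y"
  shows "Ext_van n B Y"
proof (cases n)
  case 0
  have "\<exists>e. lin \<Lambda> P Y e \<and> (\<forall>x\<in>carrier Z. e (z x) = h x)"
    if P: "projective \<Lambda> P" "ses \<Lambda> Z z P p B" and h: "lin \<Lambda> Z Y h" for Z z P p h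
  proof -
    obtain A' t a b where A': "ses \<Lambda> A' t P (\<lambda>x. g (p x)) C" "ses \<Lambda> Z a A' b A"
      "\<And>x. x \<in> carrier Z \<Longrightarrow> t (a x) = z x"
      by (rule kernel_comp_ses[OF A P(2)]) blast
    obtain e where e: "lin \<Lambda> A' Y e" "\<And>x. x \<in> carrier Z \<Longrightarrow> e (a x) = h x"
      using Ext_van_0_extend[OF assms(3)[unfolded 0] Y A'(2) h] by blast
    obtain d where d: "lin \<Lambda> P Y d" "\<And>x. x \<in> carrier A' \<Longrightarrow> d (t x) = e x"
      using Ext_van_0E[OF assms(4)[unfolded 0] P(1) A'(1) e(1)] by blast
    have "d (z x) = h x" if "x \<in> carrier Z" for x
      using A'(3)[OF that] d(2)[OF ses_closed(1)[OF A'(2) that]] e(2)[OF that] by simp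
    then show ?thesis using d(1) by blast
  qed
  then show ?thesis using 0 by auto
next
  case (Suc m)
  have "Ext_van m Z Y" if P: "projective \<Lambda> P" "ses \<Lambda> Z z P p B" for Z z P p
  proof -
    obtain A' t a b where A': "ses \<Lambda> A' t P (\<lambda>x. g (p x)) C" "ses \<Lambda> Z a A' b A"
      by (rule kernel_comp_ses[OF A P(2)]) blast
    show ?thesis
      by (rule Ext_van_left_left[OF A'(2) Y Ext_van_SucD[OF assms(4)[unfolded Suc] P(1) A'(1)] assms(3)[unfolded Suc]])
  qed
  then show ?thesis using Suc by auto
qed

lemma projective_kernel:
  fixes P A :: "('r, 'm) module"
  assumes P: "projective \<Lambda> P" "projective \<Lambda> Q" and A: "ses \<Lambda> A f Q p P"
  shows "projective \<Lambda> A"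
proof -
  obtain s r where "biprod \<Lambda> A P Q f s r p" using projective_split[OF P(1) A] by blast
  then have "lin \<Lambda> A Q f" "lin \<Lambda> Q A r" "\<forall>x\<in>carrier A. r (f x) = x" by (auto simp: biprod_def)
  then have "retract A Q" unfolding retract_def using sesD(1,2)[OF A] by blast
  then show ?thesis using projective_retract[OF P(2)] by blast
qed

lemma Ext_van_projective: "projective \<Lambda> P \<Longrightarrow> Ext_van n P Y"
proof (induct n arbitrary: P)
  case 0
  have "\<exists>e. lin \<Lambda> Q Y e \<and> (\<forall>x\<in>carrier Z. e (z x) = h x)"
    if Q: "projective \<Lambda> Q" "ses \<Lambda> Z z Q p P" and h: "lin \<Lambda> Z Y h" for Z z Q p h
  proof -
    obtain s r where "biprod \<Lambda> Z P Q z s r p" using projective_split[OF 0 Q(2)] by blast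
    then have r: "lin \<Lambda> Q Z r" "\<And>x. x \<in> carrier Z \<Longrightarrow> r (z x) = x" by (auto simp: biprod_def)
    show ?thesis using lin_comp[OF r(1) h] r(2) by (intro exI[of _ "\<lambda>x. h (r x)"]) simp
  qed
  then show ?case by auto
next
  case (Suc n)
  have "Ext_van n Z Y" if "projective \<Lambda> Q" "ses \<Lambda> Z z Q p P" for Z z Q p
    using Suc(1) projective_kernel[OF Suc(2) that] by blast
  then show ?case by auto
qed

text \<open>In the pullback \<open>W\<close> of \<open>B\<close> and \<open>P\<close> over
  \<open>C\<close>, the sequence A \<rightarrow> W \<rightarrow> P carries vanishing from
  \<open>A\<close> to \<open>W\<close>, and Z \<rightarrow> W \<rightarrow> B carries it on to the
  syzygy \<open>Z\<close> of \<open>C\<close>.\<close>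

lemma Ext_van_right_left:
  assumes A: "ses \<Lambda> A f B g C" and Y: "Y \<in> mods" and E: "Ext_van n A Y" "Ext_van (Suc n) B Y"
  shows "Ext_van (Suc n) C Y"
proof -
  have "Ext_van n Z Y" if P: "projective \<Lambda> P" "ses \<Lambda> Z z P p C" for Z z P p
  proof -
    obtain W a b u v where W: "ses \<Lambda> A u W b P" "ses \<Lambda> Z v W a B"
      by (rule pullback_ses[OF A P(2)]) blast
    have "Ext_van n W Y"
      by (rule Ext_van_middle_left[OF W(1) Y E(1) Ext_van_projective[OF P(1)]])
    then show ?thesis by (rule Ext_van_left_left[OF W(2) Y _ E(2)])
  qed
  then show ?thesis by auto
qed

text \<open>The start of the long exact sequence in the first variable, with surjectivity of
  Hom(B,Y) \<rightarrow> Hom(A,Y) in place of vanishing in the preceding degree. An extension to the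
  pullback \<open>W\<close> is corrected on \<open>A\<close> by a map from \<open>B\<close>, which
  is zero on \<open>Z\<close>.\<close>

lemma Ext_van_right_left_0:
  assumes A: "ses \<Lambda> A f B g C" and Y: "Y \<in> mods" and E: "Ext_van 0 B Y"
    and onto: "\<And>h. lin \<Lambda> A Y h \<Longrightarrow> \<exists>e. lin \<Lambda> B Y e \<and> (\<forall>x\<in>carrier A. e (f x) = h x)"
  shows "Ext_van 0 C Y"
proof -
  interpret Y: left_module \<Lambda> Y using Y by (rule mod_catD)
  have "\<exists>e. lin \<Lambda> P Y e \<and> (\<forall>x\<in>carrier Z. e (z x) = h x)"
    if P: "projective \<Lambda> P" "ses \<Lambda> Z z P p C" and h: "lin \<Lambda> Z Y h" for Z z P p h
  proof -
    obtain W a b u v where W: "ses \<Lambda> A u W b P" "ses \<Lambda> Z v W a B"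
      "\<And>x. x \<in> carrier A \<Longrightarrow> a (u x) = f x" "\<And>x. x \<in> carrier Z \<Longrightarrow> b (v x) = z x"
      "\<And>w. w \<in> carrier W \<Longrightarrow> g (a w) = p (b w)"
      by (rule pullback_ses[OF A P(2)]) blast
    obtain e where e: "lin \<Lambda> W Y e" "\<And>x. x \<in> carrier Z \<Longrightarrow> e (v x) = h x"
      using Ext_van_0_extend[OF E Y W(2) h] by blast
    obtain d where d: "lin \<Lambda> B Y d" "\<And>x. x \<in> carrier A \<Longrightarrow> d (f x) = e (u x)"
      using onto[OF lin_comp[OF sesD(4)[OF W(1)] e(1)]] by blast
    have m: "lin \<Lambda> W Y (\<lambda>w. e w \<ominus>\<^bsub>Y\<^esub> d (a w))"
      by (intro lin_diff Y.left_module_axioms e(1) lin_comp[OF sesD(5)[OF W(2)] d(1)])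
    have m0: "e (u x) \<ominus>\<^bsub>Y\<^esub> d (a (u x)) = \<zero>\<^bsub>Y\<^esub>" if "x \<in> carrier A" for x
      using W(3)[OF that] d(2)[OF that] lin_closed[OF e(1) ses_closed(1)[OF W(1) that]]
      by (simp add: Y.diff_eq_zero_iff)
    obtain l where l: "lin \<Lambda> P Y l" "\<And>w. w \<in> carrier W \<Longrightarrow> l (b w) = e w \<ominus>\<^bsub>Y\<^esub> d (a w)"
      using lin_factor[OF W(1) m Y.left_module_axioms m0] by blast
    have "l (z x) = h x" if "x \<in> carrier Z" for x
      using l(2)[OF ses_closed(1)[OF W(2) that]] W(4)[OF that] e(2)[OF that] ses_comp_zero[OF W(2) that]
        lin_zero[OF sesD(10)[OF A] Y.left_module_axioms d(1)] lin_closed[OF h that] by simp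
    then show ?thesis using l(1) by blast
  qed
  then show ?thesis by auto
qed

text \<open>A retraction lifts to the syzygies up to a map that factors through a projective module.\<close>

lemma retract_syzygy:
  assumes r: "retract U V" and P: "projective \<Lambda> P" "ses \<Lambda> Z z P p U" and Q: "projective \<Lambda> Q" "ses \<Lambda> A k Q q V"
  obtains \<alpha> \<alpha>' \<beta> \<delta> where "lin \<Lambda> P Q \<alpha>" "lin \<Lambda> Z A \<alpha>'" "lin \<Lambda> A Z \<beta>" "lin \<Lambda> P Z \<delta>"
    "\<And>x. x \<in> carrier Z \<Longrightarrow> \<alpha> (z x) = k (\<alpha>' x)"
    "\<And>x. x \<in> carrier Z \<Longrightarrow> \<beta> (\<alpha>' x) \<ominus>\<^bsub>Z\<^esub> \<delta> (z x) = x"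
proof -
  obtain s r where sr: "lin \<Lambda> U V s" "lin \<Lambda> V U r" "\<And>x. x \<in> carrier U \<Longrightarrow> r (s x) = x"
    using r by (auto simp: retract_def)
  interpret U: left_module \<Lambda> U by (rule sesD[OF P(2)])
  interpret V: left_module \<Lambda> V by (rule sesD[OF Q(2)])
  interpret P: left_module \<Lambda> P by (rule sesD[OF P(2)])
  interpret Z: left_module \<Lambda> Z by (rule sesD[OF P(2)])
  note pc = ses_closed(2)[OF P(2)] and zc = ses_closed(1)[OF P(2)] and qc = ses_closed(2)[OF Q(2)]
    and kc = ses_closed(1)[OF Q(2)]
  obtain \<alpha> where \<alpha>: "lin \<Lambda> P Q \<alpha>" "\<And>x. x \<in> carrier P \<Longrightarrow> q (\<alpha> x) = s (p x)"
    using projective_lift[OF P(1) Q(2) lin_comp[OF sesD(5)[OF P(2)] sr(1)]] by blast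
  obtain b where b: "lin \<Lambda> Q P b" "\<And>x. x \<in> carrier Q \<Longrightarrow> p (b x) = r (q x)"
    using projective_lift[OF Q(1) P(2) lin_comp[OF sesD(5)[OF Q(2)] sr(2)]] by blast
  have "q (\<alpha> (z x)) = \<zero>\<^bsub>V\<^esub>" if "x \<in> carrier Z" for x
    using \<alpha>(2)[OF zc[OF that]] ses_comp_zero[OF P(2) that]
      lin_zero[OF U.left_module_axioms V.left_module_axioms sr(1)] by simp
  then obtain \<alpha>' where \<alpha>': "lin \<Lambda> Z A \<alpha>'" "\<And>x. x \<in> carrier Z \<Longrightarrow> k (\<alpha>' x) = \<alpha> (z x)"
    using lin_corestrict[OF Q(2) lin_comp[OF sesD(4)[OF P(2)] \<alpha>(1)]] by blast
  have "p (b (k x)) = \<zero>\<^bsub>U\<^esub>" if "x \<in> carrier A" for x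
    using b(2)[OF kc[OF that]] ses_comp_zero[OF Q(2) that]
      lin_zero[OF V.left_module_axioms U.left_module_axioms sr(2)] by simp
  then obtain \<beta> where \<beta>: "lin \<Lambda> A Z \<beta>" "\<And>x. x \<in> carrier A \<Longrightarrow> z (\<beta> x) = b (k x)"
    using lin_corestrict[OF P(2) lin_comp[OF sesD(4)[OF Q(2)] b(1)]] by blast
  note b\<alpha> = lin_comp[OF \<alpha>(1) b(1)]
  \<comment> \<open>b \<alpha> and the identity of \<open>P\<close> lift the same map to
    \<open>U\<close>, so their difference has values in \<open>Z\<close>; this is \<delta>.\<close>
  have d: "lin \<Lambda> P P (\<lambda>x. b (\<alpha> x) \<ominus>\<^bsub>P\<^esub> x)"
    by (intro lin_diff P.left_module_axioms lin_id b\<alpha>)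
  have "p (b (\<alpha> x) \<ominus>\<^bsub>P\<^esub> x) = \<zero>\<^bsub>U\<^esub>" if "x \<in> carrier P" for x
    using that lin_closed[OF b\<alpha> that] b(2)[OF lin_closed[OF \<alpha>(1) that]] \<alpha>(2)[OF that] sr(3)[OF pc[OF that]] pc[OF that]
    by (simp add: lin_minus[OF sesD(10,11,5)[OF P(2)]] U.diff_eq_zero_iff)
  then obtain \<delta> where \<delta>: "lin \<Lambda> P Z \<delta>" "\<And>x. x \<in> carrier P \<Longrightarrow> z (\<delta> x) = b (\<alpha> x) \<ominus>\<^bsub>P\<^esub> x"
    using lin_corestrict[OF P(2) d] by blast
  have "\<beta> (\<alpha>' x) \<ominus>\<^bsub>Z\<^esub> \<delta> (z x) = x" if x: "x \<in> carrier Z" for x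
  proof (rule ses_inj[OF P(2)])
    note c = lin_closed[OF \<beta>(1) lin_closed[OF \<alpha>'(1) x]] lin_closed[OF \<delta>(1) zc[OF x]]
    show "z (\<beta> (\<alpha>' x) \<ominus>\<^bsub>Z\<^esub> \<delta> (z x)) = z x"
      using c \<beta>(2)[OF lin_closed[OF \<alpha>'(1) x]] \<delta>(2)[OF zc[OF x]] \<alpha>'(2)[OF x] lin_closed[OF b\<alpha> zc[OF x]] zc[OF x]
      by (simp add: lin_minus[OF sesD(9,10,4)[OF P(2)]] P.diff_diff_cancel)
    show "\<beta> (\<alpha>' x) \<ominus>\<^bsub>Z\<^esub> \<delta> (z x) \<in> carrier Z" using c by simp
  qed (rule x)
  then show thesis using that[OF \<alpha>(1) \<alpha>'(1) \<beta>(1) \<delta>(1)] \<alpha>'(2) by simp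
qed

text \<open>The syzygy \<open>Z\<close> of \<open>U\<close> need not be a summand of the syzygy
  \<open>A\<close> of \<open>V\<close>, but by \<open>retract_syzygy\<close> it is a summand of a
  direct sum of \<open>A\<close> and \<open>P\<close>, and \<open>P\<close> contributes no Ext. In
  the base case the correcting term h \<delta> is already defined on all of
  \<open>P\<close>.\<close>

lemma Ext_van_retract_left:
  assumes "retract U V" "Y \<in> mods" "Ext_van n V Y"
  shows "Ext_van n U Y"
  using assms
proof (induct n arbitrary: U V)
  case 0
  interpret Y: left_module \<Lambda> Y using 0(2) by (rule mod_catD)
  have "\<exists>e. lin \<Lambda> P Y e \<and> (\<forall>x\<in>carrier Z. e (z x) = h x)"
    if P: "projective \<Lambda> P" "ses \<Lambda> Z z P p U" and h: "lin \<Lambda> Z Y h" for Z z P p h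
  proof -
    interpret Z: left_module \<Lambda> Z by (rule sesD[OF P(2)])
    have "V \<in> mods" using 0(1) by (simp add: retract_def)
    then obtain A k Q q where Q: "projective \<Lambda> Q" "ses \<Lambda> A k Q q V"
      using enough_projectives by metis
    obtain \<alpha> \<alpha>' \<beta> \<delta> where ab: "lin \<Lambda> P Q \<alpha>" "lin \<Lambda> Z A \<alpha>'" "lin \<Lambda> A Z \<beta>" "lin \<Lambda> P Z \<delta>"
      "\<And>x. x \<in> carrier Z \<Longrightarrow> \<alpha> (z x) = k (\<alpha>' x)"
      "\<And>x. x \<in> carrier Z \<Longrightarrow> \<beta> (\<alpha>' x) \<ominus>\<^bsub>Z\<^esub> \<delta> (z x) = x"
      by (rule retract_syzygy[OF 0(1) P Q]) blast
    obtain e where e: "lin \<Lambda> Q Y e" "\<And>x. x \<in> carrier A \<Longrightarrow> e (k x) = h (\<beta> x)"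
      using Ext_van_0E[OF 0(3) Q lin_comp[OF ab(3) h]] by blast
    have "lin \<Lambda> P Y (\<lambda>x. e (\<alpha> x) \<ominus>\<^bsub>Y\<^esub> h (\<delta> x))"
      by (intro lin_diff Y.left_module_axioms lin_comp[OF ab(1) e(1)] lin_comp[OF ab(4) h])
    moreover have "e (\<alpha> (z x)) \<ominus>\<^bsub>Y\<^esub> h (\<delta> (z x)) = h x" if x: "x \<in> carrier Z" for x
    proof -
      note a'x = lin_closed[OF ab(2) x]
      have "e (\<alpha> (z x)) \<ominus>\<^bsub>Y\<^esub> h (\<delta> (z x)) = h (\<beta> (\<alpha>' x)) \<ominus>\<^bsub>Y\<^esub> h (\<delta> (z x))"
        using ab(5)[OF x] e(2)[OF a'x] by simp
      also have "\<dots> = h (\<beta> (\<alpha>' x) \<ominus>\<^bsub>Z\<^esub> \<delta> (z x))"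
        by (rule lin_minus[OF Z.left_module_axioms Y.left_module_axioms h lin_closed[OF ab(3) a'x]
              lin_closed[OF ab(4) ses_closed(1)[OF P(2) x]], symmetric])
      finally show ?thesis using ab(6)[OF x] by simp
    qed
    ultimately show ?thesis by (intro exI[of _ "\<lambda>x. e (\<alpha> x) \<ominus>\<^bsub>Y\<^esub> h (\<delta> x)"]) simp
  qed
  then show ?case by auto
next
  case (Suc n)
  have "Ext_van n Z Y" if P: "projective \<Lambda> P" "ses \<Lambda> Z z P p U" for Z z P p
  proof -
    interpret Z: left_module \<Lambda> Z by (rule sesD[OF P(2)])
    interpret P: left_module \<Lambda> P by (rule sesD[OF P(2)])
    have "V \<in> mods" using Suc(2) by (simp add: retract_def)
    then obtain A k Q q where Q: "projective \<Lambda> Q" "ses \<Lambda> A k Q q V"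
      using enough_projectives by metis
    interpret A: left_module \<Lambda> A by (rule sesD[OF Q(2)])
    obtain \<alpha> \<alpha>' \<beta> \<delta> where ab: "lin \<Lambda> P Q \<alpha>" "lin \<Lambda> Z A \<alpha>'" "lin \<Lambda> A Z \<beta>" "lin \<Lambda> P Z \<delta>"
      "\<And>x. x \<in> carrier Z \<Longrightarrow> \<alpha> (z x) = k (\<alpha>' x)"
      "\<And>x. x \<in> carrier Z \<Longrightarrow> \<beta> (\<alpha>' x) \<ominus>\<^bsub>Z\<^esub> \<delta> (z x) = x"
      by (rule retract_syzygy[OF Suc(2) P Q]) blast
    obtain W i j \<pi> \<rho> where W: "W \<in> mods" "biprod \<Lambda> A P W i j \<pi> \<rho>"
      using biprod_exists[OF sesD(1)[OF Q(2)] sesD(2)[OF P(2)]] by metis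
    interpret W: left_module \<Lambda> W using W(1) by (rule mod_catD)
    have i: "lin \<Lambda> A W i" and j: "lin \<Lambda> P W j" and \<pi>: "lin \<Lambda> W A \<pi>" and \<rho>: "lin \<Lambda> W P \<rho>"
      and ij: "\<And>x. x \<in> carrier A \<Longrightarrow> \<pi> (i x) = x" "\<And>x. x \<in> carrier A \<Longrightarrow> \<rho> (i x) = \<zero>\<^bsub>P\<^esub>"
        "\<And>x. x \<in> carrier P \<Longrightarrow> \<rho> (j x) = x" "\<And>x. x \<in> carrier P \<Longrightarrow> \<pi> (j x) = \<zero>\<^bsub>A\<^esub>"
      using W(2) by (auto simp: biprod_def)
    let ?s = "\<lambda>x. i (\<alpha>' x) \<oplus>\<^bsub>W\<^esub> j (z x)" and ?r = "\<lambda>w. \<beta> (\<pi> w) \<ominus>\<^bsub>Z\<^esub> \<delta> (\<rho> w)"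
    have "lin \<Lambda> Z W ?s"
      by (intro lin_sum W.left_module_axioms lin_comp[OF ab(2) i] lin_comp[OF sesD(4)[OF P(2)] j])
    moreover have "lin \<Lambda> W Z ?r"
      by (intro lin_diff Z.left_module_axioms lin_comp[OF \<pi> ab(3)] lin_comp[OF \<rho> ab(4)])
    moreover have "?r (?s x) = x" if x: "x \<in> carrier Z" for x
    proof -
      note a'x = lin_closed[OF ab(2) x] and zx = ses_closed(1)[OF P(2) x]
      have "\<pi> (?s x) = \<alpha>' x" "\<rho> (?s x) = z x"
        using a'x zx lin_closed[OF i a'x] lin_closed[OF j zx]
        by (auto simp: lin_add[OF \<pi>] lin_add[OF \<rho>] ij)
      then show ?thesis using ab(6)[OF x] by simp
    qed
    ultimately have "retract Z W"
      unfolding retract_def using W(1) sesD(1)[OF P(2)] by blast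
    moreover have "Ext_van n W Y"
      by (rule Ext_van_middle_left[OF biprod_ses(1)[OF W(2) sesD(1)[OF Q(2)] sesD(2)[OF P(2)] W(1)] Suc(3)
            Ext_van_SucD[OF Suc(4) Q] Ext_van_projective[OF P(1)]])
    ultimately show ?thesis using Suc(1) Suc(3) by blast
  qed
  then show ?case by auto
qed

end

section \<open>The additive closure of a module\<close>

lemma lin_inv_into:
  assumes V: "left_module \<Lambda> V" and f: "lin \<Lambda> V W f" and bij: "bij_betw f (carrier V) (carrier W)"
  shows "lin \<Lambda> W V (inv_into (carrier V) f)"
proof -
  interpret V: left_module \<Lambda> V by (rule V)
  let ?g = "inv_into (carrier V) f"
  have g: "?g y \<in> carrier V" "f (?g y) = y" if "y \<in> carrier W" for y
    using that bij by (auto simp: bij_betw_def inv_into_into f_inv_into_f)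
  have gf: "?g (f x) = x" if "x \<in> carrier V" for x
    using that bij by (auto simp: bij_betw_def)
  show ?thesis
  proof (rule linI)
    fix x y assume xy: "x \<in> carrier W" "y \<in> carrier W"
    then show "?g (x \<oplus>\<^bsub>W\<^esub> y) = ?g x \<oplus>\<^bsub>V\<^esub> ?g y"
      using gf[of "?g x \<oplus>\<^bsub>V\<^esub> ?g y"] g[OF xy(1)] g[OF xy(2)] by (simp add: lin_add[OF f])
  next
    fix a x assume "a \<in> carrier \<Lambda>" "x \<in> carrier W"
    then show "?g (a \<odot>\<^bsub>W\<^esub> x) = a \<odot>\<^bsub>V\<^esub> ?g x"
      using gf[of "a \<odot>\<^bsub>V\<^esub> ?g x"] g[of x] by (simp add: lin_smult[OF f])
  qed (rule g)
qed

lemma direct_power_simps [simp]: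
  "carrier (direct_power n M) = {..<n} \<rightarrow>\<^sub>E carrier M"
  "\<zero>\<^bsub>direct_power n M\<^esub> = (\<lambda>i\<in>{..<n}. \<zero>\<^bsub>M\<^esub>)"
  "u \<oplus>\<^bsub>direct_power n M\<^esub> v = (\<lambda>i\<in>{..<n}. u i \<oplus>\<^bsub>M\<^esub> v i)"
  "a \<odot>\<^bsub>direct_power n M\<^esub> u = (\<lambda>i\<in>{..<n}. a \<odot>\<^bsub>M\<^esub> u i)"
  by (simp_all add: direct_power_def)

context artin_modules begin

text \<open>Contains \<open>add_cat \<Lambda> M\<close> by \<open>add_cat_imp_add_closure\<close>,
  stays within the type \<open>'m\<close>, and comes with an induction rule, whereas direct powers
  live in a type of functions on \<open>nat\<close>. Isomorphic copies are covered by
  \<open>retract\<close>.\<close>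

inductive add_closure :: "('r, 'm) module \<Rightarrow> ('r, 'm) module \<Rightarrow> bool" for M where
  base: "add_closure M M"
| biprod: "add_closure M U \<Longrightarrow> add_closure M V \<Longrightarrow> W \<in> mods \<Longrightarrow> biprod \<Lambda> U V W i j p q \<Longrightarrow> add_closure M W"
| retract: "add_closure M V \<Longrightarrow> retract U V \<Longrightarrow> add_closure M U"

lemma add_closure_mods: "add_closure M W \<Longrightarrow> M \<in> mods \<Longrightarrow> W \<in> mods"
  by (induct rule: add_closure.induct) (auto simp: retract_def)

lemma Ext_van_add_closure_left:
  assumes W: "add_closure M W" and M: "M \<in> mods" and Y: "Y \<in> mods" and E: "Ext_van n M Y"
  shows "Ext_van n W Y"
  using W
proof (induct rule: add_closure.induct)
  case (biprod U V W i j p q)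
  then show ?case
    using Ext_van_middle_left[OF biprod_ses(1)[OF biprod(6)] Y] add_closure_mods[OF _ M] by blast
next
  case (retract V U)
  then show ?case using Ext_van_retract_left Y by blast
qed (rule E)

lemma Ext_van_add_closure_right:
  assumes W: "add_closure M W" and M: "M \<in> mods" and E: "Ext_van n U M"
  shows "Ext_van n U W"
  using W
proof (induct rule: add_closure.induct)
  case (biprod U V W i j p q)
  then show ?case
    using Ext_van_middle_right[OF biprod_ses(1)[OF biprod(6)]] add_closure_mods[OF _ M] by blast
next
  case (retract V U)
  then show ?case using Ext_van_retract_right by blast
qed (rule E)

text \<open>This makes the modules in add M projective relative to F_M. It serves to factor maps
  through approximations and to split F_M-exact sequences that end in add M.\<close>

lemma add_closure_lift:
  assumes W: "add_closure M W" and M: "M \<in> mods" and B: "B \<in> mods" and C: "C \<in> mods" and g: "lin \<Lambda> B C g"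
    and lift: "\<And>h. lin \<Lambda> M C h \<Longrightarrow> \<exists>k. lin \<Lambda> M B k \<and> (\<forall>x\<in>carrier M. g (k x) = h x)"
  shows "lin \<Lambda> W C h \<Longrightarrow> \<exists>k. lin \<Lambda> W B k \<and> (\<forall>x\<in>carrier W. g (k x) = h x)"
  using W
proof (induct arbitrary: h rule: add_closure.induct)
  case base
  then show ?case using lift by blast
next
  case (biprod U V W i j p q)
  interpret B: left_module \<Lambda> B using B by (rule mod_catD)
  have i: "lin \<Lambda> U W i" and j: "lin \<Lambda> V W j" and p: "lin \<Lambda> W U p" and q: "lin \<Lambda> W V q"
    and dec: "\<And>w. w \<in> carrier W \<Longrightarrow> i (p w) \<oplus>\<^bsub>W\<^esub> j (q w) = w"
    using biprod(6) by (auto simp: biprod_def)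
  obtain k where k: "lin \<Lambda> U B k" "\<And>x. x \<in> carrier U \<Longrightarrow> g (k x) = h (i x)"
    using biprod(2)[OF lin_comp[OF i biprod(7)]] by blast
  obtain l where l: "lin \<Lambda> V B l" "\<And>x. x \<in> carrier V \<Longrightarrow> g (l x) = h (j x)"
    using biprod(4)[OF lin_comp[OF j biprod(7)]] by blast
  have "lin \<Lambda> W B (\<lambda>w. k (p w) \<oplus>\<^bsub>B\<^esub> l (q w))"
    by (intro lin_sum B.left_module_axioms lin_comp[OF p k(1)] lin_comp[OF q l(1)])
  moreover have "g (k (p w) \<oplus>\<^bsub>B\<^esub> l (q w)) = h w" if w: "w \<in> carrier W" for w
  proof -
    note c = lin_closed[OF p w] lin_closed[OF q w]
    have "g (k (p w) \<oplus>\<^bsub>B\<^esub> l (q w)) = h (i (p w)) \<oplus>\<^bsub>C\<^esub> h (j (q w))"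
      using c lin_closed[OF k(1)] lin_closed[OF l(1)] by (simp add: lin_add[OF g] k(2) l(2))
    also have "\<dots> = h (i (p w) \<oplus>\<^bsub>W\<^esub> j (q w))"
      using c lin_closed[OF i] lin_closed[OF j] by (simp add: lin_add[OF biprod(7)])
    finally show ?thesis using dec[OF w] by simp
  qed
  ultimately show ?case by (intro exI[of _ "\<lambda>w. k (p w) \<oplus>\<^bsub>B\<^esub> l (q w)"]) simp
next
  case (retract V U)
  obtain s r where sr: "lin \<Lambda> U V s" "lin \<Lambda> V U r" "\<And>x. x \<in> carrier U \<Longrightarrow> r (s x) = x"
    using retract(3) by (auto simp: retract_def)
  obtain k where k: "lin \<Lambda> V B k" "\<And>x. x \<in> carrier V \<Longrightarrow> g (k x) = h (r x)"
    using retract(2)[OF lin_comp[OF sr(2) retract(4)]] by blast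
  show ?case using lin_comp[OF sr(1) k(1)] k(2)[OF lin_closed[OF sr(1)]] sr(3)
    by (intro exI[of _ "\<lambda>x. k (s x)"]) simp
qed

text \<open>The dual form: the modules in add M are injective relative to F^M. It serves to show
  that left approximations are injective, and for the terms of the coresolution in (b).\<close>

lemma add_closure_extend:
  assumes W: "add_closure M W" and M: "M \<in> mods" and f: "lin \<Lambda> A B f"
    and ext: "\<And>h. lin \<Lambda> A M h \<Longrightarrow> \<exists>e. lin \<Lambda> B M e \<and> (\<forall>x\<in>carrier A. e (f x) = h x)"
  shows "lin \<Lambda> A W h \<Longrightarrow> \<exists>e. lin \<Lambda> B W e \<and> (\<forall>x\<in>carrier A. e (f x) = h x)"
  using W
proof (induct arbitrary: h rule: add_closure.induct)
  case base
  then show ?case using ext by blast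
next
  case (biprod U V W i j p q)
  interpret W: left_module \<Lambda> W using biprod(5) by (rule mod_catD)
  have i: "lin \<Lambda> U W i" and j: "lin \<Lambda> V W j" and p: "lin \<Lambda> W U p" and q: "lin \<Lambda> W V q"
    and dec: "\<And>w. w \<in> carrier W \<Longrightarrow> i (p w) \<oplus>\<^bsub>W\<^esub> j (q w) = w"
    using biprod(6) by (auto simp: biprod_def)
  obtain k where k: "lin \<Lambda> B U k" "\<And>x. x \<in> carrier A \<Longrightarrow> k (f x) = p (h x)"
    using biprod(2)[OF lin_comp[OF biprod(7) p]] by blast
  obtain l where l: "lin \<Lambda> B V l" "\<And>x. x \<in> carrier A \<Longrightarrow> l (f x) = q (h x)"
    using biprod(4)[OF lin_comp[OF biprod(7) q]] by blast
  have "lin \<Lambda> B W (\<lambda>x. i (k x) \<oplus>\<^bsub>W\<^esub> j (l x))"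
    by (intro lin_sum W.left_module_axioms lin_comp[OF k(1) i] lin_comp[OF l(1) j])
  moreover have "i (k (f x)) \<oplus>\<^bsub>W\<^esub> j (l (f x)) = h x" if "x \<in> carrier A" for x
    using that k(2) l(2) dec[OF lin_closed[OF biprod(7) that]] by simp
  ultimately show ?case by (intro exI[of _ "\<lambda>x. i (k x) \<oplus>\<^bsub>W\<^esub> j (l x)"]) simp
next
  case (retract V U)
  obtain s r where sr: "lin \<Lambda> U V s" "lin \<Lambda> V U r" "\<And>x. x \<in> carrier U \<Longrightarrow> r (s x) = x"
    using retract(3) by (auto simp: retract_def)
  obtain k where k: "lin \<Lambda> B V k" "\<And>x. x \<in> carrier A \<Longrightarrow> k (f x) = s (h x)"
    using retract(2)[OF lin_comp[OF retract(4) sr(1)]] by blast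
  show ?case using lin_comp[OF k(1) sr(2)] k(2) sr(3) lin_closed[OF retract(4)]
    by (intro exI[of _ "\<lambda>x. r (k x)"]) simp
qed

lemma zero_module: "M \<in> mods \<Longrightarrow> M\<lparr>carrier := {\<zero>\<^bsub>M\<^esub>}\<rparr> \<in> mods"
  using submod_mod_cat left_module.submod_zero mod_catD by blast

text \<open>The power M^n has its carrier among functions on \<open>nat\<close>, so a module
  \<open>N\<close> of the right type stands in for it: an iterated direct sum of copies of
  \<open>M\<close>, starting from a zero module. A one-sided inverse is enough to carry summands of
  M^n to summands of \<open>N\<close>.\<close>

lemma direct_power_retract:
  assumes M: "M \<in> mods"
  shows "\<exists>N f g. add_closure M N \<and> lin \<Lambda> N (direct_power n M) f \<and> lin \<Lambda> (direct_power n M) N g \<and>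
     (\<forall>u\<in>carrier (direct_power n M). f (g u) = u)"
proof (induct n)
  case 0
  interpret M: left_module \<Lambda> M using M by (rule mod_catD)
  let ?N = "M\<lparr>carrier := {\<zero>\<^bsub>M\<^esub>}\<rparr>"
  have "lin \<Lambda> ?N M (\<lambda>x. x)" "lin \<Lambda> M ?N (\<lambda>x. \<zero>\<^bsub>M\<^esub>)" by (auto simp: lin_def)
  then have "retract ?N M" unfolding retract_def using M zero_module[OF M] by auto
  then have "add_closure M ?N" by (rule add_closure.retract[OF add_closure.base])
  \<comment> \<open>The only element of the zeroth power is the extensional function on the empty
    set, which is \<open>undefined\<close> everywhere.\<close>
  moreover have "lin \<Lambda> ?N (direct_power 0 M) (\<lambda>x. \<lambda>i. undefined)" "lin \<Lambda> (direct_power 0 M) ?N (\<lambda>x. \<zero>\<^bsub>M\<^esub>)"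
    by (auto simp: lin_def)
  ultimately show ?case
    by (intro exI[of _ ?N] exI[of _ "\<lambda>x. \<lambda>i. undefined"] exI[of _ "\<lambda>x. \<zero>\<^bsub>M\<^esub>"]) auto
next
  case (Suc n)
  interpret M: left_module \<Lambda> M using M by (rule mod_catD)
  from Suc obtain N f g where N: "add_closure M N" "lin \<Lambda> N (direct_power n M) f" "lin \<Lambda> (direct_power n M) N g"
    "\<And>u. u \<in> carrier (direct_power n M) \<Longrightarrow> f (g u) = u" by blast
  have Nm: "N \<in> mods" using add_closure_mods[OF N(1) M] .
  obtain W i j p q where W: "W \<in> mods" "biprod \<Lambda> N M W i j p q" using biprod_exists[OF Nm M] by metis
  interpret W: left_module \<Lambda> W using W(1) by (rule mod_catD)
  interpret N: left_module \<Lambda> N using Nm by (rule mod_catD)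
  have i: "lin \<Lambda> N W i" and j: "lin \<Lambda> M W j" and p: "lin \<Lambda> W N p" and q: "lin \<Lambda> W M q"
    and ij: "\<And>x. x \<in> carrier N \<Longrightarrow> p (i x) = x" "\<And>x. x \<in> carrier N \<Longrightarrow> q (i x) = \<zero>\<^bsub>M\<^esub>"
      "\<And>x. x \<in> carrier M \<Longrightarrow> q (j x) = x" "\<And>x. x \<in> carrier M \<Longrightarrow> p (j x) = \<zero>\<^bsub>N\<^esub>"
    using W(2) by (auto simp: biprod_def)
  let ?D = "direct_power (Suc n) M"
  let ?f = "\<lambda>w. \<lambda>m\<in>{..<Suc n}. if m < n then f (p w) m else q w"
  let ?g = "\<lambda>u. i (g (restrict u {..<n})) \<oplus>\<^bsub>W\<^esub> j (u n)"
  have fp: "lin \<Lambda> W (direct_power n M) (\<lambda>w. f (p w))" by (rule lin_comp[OF p N(2)])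
  have fpc: "f (p w) m \<in> carrier M" if "w \<in> carrier W" "m < n" for w m
    using lin_closed[OF fp that(1)] that(2) by auto
  have f: "lin \<Lambda> W ?D ?f"
  proof (rule linI)
    fix w assume w: "w \<in> carrier W"
    then show "?f w \<in> carrier ?D" using fpc[OF w] lin_closed[OF q w] by auto
    { fix v assume v: "v \<in> carrier W"
      show "?f (w \<oplus>\<^bsub>W\<^esub> v) = ?f w \<oplus>\<^bsub>?D\<^esub> ?f v"
        using lin_add[OF fp w v] lin_add[OF q w v] by (auto simp: fun_eq_iff) }
    fix a assume a: "a \<in> carrier \<Lambda>"
    show "?f (a \<odot>\<^bsub>W\<^esub> w) = a \<odot>\<^bsub>?D\<^esub> ?f w"
      using lin_smult[OF fp a w] lin_smult[OF q a w] by (auto simp: fun_eq_iff)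
  qed
  have res: "lin \<Lambda> ?D (direct_power n M) (\<lambda>u. restrict u {..<n})"
  proof (rule linI)
    fix u assume "u \<in> carrier ?D"
    then have "u m \<in> carrier M" if "m < n" for m
      using that PiE_mem[of u "{..<Suc n}" "\<lambda>_. carrier M" m] by simp
    then show "restrict u {..<n} \<in> carrier (direct_power n M)"
      unfolding direct_power_simps restrict_PiE_iff by simp
  qed (simp_all add: fun_eq_iff)
  have ev: "lin \<Lambda> ?D M (\<lambda>u. u n)"
    by (auto simp: lin_def)
  have g: "lin \<Lambda> ?D W ?g"
    by (intro lin_sum W.left_module_axioms lin_comp[OF lin_comp[OF res N(3)] i] lin_comp[OF ev j])
  have "?f (?g u) = u" if u: "u \<in> carrier ?D" for u
  proof -
    note r = lin_closed[OF res u] and un = lin_closed[OF ev u]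
    note gr = lin_closed[OF N(3) r]
    note c = lin_closed[OF i gr] lin_closed[OF j un]
    have pq: "p (?g u) = g (restrict u {..<n})" "q (?g u) = u n"
      using c gr un by (simp_all add: lin_add[OF p] lin_add[OF q] ij)
    have "?f (?g u) = (\<lambda>m\<in>{..<Suc n}. if m < n then restrict u {..<n} m else u n)"
      by (simp only: pq N(4)[OF r])
    also have "\<dots> = u"
    proof
      fix m show "(\<lambda>m\<in>{..<Suc n}. if m < n then restrict u {..<n} m else u n) m = u m"
        using u by (cases "m < n"; cases "m = n") (auto simp: PiE_def extensional_def)
    qed
    finally show ?thesis .
  qed
  moreover have "add_closure M W" by (rule add_closure.biprod[OF N(1) add_closure.base W])
  ultimately show ?case using f g by blast
qed

lemma add_cat_imp_add_closure:
  assumes M: "M \<in> mods" and V: "V \<in> add_cat \<Lambda> M"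
  shows "add_closure M V"
proof -
  obtain n and W :: "('r, 'm) module" and F where V: "V \<in> mods" and W: "W \<in> mods"
    and F: "F \<in> Hom_set \<Lambda> (direct_sum V W) (direct_power n M)"
      "bij_betw F (carrier (direct_sum V W)) (carrier (direct_power n M))"
    using V by (auto simp: add_cat_def mod_iso_def)
  have ld: "left_module \<Lambda> (direct_sum V W)" by (rule direct_sum_left_module[OF mod_catD[OF V] mod_catD[OF W]])
  have b: "lin \<Lambda> V (direct_sum V W) (\<lambda>x. (x, \<zero>\<^bsub>W\<^esub>))" "lin \<Lambda> (direct_sum V W) V fst"
    using direct_sum_biprod[OF mod_catD[OF V] mod_catD[OF W]] by (auto simp: biprod_def)
  have lF: "lin \<Lambda> (direct_sum V W) (direct_power n M) F" using F by (simp add: Hom_set_iff)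
  let ?G = "inv_into (carrier (direct_sum V W)) F"
  have lG: "lin \<Lambda> (direct_power n M) (direct_sum V W) ?G" by (rule lin_inv_into[OF ld lF F(2)])
  from direct_power_retract[OF M, of n]
  obtain N f g where N: "add_closure M N" "lin \<Lambda> N (direct_power n M) f" "lin \<Lambda> (direct_power n M) N g"
    "\<And>u. u \<in> carrier (direct_power n M) \<Longrightarrow> f (g u) = u" by blast
  have "retract V N" unfolding retract_def
  proof (intro conjI exI ballI)
    show "lin \<Lambda> V N (\<lambda>x. g (F (x, \<zero>\<^bsub>W\<^esub>)))" by (rule lin_comp[OF lin_comp[OF b(1) lF] N(3)])
    show "lin \<Lambda> N V (\<lambda>y. fst (?G (f y)))" by (rule lin_comp[OF lin_comp[OF N(2) lG] b(2)])
    fix x assume x: "x \<in> carrier V"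
    note c = lin_closed[OF b(1) x]
    have "f (g (F (x, \<zero>\<^bsub>W\<^esub>))) = F (x, \<zero>\<^bsub>W\<^esub>)" by (rule N(4)[OF lin_closed[OF lF c]])
    moreover have "?G (F (x, \<zero>\<^bsub>W\<^esub>)) = (x, \<zero>\<^bsub>W\<^esub>)"
      using c F(2) by (intro inv_into_f_f) (auto simp: bij_betw_def)
    ultimately show "fst (?G (f (g (F (x, \<zero>\<^bsub>W\<^esub>))))) = x" by simp
  qed (use V add_closure_mods[OF N(1) M] in auto)
  then show ?thesis by (rule add_closure.retract[OF N(1)])
qed

text \<open>Witnessed by the first power and a zero complement. Through it maximal orthogonality
  yields the rigidity of \<open>M\<close>.\<close>

lemma add_cat_self:
  assumes M: "M \<in> mods" shows "M \<in> add_cat \<Lambda> M"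
proof -
  interpret M: left_module \<Lambda> M using M by (rule mod_catD)
  let ?Z = "M\<lparr>carrier := {\<zero>\<^bsub>M\<^esub>}\<rparr>"
  let ?S = "direct_sum M ?Z" and ?D = "direct_power (Suc 0) M"
  interpret S: left_module \<Lambda> ?S by (rule direct_sum_left_module[OF M.left_module_axioms mod_catD[OF zero_module[OF M]]])
  let ?F = "\<lambda>u. \<lambda>i\<in>{..<Suc 0}. fst u"
  have "lin \<Lambda> ?S ?D ?F" by (auto simp: lin_def fun_eq_iff)
  then have "restrict ?F (carrier ?S) \<in> Hom_set \<Lambda> ?S ?D"
    by (rule restrict_Hom_set[OF _ S.left_module_axioms])
  moreover have "bij_betw (restrict ?F (carrier ?S)) (carrier ?S) (carrier ?D)"
  proof (rule bij_betwI[where g = "\<lambda>v. (v 0, \<zero>\<^bsub>M\<^esub>)"])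
    show "restrict ?F (carrier ?S) \<in> carrier ?S \<rightarrow> carrier ?D"
    proof (rule funcsetI)
      fix u assume u: "u \<in> carrier ?S"
      then have "?F u \<in> {..<Suc 0} \<rightarrow>\<^sub>E carrier M" by (simp only: restrict_PiE_iff) auto
      then show "restrict ?F (carrier ?S) u \<in> carrier ?D" using u by simp
    qed
    show "(\<lambda>v. (v 0, \<zero>\<^bsub>M\<^esub>)) \<in> carrier ?D \<rightarrow> carrier ?S" by auto
    show "(restrict ?F (carrier ?S) u 0, \<zero>\<^bsub>M\<^esub>) = u" if "u \<in> carrier ?S" for u using that by auto
    fix v assume v: "v \<in> carrier ?D"
    then have "v 0 \<in> carrier M" by auto
    then show "restrict ?F (carrier ?S) (v 0, \<zero>\<^bsub>M\<^esub>) = v"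
      using v by (auto simp: fun_eq_iff PiE_def extensional_def)
  qed
  ultimately have "mod_iso \<Lambda> ?S ?D" unfolding mod_iso_def by blast
  then show ?thesis using M zero_module[OF M] by (auto simp: add_cat_def)
qed

subsection \<open>Approximations\<close>

text \<open>Take one copy of \<open>M\<close> for each of finitely many generators of Hom(M,V) over
  \<open>K\<close> and map their sum to \<open>V\<close>. The maps M \<rightarrow> V that factor
  through it are closed under sums and under the action of \<open>K\<close>, so they are
  all.\<close>

lemma right_approximation:
  assumes M: "M \<in> mods" and V: "V \<in> mods"
  obtains Q p where "add_closure M Q" "lin \<Lambda> Q V p"
    "\<And>h. lin \<Lambda> M V h \<Longrightarrow> \<exists>k. lin \<Lambda> M Q k \<and> (\<forall>x\<in>carrier M. p (k x) = h x)"
proof -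
  interpret M: left_module \<Lambda> M using M by (rule mod_catD)
  interpret V: left_module \<Lambda> V using V by (rule mod_catD)
  obtain H where H: "finite H" "H \<subseteq> Hom_set \<Lambda> M V" "Hom_set \<Lambda> M V = gspan K (hom_module \<phi> \<Lambda> M V) H"
    by (rule Hom_set_fg[OF M V]) blast
  have approx: "\<exists>Q p. add_closure M Q \<and> lin \<Lambda> Q V p \<and> (\<forall>h\<in>H. \<exists>k. lin \<Lambda> M Q k \<and> (\<forall>x\<in>carrier M. p (k x) = h x))"
    if "finite H" "H \<subseteq> Hom_set \<Lambda> M V" for H
    using that
  proof (induct H)
    case empty
    \<comment> \<open>The empty sum is replaced by \<open>M\<close> with the zero map, since
      \<open>M\<close> is in \<open>add_closure M\<close> at once.\<close>
    show ?case using add_closure.base lin_const_zero[OF V.left_module_axioms, of M] by blast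
  next
    case (insert h H)
    then obtain Q p where Q: "add_closure M Q" "lin \<Lambda> Q V p"
      "\<And>h. h \<in> H \<Longrightarrow> \<exists>k. lin \<Lambda> M Q k \<and> (\<forall>x\<in>carrier M. p (k x) = h x)" by auto
    have Qm: "Q \<in> mods" using add_closure_mods[OF Q(1) M] .
    interpret Q: left_module \<Lambda> Q using Qm by (rule mod_catD)
    have h: "lin \<Lambda> M V h" using insert by (simp add: Hom_set_iff)
    obtain W i j a b where W: "W \<in> mods" "biprod \<Lambda> Q M W i j a b" using biprod_exists[OF Qm M] by metis
    have i: "lin \<Lambda> Q W i" and j: "lin \<Lambda> M W j" and a: "lin \<Lambda> W Q a" and b: "lin \<Lambda> W M b"
      and ij: "\<And>x. x \<in> carrier Q \<Longrightarrow> a (i x) = x" "\<And>x. x \<in> carrier Q \<Longrightarrow> b (i x) = \<zero>\<^bsub>M\<^esub>"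
        "\<And>x. x \<in> carrier M \<Longrightarrow> b (j x) = x" "\<And>x. x \<in> carrier M \<Longrightarrow> a (j x) = \<zero>\<^bsub>Q\<^esub>"
      using W(2) by (auto simp: biprod_def)
    let ?p = "\<lambda>w. p (a w) \<oplus>\<^bsub>V\<^esub> h (b w)"
    have lp: "lin \<Lambda> W V ?p"
      by (intro lin_sum V.left_module_axioms lin_comp[OF a Q(2)] lin_comp[OF b h])
    have z: "p \<zero>\<^bsub>Q\<^esub> = \<zero>\<^bsub>V\<^esub>" "h \<zero>\<^bsub>M\<^esub> = \<zero>\<^bsub>V\<^esub>"
      using lin_zero[OF Q.left_module_axioms V.left_module_axioms Q(2)]
        lin_zero[OF M.left_module_axioms V.left_module_axioms h] by auto
    have new: "?p (j x) = h x" if "x \<in> carrier M" for x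
      using that ij z lin_closed[OF h that] by simp
    have "\<exists>k. lin \<Lambda> M W k \<and> (\<forall>x\<in>carrier M. ?p (k x) = h' x)" if h': "h' \<in> insert h H" for h'
    proof (cases "h' = h")
      case True
      show ?thesis unfolding True using j new by (intro exI[of _ j]) simp
    next
      case False
      then obtain k where k: "lin \<Lambda> M Q k" "\<And>x. x \<in> carrier M \<Longrightarrow> p (k x) = h' x" using Q(3)[of h'] h' by blast
      have "?p (i (k x)) = h' x" if "x \<in> carrier M" for x
        using ij(1,2)[OF lin_closed[OF k(1) that]] z k(2)[OF that] lin_closed[OF Q(2) lin_closed[OF k(1) that]] by simp
      then show ?thesis using lin_comp[OF k(1) i] by (intro exI[of _ "\<lambda>x. i (k x)"]) simp
    qed
    then show ?case using add_closure.biprod[OF Q(1) add_closure.base W] lp by blast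
  qed
  obtain Q p where Q: "add_closure M Q" "lin \<Lambda> Q V p"
    "\<And>h. h \<in> H \<Longrightarrow> \<exists>k. lin \<Lambda> M Q k \<and> (\<forall>x\<in>carrier M. p (k x) = h x)"
    using approx[OF H(1,2)] by blast
  interpret Q: left_module \<Lambda> Q using add_closure_mods[OF Q(1) M] by (rule mod_catD)
  have fac: "\<exists>k. lin \<Lambda> M Q k \<and> (\<forall>x\<in>carrier M. p (k x) = h x)" if "h \<in> gspan K (hom_module \<phi> \<Lambda> M V) H" for h
    using that
  proof induct
    case zero
    then show ?case
      using lin_const_zero[OF Q.left_module_axioms, of M] lin_zero[OF Q.left_module_axioms V.left_module_axioms Q(2)]
      by (intro exI[of _ "\<lambda>x. \<zero>\<^bsub>Q\<^esub>"]) simp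
  next
    case (base h)
    then show ?case by (rule Q(3))
  next
    case (add g h)
    then obtain k l where kl: "lin \<Lambda> M Q k" "\<And>x. x \<in> carrier M \<Longrightarrow> p (k x) = g x"
      "lin \<Lambda> M Q l" "\<And>x. x \<in> carrier M \<Longrightarrow> p (l x) = h x" by blast
    show ?case
      using lin_sum[OF Q.left_module_axioms kl(1,3)] kl lin_closed[OF kl(1)] lin_closed[OF kl(3)]
      by (intro exI[of _ "\<lambda>x. k x \<oplus>\<^bsub>Q\<^esub> l x"]) (simp add: lin_add[OF Q(2)])
  next
    case (smult c h)
    then obtain k where k: "lin \<Lambda> M Q k" "\<And>x. x \<in> carrier M \<Longrightarrow> p (k x) = h x" by blast
    have "lin \<Lambda> M Q (\<lambda>x. \<phi> c \<odot>\<^bsub>Q\<^esub> k x)"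
      using smult(1) lin_closed[OF k(1)] \<phi>_closed lin_add[OF k(1)] lin_smult[OF k(1)]
      by (intro linI) (auto simp: Q.smult_r_distr \<phi>_smult_comm[OF Q.left_module_axioms])
    then show ?case
      using k lin_closed[OF k(1)] \<phi>_closed[OF smult(1)]
      by (intro exI[of _ "\<lambda>x. \<phi> c \<odot>\<^bsub>Q\<^esub> k x"]) (simp add: lin_smult[OF Q(2)])
  qed
  have "\<exists>k. lin \<Lambda> M Q k \<and> (\<forall>x\<in>carrier M. p (k x) = h x)" if h: "lin \<Lambda> M V h" for h
    using fac[of "restrict h (carrier M)"] restrict_Hom_set[OF h M.left_module_axioms] H(3) by simp
  then show thesis using that Q by blast
qed

text \<open>Dual to the right approximation: generators of Hom(V,M) over \<open>K\<close> become the
  coordinates of a map from \<open>V\<close> into a sum of copies of \<open>M\<close>.\<close>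

lemma left_approximation:
  assumes M: "M \<in> mods" and V: "V \<in> mods"
  obtains Q u where "add_closure M Q" "lin \<Lambda> V Q u"
    "\<And>h. lin \<Lambda> V M h \<Longrightarrow> \<exists>k. lin \<Lambda> Q M k \<and> (\<forall>x\<in>carrier V. k (u x) = h x)"
proof -
  interpret M: left_module \<Lambda> M using M by (rule mod_catD)
  interpret V: left_module \<Lambda> V using V by (rule mod_catD)
  obtain H where H: "finite H" "H \<subseteq> Hom_set \<Lambda> V M" "Hom_set \<Lambda> V M = gspan K (hom_module \<phi> \<Lambda> V M) H"
    by (rule Hom_set_fg[OF V M]) blast
  have approx: "\<exists>Q u. add_closure M Q \<and> lin \<Lambda> V Q u \<and> (\<forall>h\<in>H. \<exists>k. lin \<Lambda> Q M k \<and> (\<forall>x\<in>carrier V. k (u x) = h x))"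
    if "finite H" "H \<subseteq> Hom_set \<Lambda> V M" for H
    using that
  proof (induct H)
    case empty
    show ?case using add_closure.base lin_const_zero[OF M.left_module_axioms, of V] by blast
  next
    case (insert h H)
    then obtain Q u where Q: "add_closure M Q" "lin \<Lambda> V Q u"
      "\<And>h. h \<in> H \<Longrightarrow> \<exists>k. lin \<Lambda> Q M k \<and> (\<forall>x\<in>carrier V. k (u x) = h x)" by auto
    have Qm: "Q \<in> mods" using add_closure_mods[OF Q(1) M] .
    interpret Q: left_module \<Lambda> Q using Qm by (rule mod_catD)
    have h: "lin \<Lambda> V M h" using insert by (simp add: Hom_set_iff)
    obtain W i j a b where W: "W \<in> mods" "biprod \<Lambda> Q M W i j a b" using biprod_exists[OF Qm M] by metis
    interpret W: left_module \<Lambda> W using W(1) by (rule mod_catD)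
    have i: "lin \<Lambda> Q W i" and j: "lin \<Lambda> M W j" and a: "lin \<Lambda> W Q a" and b: "lin \<Lambda> W M b"
      and ij: "\<And>x. x \<in> carrier Q \<Longrightarrow> a (i x) = x" "\<And>x. x \<in> carrier Q \<Longrightarrow> b (i x) = \<zero>\<^bsub>M\<^esub>"
        "\<And>x. x \<in> carrier M \<Longrightarrow> b (j x) = x" "\<And>x. x \<in> carrier M \<Longrightarrow> a (j x) = \<zero>\<^bsub>Q\<^esub>"
      using W(2) by (auto simp: biprod_def)
    let ?u = "\<lambda>x. i (u x) \<oplus>\<^bsub>W\<^esub> j (h x)"
    have lu: "lin \<Lambda> V W ?u"
      by (intro lin_sum W.left_module_axioms lin_comp[OF Q(2) i] lin_comp[OF h j])
    have ab: "a (?u x) = u x" "b (?u x) = h x" if "x \<in> carrier V" for x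
      using lin_closed[OF Q(2) that] lin_closed[OF h that] lin_closed[OF i] lin_closed[OF j]
      by (simp_all add: lin_add[OF a] lin_add[OF b] ij)
    have "\<exists>k. lin \<Lambda> W M k \<and> (\<forall>x\<in>carrier V. k (?u x) = h' x)" if h': "h' \<in> insert h H" for h'
    proof (cases "h' = h")
      case True
      show ?thesis unfolding True using b ab by (intro exI[of _ b]) simp
    next
      case False
      then obtain k where k: "lin \<Lambda> Q M k" "\<And>x. x \<in> carrier V \<Longrightarrow> k (u x) = h' x" using Q(3)[of h'] h' by blast
      then show ?thesis using lin_comp[OF a k(1)] ab by (intro exI[of _ "\<lambda>x. k (a x)"]) simp
    qed
    then show ?case using add_closure.biprod[OF Q(1) add_closure.base W] lu by blast
  qed
  obtain Q u where Q: "add_closure M Q" "lin \<Lambda> V Q u"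
    "\<And>h. h \<in> H \<Longrightarrow> \<exists>k. lin \<Lambda> Q M k \<and> (\<forall>x\<in>carrier V. k (u x) = h x)"
    using approx[OF H(1,2)] by blast
  interpret Q: left_module \<Lambda> Q using add_closure_mods[OF Q(1) M] by (rule mod_catD)
  note uc = lin_closed[OF Q(2)]
  have fac: "\<exists>k. lin \<Lambda> Q M k \<and> (\<forall>x\<in>carrier V. k (u x) = h x)" if "h \<in> gspan K (hom_module \<phi> \<Lambda> V M) H" for h
    using that
  proof induct
    case zero
    then show ?case
      using lin_const_zero[OF M.left_module_axioms, of Q] by (intro exI[of _ "\<lambda>x. \<zero>\<^bsub>M\<^esub>"]) simp
  next
    case (base h)
    then show ?case by (rule Q(3))
  next
    case (add g h)
    then obtain k l where kl: "lin \<Lambda> Q M k" "\<And>x. x \<in> carrier V \<Longrightarrow> k (u x) = g x"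
      "lin \<Lambda> Q M l" "\<And>x. x \<in> carrier V \<Longrightarrow> l (u x) = h x" by blast
    show ?case
      using lin_sum[OF M.left_module_axioms kl(1,3)] kl by (intro exI[of _ "\<lambda>x. k x \<oplus>\<^bsub>M\<^esub> l x"]) simp
  next
    case (smult c h)
    then obtain k where k: "lin \<Lambda> Q M k" "\<And>x. x \<in> carrier V \<Longrightarrow> k (u x) = h x" by blast
    have "lin \<Lambda> Q M (\<lambda>x. \<phi> c \<odot>\<^bsub>M\<^esub> k x)"
      using smult(1) lin_closed[OF k(1)] \<phi>_closed lin_add[OF k(1)] lin_smult[OF k(1)]
      by (intro linI) (auto simp: M.smult_r_distr \<phi>_smult_comm[OF M.left_module_axioms])
    then show ?case
      using k by (intro exI[of _ "\<lambda>x. \<phi> c \<odot>\<^bsub>M\<^esub> k x"]) simp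
  qed
  have "\<exists>k. lin \<Lambda> Q M k \<and> (\<forall>x\<in>carrier V. k (u x) = h x)" if h: "lin \<Lambda> V M h" for h
    using fac[of "restrict h (carrier V)"] restrict_Hom_set[OF h V.left_module_axioms] H(3) by simp
  then show thesis using that Q by blast
qed

subsection \<open>Universal extensions\<close>

text \<open>Ext^1(Z,Y) is killed by pushing out N \<rightarrow> P, where \<open>N\<close> is a
  syzygy of \<open>Z\<close>, along each of finitely many generators of Hom(N,Y) over
  \<open>K\<close>. Every pushout has cokernel \<open>Z\<close>; since \<open>Z\<close> has no
  self-extensions, no new classes arise, and vanishing shared by \<open>Y\<close> and
  \<open>Z\<close> is inherited.\<close>

lemma universal_extension:
  assumes Z: "Z \<in> mods" and Y: "Y \<in> mods" and E: "Ext_van 0 Z Z"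
  obtains Y' u where "Y' \<in> mods" "lin \<Lambda> Y Y' u" "inj_on u (carrier Y)" "Ext_van 0 Z Y'"
    "\<And>n V. Ext_van n V Y \<Longrightarrow> Ext_van n V Z \<Longrightarrow> Ext_van n V Y'"
proof -
  obtain N n P p where P: "projective \<Lambda> P" "ses \<Lambda> N n P p Z" using enough_projectives[OF Z] by metis
  note N = sesD(1)[OF P(2)] and lN = sesD(9)[OF P(2)] and nc = ses_closed(1)[OF P(2)]
  obtain H where H: "finite H" "H \<subseteq> Hom_set \<Lambda> N Y" "Hom_set \<Lambda> N Y = gspan K (hom_module \<phi> \<Lambda> N Y) H"
    by (rule Hom_set_fg[OF N Y]) blast
  let ?ext = "\<lambda>Y' u h. \<exists>e. lin \<Lambda> P Y' e \<and> (\<forall>x\<in>carrier N. e (n x) = u (h x))"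
  \<comment> \<open>The clause on h' is the invariant that matters: up to maps that extend to
    \<open>P\<close>, every map from \<open>N\<close> to the new module comes from \<open>Y\<close>.
    So in the end it suffices to extend the generators in \<open>H\<close>.\<close>
  let ?good = "\<lambda>H Y' u. Y' \<in> mods \<and> lin \<Lambda> Y Y' u \<and> inj_on u (carrier Y) \<and> (\<forall>h\<in>H. ?ext Y' u h) \<and>
     (\<forall>h'. lin \<Lambda> N Y' h' \<longrightarrow> (\<exists>h e. lin \<Lambda> N Y h \<and> lin \<Lambda> P Y' e \<and> (\<forall>x\<in>carrier N. h' x = u (h x) \<oplus>\<^bsub>Y'\<^esub> e (n x)))) \<and>
     (\<forall>n V. Ext_van n V Y \<and> Ext_van n V Z \<longrightarrow> Ext_van n V Y')"
  interpret Y: left_module \<Lambda> Y using Y by (rule mod_catD)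
  have step: "\<exists>Y' u. ?good H Y' u" if "finite H" "H \<subseteq> Hom_set \<Lambda> N Y" for H
    using that
  proof (induct H)
    case empty
    have "\<exists>h e. lin \<Lambda> N Y h \<and> lin \<Lambda> P Y e \<and> (\<forall>x\<in>carrier N. h' x = h x \<oplus>\<^bsub>Y\<^esub> e (n x))" if "lin \<Lambda> N Y h'" for h'
      using that lin_closed[OF that] lin_const_zero[OF Y.left_module_axioms, of P]
      by (intro exI[of _ h'] exI[of _ "\<lambda>x. \<zero>\<^bsub>Y\<^esub>"]) simp
    then have "?good {} Y (\<lambda>x. x)" using Y lin_id by (auto simp: inj_on_def)
    then show ?case by blast
  next
    case (insert h H)
    then have "\<exists>Y' u. ?good H Y' u" by simp
    then obtain Y1 u1 where Y1: "Y1 \<in> mods" "lin \<Lambda> Y Y1 u1" "inj_on u1 (carrier Y)"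
      and ext1: "\<And>h. h \<in> H \<Longrightarrow> ?ext Y1 u1 h"
      and dec1: "\<And>h'. lin \<Lambda> N Y1 h' \<Longrightarrow> \<exists>h e. lin \<Lambda> N Y h \<and> lin \<Lambda> P Y1 e \<and> (\<forall>x\<in>carrier N. h' x = u1 (h x) \<oplus>\<^bsub>Y1\<^esub> e (n x))"
      and van1: "\<And>n V. Ext_van n V Y \<Longrightarrow> Ext_van n V Z \<Longrightarrow> Ext_van n V Y1"
      by metis
    have h: "lin \<Lambda> N Y h" using insert by (simp add: Hom_set_iff)
    obtain Y2 u e q where Y2: "ses \<Lambda> Y1 u Y2 q Z" "lin \<Lambda> P Y2 e"
      "\<And>x. x \<in> carrier N \<Longrightarrow> e (n x) = u (u1 (h x))" "\<And>x. x \<in> carrier P \<Longrightarrow> q (e x) = p x"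
      by (rule pushout_ses[OF P(2) Y1(1) lin_comp[OF h Y1(2)]]) blast
    interpret Y2: left_module \<Lambda> Y2 by (rule sesD[OF Y2(1)])
    interpret Y1: left_module \<Lambda> Y1 by (rule sesD[OF Y2(1)])
    interpret Z: left_module \<Lambda> Z by (rule sesD[OF Y2(1)])
    note u = sesD(4)[OF Y2(1)]
    let ?u = "\<lambda>y. u (u1 y)"
    have lu: "lin \<Lambda> Y Y2 ?u" by (rule lin_comp[OF Y1(2) u])
    have inj: "inj_on ?u (carrier Y)"
    proof (rule inj_onI)
      fix x y assume "x \<in> carrier Y" "y \<in> carrier Y" "u (u1 x) = u (u1 y)"
      then show "x = y" using ses_inj[OF Y2(1)] lin_closed[OF Y1(2)] Y1(3) by (metis inj_onD)
    qed
    have ext: "?ext Y2 ?u h'" if h': "h' \<in> insert h H" for h'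
    proof (cases "h' = h")
      case True
      show ?thesis unfolding True using Y2(2,3) by blast
    next
      case False
      then obtain e' where e': "lin \<Lambda> P Y1 e'" "\<forall>x\<in>carrier N. e' (n x) = u1 (h' x)" using ext1[of h'] h' by blast
      then show ?thesis using lin_comp[OF e'(1) u] by (intro exI[of _ "\<lambda>x. u (e' x)"]) simp
    qed
    have dec: "\<exists>h0 e. lin \<Lambda> N Y h0 \<and> lin \<Lambda> P Y2 e \<and> (\<forall>x\<in>carrier N. h' x = ?u (h0 x) \<oplus>\<^bsub>Y2\<^esub> e (n x))"
      if h': "lin \<Lambda> N Y2 h'" for h'
    proof -
      \<comment> \<open>The composite of h' with \<open>q\<close> extends to \<open>P\<close> by
        \<open>E\<close>, and the extension lifts to \<open>Y2\<close>; what remains is a map into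
        \<open>Y1\<close>, to which the invariant applies.\<close>
      obtain t where t: "lin \<Lambda> P Z t" "\<And>x. x \<in> carrier N \<Longrightarrow> t (n x) = q (h' x)"
        using Ext_van_0E[OF E P lin_comp[OF h' sesD(5)[OF Y2(1)]]] by blast
      obtain t' where t': "lin \<Lambda> P Y2 t'" "\<And>x. x \<in> carrier P \<Longrightarrow> q (t' x) = t x"
        using projective_lift[OF P(1) Y2(1) t(1)] by blast
      have d: "lin \<Lambda> N Y2 (\<lambda>x. h' x \<ominus>\<^bsub>Y2\<^esub> t' (n x))"
        by (intro lin_diff Y2.left_module_axioms h' lin_comp[OF sesD(4)[OF P(2)] t'(1)])
      have d0: "q (h' x \<ominus>\<^bsub>Y2\<^esub> t' (n x)) = \<zero>\<^bsub>Z\<^esub>" if x: "x \<in> carrier N" for x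
        using lin_closed[OF h' x] lin_closed[OF t'(1) nc[OF x]] t(2)[OF x] t'(2)[OF nc[OF x]] ses_closed(2)[OF Y2(1)]
        by (simp add: lin_minus[OF sesD(10,11,5)[OF Y2(1)]] Z.diff_eq_zero_iff)
      obtain m where m: "lin \<Lambda> N Y1 m" "\<And>x. x \<in> carrier N \<Longrightarrow> u (m x) = h' x \<ominus>\<^bsub>Y2\<^esub> t' (n x)"
        using lin_corestrict[OF Y2(1) d d0] by blast
      obtain h0 e0 where h0: "lin \<Lambda> N Y h0" "lin \<Lambda> P Y1 e0" "\<And>x. x \<in> carrier N \<Longrightarrow> m x = u1 (h0 x) \<oplus>\<^bsub>Y1\<^esub> e0 (n x)"
        using dec1[OF m(1)] by blast
      have le: "lin \<Lambda> P Y2 (\<lambda>x. u (e0 x) \<oplus>\<^bsub>Y2\<^esub> t' x)"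
        by (intro lin_sum Y2.left_module_axioms lin_comp[OF h0(2) u] t'(1))
      have "h' x = ?u (h0 x) \<oplus>\<^bsub>Y2\<^esub> (u (e0 (n x)) \<oplus>\<^bsub>Y2\<^esub> t' (n x))" if x: "x \<in> carrier N" for x
      proof -
        note c = lin_closed[OF Y1(2) lin_closed[OF h0(1) x]] lin_closed[OF h0(2) nc[OF x]] lin_closed[OF t'(1) nc[OF x]]
        have "h' x = u (m x) \<oplus>\<^bsub>Y2\<^esub> t' (n x)"
          using m(2)[OF x] lin_closed[OF h' x] c by (simp add: Y2.diff_add_cancel)
        then show ?thesis
          using h0(3)[OF x] c lin_closed[OF u] by (simp add: lin_add[OF u] Y2.M.a_assoc)
      qed
      then show ?thesis using h0(1) le by blast
    qed
    have van: "Ext_van n V Y2" if "Ext_van n V Y" "Ext_van n V Z" for n V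
      by (rule Ext_van_middle_right[OF Y2(1) van1[OF that] that(2)])
    show ?case
      using sesD(2)[OF Y2(1)] lu inj ext dec van by (intro exI[of _ Y2] exI[of _ ?u]) blast
  qed
  obtain Y' u where Y': "Y' \<in> mods" "lin \<Lambda> Y Y' u" "inj_on u (carrier Y)"
    and ext: "\<And>h. h \<in> H \<Longrightarrow> ?ext Y' u h"
    and dec: "\<And>h'. lin \<Lambda> N Y' h' \<Longrightarrow> \<exists>h e. lin \<Lambda> N Y h \<and> lin \<Lambda> P Y' e \<and> (\<forall>x\<in>carrier N. h' x = u (h x) \<oplus>\<^bsub>Y'\<^esub> e (n x))"
    and van: "\<And>n V. Ext_van n V Y \<Longrightarrow> Ext_van n V Z \<Longrightarrow> Ext_van n V Y'"
    using step[OF H(1,2)] by metis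
  interpret Y': left_module \<Lambda> Y' using Y'(1) by (rule mod_catD)
  have gen: "?ext Y' u h" if "h \<in> gspan K (hom_module \<phi> \<Lambda> N Y) H" for h
    using that
  proof induct
    case zero
    then show ?case
      using lin_const_zero[OF Y'.left_module_axioms, of P] lin_zero[OF Y.left_module_axioms Y'.left_module_axioms Y'(2)]
      by (intro exI[of _ "\<lambda>x. \<zero>\<^bsub>Y'\<^esub>"]) simp
  next
    case (base h)
    then show ?case by (rule ext)
  next
    case (add g h)
    then have gh: "lin \<Lambda> N Y g" "lin \<Lambda> N Y h" using H(3) by (auto simp: Hom_set_iff)
    from add obtain k l where kl: "lin \<Lambda> P Y' k" "\<And>x. x \<in> carrier N \<Longrightarrow> k (n x) = u (g x)"
      "lin \<Lambda> P Y' l" "\<And>x. x \<in> carrier N \<Longrightarrow> l (n x) = u (h x)" by blast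
    show ?case
      using lin_sum[OF Y'.left_module_axioms kl(1,3)] kl lin_closed[OF gh(1)] lin_closed[OF gh(2)]
      by (intro exI[of _ "\<lambda>x. k x \<oplus>\<^bsub>Y'\<^esub> l x"]) (simp add: lin_add[OF Y'(2)])
  next
    case (smult c h)
    then have h: "lin \<Lambda> N Y h" using H(3) by (auto simp: Hom_set_iff)
    from smult obtain k where k: "lin \<Lambda> P Y' k" "\<And>x. x \<in> carrier N \<Longrightarrow> k (n x) = u (h x)" by blast
    have "lin \<Lambda> P Y' (\<lambda>x. \<phi> c \<odot>\<^bsub>Y'\<^esub> k x)"
      using smult(1) lin_closed[OF k(1)] \<phi>_closed lin_add[OF k(1)] lin_smult[OF k(1)]
      by (intro linI) (auto simp: Y'.smult_r_distr \<phi>_smult_comm[OF Y'.left_module_axioms])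
    then show ?case
      using k lin_closed[OF h] \<phi>_closed[OF smult(1)]
      by (intro exI[of _ "\<lambda>x. \<phi> c \<odot>\<^bsub>Y'\<^esub> k x"]) (simp add: lin_smult[OF Y'(2)])
  qed
  have "Ext_van 0 Z Y'"
  proof (rule Ext_van_right_left_0[OF P(2) Y'(1) Ext_van_projective[OF P(1)]])
    fix h' assume h': "lin \<Lambda> N Y' h'"
    obtain h e where he: "lin \<Lambda> N Y h" "lin \<Lambda> P Y' e" "\<And>x. x \<in> carrier N \<Longrightarrow> h' x = u (h x) \<oplus>\<^bsub>Y'\<^esub> e (n x)"
      using dec[OF h'] by blast
    obtain d where d: "lin \<Lambda> P Y' d" "\<And>x. x \<in> carrier N \<Longrightarrow> d (n x) = u (h x)"
      using gen[of "restrict h (carrier N)"] restrict_Hom_set[OF he(1) lN] H(3) by auto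
    show "\<exists>e. lin \<Lambda> P Y' e \<and> (\<forall>x\<in>carrier N. e (n x) = h' x)"
      using lin_sum[OF Y'.left_module_axioms d(1) he(2)] d(2) he(3) by (intro exI[of _ "\<lambda>x. d x \<oplus>\<^bsub>Y'\<^esub> e x"]) simp
  qed
  then show thesis using that Y' van by blast
qed

end

section \<open>Relative resolutions\<close>

text \<open>Index 0 is \<open>C\<close>, so that the i-th short exact sequence runs from syzygy i +
  1 through P i to syzygy i for all i. Later syzygies are literal subsets of the terms, with
  inclusion \<lambda>x. x.\<close>

primrec syzygy ::
  "('r, 'm) module \<Rightarrow> (nat \<Rightarrow> ('r, 'm) module) \<Rightarrow> (nat \<Rightarrow> 'm \<Rightarrow> 'm) \<Rightarrow> nat \<Rightarrow> ('r, 'm) module" where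
  "syzygy C P d 0 = C"
| "syzygy C P d (Suc i) = (P i)\<lparr>carrier := a_kernel (P i) (res_target C P i) (d i)\<rparr>"

lemma syzygy_zero: "\<zero>\<^bsub>syzygy C P d i\<^esub> = \<zero>\<^bsub>res_target C P i\<^esub>"
  by (cases i) (auto simp: res_target_def)

lemma carrier_syzygy_Suc:
  "carrier (syzygy C P d (Suc i)) = {x \<in> carrier (P i). d i x = \<zero>\<^bsub>syzygy C P d i\<^esub>}"
  by (simp only: syzygy_zero) (simp add: a_kernel_def')

lemma all_ses_imp_ses: "all_ses \<Lambda> A f B g C \<Longrightarrow> ses \<Lambda> A f B g C"
  by (auto simp: all_ses_def ses_def Hom_set_iff a_kernel_def')

lemma ses_imp_all_ses:
  "ses \<Lambda> A f B g C \<Longrightarrow> f \<in> extensional (carrier A) \<Longrightarrow> g \<in> extensional (carrier B) \<Longrightarrow> all_ses \<Lambda> A f B g C"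
  by (auto simp: all_ses_def ses_def Hom_set_iff a_kernel_def')

lemma ses_cong:
  assumes s: "ses \<Lambda> A f B g C" and f: "\<And>x. x \<in> carrier A \<Longrightarrow> f' x = f x" and g: "\<And>x. x \<in> carrier B \<Longrightarrow> g' x = g x"
  shows "ses \<Lambda> A f' B g' C"
proof -
  note d = sesD[OF s]
  have "lin \<Lambda> A B f'" "lin \<Lambda> B C g'" using lin_cong[OF d(4,9) f] lin_cong[OF d(5,10) g] by auto
  moreover have "inj_on f' (carrier A)" using d(6) f by (simp cong: inj_on_cong)
  moreover have "f' ` carrier A = {y \<in> carrier B. g' y = \<zero>\<^bsub>C\<^esub>}" using d(7) f g by auto
  moreover have "g' ` carrier B = carrier C" using d(8) g by (simp cong: image_cong)
  ultimately show ?thesis using d(1-3) by (simp add: ses_def)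
qed

definition is_ses_class :: "('r, 'a) ring_scheme \<Rightarrow> ('r, 'm) ses_class \<Rightarrow> bool" where
  "is_ses_class \<Lambda> F \<longleftrightarrow> (\<forall>A f B g C. F A f B g C \<longrightarrow> all_ses \<Lambda> A f B g C)"

lemma is_ses_class_simps:
  "is_ses_class \<Lambda> (all_ses \<Lambda>)" "is_ses_class \<Lambda> (F_lower \<Lambda> M)" "is_ses_class \<Lambda> (F_upper \<Lambda> M)"
  by (auto simp: is_ses_class_def F_lower_def F_upper_def)

text \<open>The definition of a resolution has the image of d i as last term of the i-th sequence;
  exactness identifies it with the i-th syzygy.\<close>

lemma resolution_ses_class:
  assumes res: "F_projective_resolution \<Lambda> F C P d"
  shows "F (syzygy C P d (Suc i)) (\<lambda>x\<in>carrier (syzygy C P d (Suc i)). x) (P i) (d i) (syzygy C P d i)"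
proof -
  have "(res_target C P i)\<lparr>carrier := d i ` carrier (P i)\<rparr> = syzygy C P d i"
    using res by (cases i) (auto simp: F_projective_resolution_def res_target_def)
  moreover have "F ((P i)\<lparr>carrier := a_kernel (P i) (res_target C P i) (d i)\<rparr>)
      (\<lambda>x\<in>a_kernel (P i) (res_target C P i) (d i). x) (P i)
      (d i) ((res_target C P i)\<lparr>carrier := d i ` carrier (P i)\<rparr>)"
    using res by (auto simp: F_projective_resolution_def Let_def)
  ultimately show ?thesis by simp
qed

lemma resolution_ses:
  assumes res: "F_projective_resolution \<Lambda> F C P d" and F: "is_ses_class \<Lambda> F"
  shows "ses \<Lambda> (syzygy C P d (Suc i)) (\<lambda>x. x) (P i) (d i) (syzygy C P d i)"
proof -
  have "ses \<Lambda> (syzygy C P d (Suc i)) (\<lambda>x\<in>carrier (syzygy C P d (Suc i)). x) (P i) (d i) (syzygy C P d i)"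
    using resolution_ses_class[OF res] F by (intro all_ses_imp_ses) (auto simp: is_ses_class_def)
  then show ?thesis by (rule ses_cong) auto
qed

lemma F_projective_lift:
  assumes P: "F_projective \<Lambda> F P" and F: "F A f B g C" and h: "lin \<Lambda> P C h"
  obtains k where "lin \<Lambda> P B k" "\<And>x. x \<in> carrier P \<Longrightarrow> g (k x) = h x"
proof -
  have lP: "left_module \<Lambda> P" using P by (simp add: F_projective_def mod_catD)
  have "short_exact_sequence (Hom \<Lambda> P C) (Hom \<Lambda> P B) (Hom \<Lambda> P A) (compose (carrier P) g) (compose (carrier P) f)"
    using P F by (auto simp: F_projective_def)
  then have "compose (carrier P) g \<in> epi (Hom \<Lambda> P B) (Hom \<Lambda> P C)"
    using short_exact_sequenceD by blast
  then have "compose (carrier P) g ` Hom_set \<Lambda> P B = Hom_set \<Lambda> P C"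
    by (auto simp: epi_def Hom_def)
  moreover have "restrict h (carrier P) \<in> Hom_set \<Lambda> P C" by (rule restrict_Hom_set[OF h lP])
  ultimately obtain k where k: "k \<in> Hom_set \<Lambda> P B" "restrict h (carrier P) = compose (carrier P) g k" by blast
  have "g (k x) = h x" if "x \<in> carrier P" for x
    using fun_cong[OF k(2), of x] that by (simp add: compose_def)
  moreover have "lin \<Lambda> P B k" using k(1) by (simp add: Hom_set_iff)
  ultimately show thesis using that by blast
qed

context artin_modules begin

section \<open>Hom groups and the cohomology of Hom complexes\<close>

lemma Hom_simps [simp]:
  "carrier (Hom \<Lambda> V W) = Hom_set \<Lambda> V W" "\<one>\<^bsub>Hom \<Lambda> V W\<^esub> = (\<lambda>x\<in>carrier V. \<zero>\<^bsub>W\<^esub>)"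
  "f \<otimes>\<^bsub>Hom \<Lambda> V W\<^esub> g = (\<lambda>x\<in>carrier V. f x \<oplus>\<^bsub>W\<^esub> g x)"
  by (simp_all add: Hom_def)

lemma Hom_comm_group:
  assumes "left_module \<Lambda> V" "left_module \<Lambda> W" shows "comm_group (Hom \<Lambda> V W)"
proof -
  interpret left_module K "hom_module \<phi> \<Lambda> V W" by (rule hom_module_left_module[OF assms])
  show ?thesis
  proof (rule comm_groupI)
    show "f \<otimes>\<^bsub>Hom \<Lambda> V W\<^esub> g \<in> carrier (Hom \<Lambda> V W)"
      if "f \<in> carrier (Hom \<Lambda> V W)" "g \<in> carrier (Hom \<Lambda> V W)" for f g
      using M.a_closed[unfolded hom_module_simps] that unfolding Hom_simps by blast
    show "\<one>\<^bsub>Hom \<Lambda> V W\<^esub> \<in> carrier (Hom \<Lambda> V W)"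
      using M.zero_closed[unfolded hom_module_simps] unfolding Hom_simps .
    show "f \<otimes>\<^bsub>Hom \<Lambda> V W\<^esub> g \<otimes>\<^bsub>Hom \<Lambda> V W\<^esub> h = f \<otimes>\<^bsub>Hom \<Lambda> V W\<^esub> (g \<otimes>\<^bsub>Hom \<Lambda> V W\<^esub> h)"
      if "f \<in> carrier (Hom \<Lambda> V W)" "g \<in> carrier (Hom \<Lambda> V W)" "h \<in> carrier (Hom \<Lambda> V W)" for f g h
      using M.a_assoc[unfolded hom_module_simps, of f g h] that unfolding Hom_simps by blast
    show "f \<otimes>\<^bsub>Hom \<Lambda> V W\<^esub> g = g \<otimes>\<^bsub>Hom \<Lambda> V W\<^esub> f"
      if "f \<in> carrier (Hom \<Lambda> V W)" "g \<in> carrier (Hom \<Lambda> V W)" for f g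
      using M.a_comm[unfolded hom_module_simps, of f g] that unfolding Hom_simps by blast
    show "\<one>\<^bsub>Hom \<Lambda> V W\<^esub> \<otimes>\<^bsub>Hom \<Lambda> V W\<^esub> f = f" if "f \<in> carrier (Hom \<Lambda> V W)" for f
      using M.l_zero[unfolded hom_module_simps, of f] that unfolding Hom_simps by blast
    show "\<exists>g\<in>carrier (Hom \<Lambda> V W). g \<otimes>\<^bsub>Hom \<Lambda> V W\<^esub> f = \<one>\<^bsub>Hom \<Lambda> V W\<^esub>"
      if "f \<in> carrier (Hom \<Lambda> V W)" for f
      using M.l_neg[unfolded hom_module_simps, of f] M.a_inv_closed[unfolded hom_module_simps, of f] that
      unfolding Hom_simps by blast
  qed
qed

lemma compose_Hom_set:
  assumes "left_module \<Lambda> U" "lin \<Lambda> U V f" "lin \<Lambda> V W g"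
  shows "compose (carrier U) g f \<in> Hom_set \<Lambda> U W"
  using restrict_Hom_set[OF lin_comp[OF assms(2,3)] assms(1)] by (simp add: compose_def)

lemma precompose_group_hom:
  assumes U: "left_module \<Lambda> U" and V: "left_module \<Lambda> V" and W: "left_module \<Lambda> W" and f: "lin \<Lambda> U V f"
  shows "group_hom (Hom \<Lambda> V W) (Hom \<Lambda> U W) (\<lambda>h. compose (carrier U) h f)"
proof -
  interpret A: comm_group "Hom \<Lambda> V W" by (rule Hom_comm_group[OF V W])
  interpret B: comm_group "Hom \<Lambda> U W" by (rule Hom_comm_group[OF U W])
  show ?thesis
  proof (intro group_hom.intro group_hom_axioms.intro A.is_group B.is_group homI)
    fix h assume "h \<in> carrier (Hom \<Lambda> V W)"
    then have "lin \<Lambda> V W h" by (simp add: Hom_set_iff)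
    then show "compose (carrier U) h f \<in> carrier (Hom \<Lambda> U W)"
      using compose_Hom_set[OF U f] by simp
  next
    fix h k assume "h \<in> carrier (Hom \<Lambda> V W)" "k \<in> carrier (Hom \<Lambda> V W)"
    then show "compose (carrier U) (h \<otimes>\<^bsub>Hom \<Lambda> V W\<^esub> k) f =
        compose (carrier U) h f \<otimes>\<^bsub>Hom \<Lambda> U W\<^esub> compose (carrier U) k f"
      using lin_closed[OF f] by (auto simp: compose_def fun_eq_iff)
  qed
qed

lemma postcompose_group_hom:
  assumes U: "left_module \<Lambda> U" and V: "left_module \<Lambda> V" and W: "left_module \<Lambda> W" and g: "lin \<Lambda> V W g"
  shows "group_hom (Hom \<Lambda> U V) (Hom \<Lambda> U W) (compose (carrier U) g)"
proof -
  interpret A: comm_group "Hom \<Lambda> U V" by (rule Hom_comm_group[OF U V])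
  interpret B: comm_group "Hom \<Lambda> U W" by (rule Hom_comm_group[OF U W])
  show ?thesis
  proof (intro group_hom.intro group_hom_axioms.intro A.is_group B.is_group homI)
    fix h assume "h \<in> carrier (Hom \<Lambda> U V)"
    then have "lin \<Lambda> U V h" by (simp add: Hom_set_iff)
    then show "compose (carrier U) g h \<in> carrier (Hom \<Lambda> U W)"
      using compose_Hom_set[OF U _ g] by simp
  next
    fix h k assume "h \<in> carrier (Hom \<Lambda> U V)" "k \<in> carrier (Hom \<Lambda> U V)"
    then have "lin \<Lambda> U V h" "lin \<Lambda> U V k" by (simp_all add: Hom_set_iff)
    then show "compose (carrier U) g (h \<otimes>\<^bsub>Hom \<Lambda> U V\<^esub> k) =
        compose (carrier U) g h \<otimes>\<^bsub>Hom \<Lambda> U W\<^esub> compose (carrier U) g k"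
      using lin_closed[of \<Lambda> U V] lin_add[OF g] by (auto simp: compose_def fun_eq_iff)
  qed
qed

lemma trivial_factor_group:
  assumes G: "comm_group G" and Z: "subgroup Z G" and B: "subgroup B G" and BZ: "B \<subseteq> Z"
  shows "trivial_group (G\<lparr>carrier := Z\<rparr> Mod B) \<longleftrightarrow> Z \<subseteq> B"
proof -
  interpret G: comm_group G by (rule G)
  let ?G = "G\<lparr>carrier := Z\<rparr>"
  interpret Z: group ?G by (rule subgroup.subgroup_is_group[OF Z G.is_group])
  have "B \<lhd> G" by (rule G.subgroup_imp_normal[OF B])
  then interpret N: normal B ?G by (rule G.normal_restrict_supergroup[OF Z _ BZ])
  have car: "carrier (?G Mod B) = rcosets\<^bsub>?G\<^esub> B" "\<one>\<^bsub>?G Mod B\<^esub> = B" by (simp_all add: FactGroup_def)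
  have sub: "subgroup B ?G" by (rule N.subgroup_axioms)
  show ?thesis
  proof
    assume "trivial_group (?G Mod B)"
    then have "rcosets\<^bsub>?G\<^esub> B = {B}" by (simp add: trivial_group_def car)
    show "Z \<subseteq> B"
    proof
      fix z assume z: "z \<in> Z"
      then have "B #>\<^bsub>?G\<^esub> z \<in> rcosets\<^bsub>?G\<^esub> B" by (auto simp: RCOSETS_def)
      then have "B #>\<^bsub>?G\<^esub> z = B" using \<open>rcosets\<^bsub>?G\<^esub> B = {B}\<close> by blast
      then show "z \<in> B" using Z.rcos_self[OF _ sub, of z] z by simp
    qed
  next
    assume "Z \<subseteq> B"
    then have "B #>\<^bsub>?G\<^esub> z = B" if "z \<in> Z" for z
      using Z.coset_join2[OF _ sub, of z] that by auto
    moreover have "\<one>\<^bsub>G\<^esub> \<in> Z" using subgroup.one_closed[OF Z] .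
    ultimately have "rcosets\<^bsub>?G\<^esub> B = {B}" by (auto simp: RCOSETS_def)
    then show "trivial_group (?G Mod B)"
      using N.factorgroup_is_group by (simp add: trivial_group_def car)
  qed
qed

text \<open>Cocycles of degree j + 1 are the maps on P (j + 1) that vanish on syzygy j + 2, which
  amounts to maps on syzygy j + 1; the coboundaries among them are those that extend to P j. This
  removes cohomology groups from the rest of the proof, for absolute and relative Ext alike.\<close>

lemma trivial_Hom_cohomology_iff:
  assumes res: "F_projective_resolution \<Lambda> F C P d" and F: "is_ses_class \<Lambda> F" and A: "A \<in> mods"
  shows "trivial_group (Hom_cohomology \<Lambda> P d A (Suc j)) \<longleftrightarrow>
    (\<forall>h. lin \<Lambda> (syzygy C P d (Suc j)) A h \<longrightarrow>
       (\<exists>e. lin \<Lambda> (P j) A e \<and> (\<forall>x\<in>carrier (syzygy C P d (Suc j)). e x = h x)))"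
proof -
  note s = resolution_ses[OF res F]
  let ?N = "syzygy C P d (Suc j)"
  note s0 = s[of j] and s1 = s[of "Suc j"] and s2 = s[of "Suc (Suc j)"]
  have d1: "lin \<Lambda> (P (Suc j)) ?N (d (Suc j))" by (rule sesD(5)[OF s1])
  have d1P: "lin \<Lambda> (P (Suc j)) (P j) (d (Suc j))" using lin_comp[OF d1 sesD(4)[OF s0]] by simp
  have d2P: "lin \<Lambda> (P (Suc (Suc j))) (P (Suc j)) (d (Suc (Suc j)))"
    using lin_comp[OF sesD(5)[OF s2] sesD(4)[OF s1]] by simp
  have lA: "left_module \<Lambda> A" using A by (rule mod_catD)
  note lP = sesD(10)[OF s]
  let ?G = "Hom \<Lambda> (P (Suc j)) A"
  have Z: "Hom_cocycles \<Lambda> P d A (Suc j) = kernel ?G (Hom \<Lambda> (P (Suc (Suc j))) A)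
      (\<lambda>h. compose (carrier (P (Suc (Suc j)))) h (d (Suc (Suc j))))"
    by (simp add: Hom_cocycles_def Hom_differential_def[abs_def])
  have B: "Hom_coboundaries \<Lambda> P d A (Suc j) =
      (\<lambda>h. compose (carrier (P (Suc j))) h (d (Suc j))) ` carrier (Hom \<Lambda> (P j) A)"
    by (simp add: Hom_coboundaries_def Hom_differential_def[abs_def])
  interpret h2: group_hom ?G "Hom \<Lambda> (P (Suc (Suc j))) A" "\<lambda>h. compose (carrier (P (Suc (Suc j)))) h (d (Suc (Suc j)))"
    by (rule precompose_group_hom[OF lP lP lA d2P])
  interpret h1: group_hom "Hom \<Lambda> (P j) A" ?G "\<lambda>h. compose (carrier (P (Suc j))) h (d (Suc j))"
    by (rule precompose_group_hom[OF lP lP lA d1P])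
  have Zi: "h \<in> Hom_cocycles \<Lambda> P d A (Suc j) \<longleftrightarrow>
      h \<in> Hom_set \<Lambda> (P (Suc j)) A \<and> (\<forall>x\<in>carrier (syzygy C P d (Suc (Suc j))). h x = \<zero>\<^bsub>A\<^esub>)" for h
  proof -
    have "(\<lambda>x\<in>carrier (P (Suc (Suc j))). h (d (Suc (Suc j)) x)) = (\<lambda>x\<in>carrier (P (Suc (Suc j))). \<zero>\<^bsub>A\<^esub>) \<longleftrightarrow>
        (\<forall>x\<in>d (Suc (Suc j)) ` carrier (P (Suc (Suc j))). h x = \<zero>\<^bsub>A\<^esub>)"
      by (auto simp: fun_eq_iff)
    then show ?thesis unfolding sesD(8)[OF s2] by (simp add: Z kernel_def compose_def)
  qed
  have d1c: "d (Suc j) x \<in> carrier ?N" if "x \<in> carrier (P (Suc j))" for x using lin_closed[OF d1 that] .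
  have BZ: "Hom_coboundaries \<Lambda> P d A (Suc j) \<subseteq> Hom_cocycles \<Lambda> P d A (Suc j)"
  proof
    fix b assume "b \<in> Hom_coboundaries \<Lambda> P d A (Suc j)"
    then obtain h where h: "lin \<Lambda> (P j) A h" "b = compose (carrier (P (Suc j))) h (d (Suc j))"
      by (auto simp: B Hom_set_iff)
    have "b x = \<zero>\<^bsub>A\<^esub>" if "x \<in> carrier (syzygy C P d (Suc (Suc j)))" for x
    proof -
      have "x \<in> carrier (P (Suc j))" using ses_closed(1)[OF s1 that] .
      moreover have "d (Suc j) x = \<zero>\<^bsub>P j\<^esub>" using ses_comp_zero[OF s1 that] by simp
      ultimately show ?thesis using lin_zero[OF lP lA h(1)] by (simp add: h(2) compose_def)
    qed
    then show "b \<in> Hom_cocycles \<Lambda> P d A (Suc j)"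
      unfolding Zi using compose_Hom_set[OF lP d1P h(1)] h(2) by simp
  qed
  have "trivial_group (Hom_cohomology \<Lambda> P d A (Suc j)) \<longleftrightarrow>
      Hom_cocycles \<Lambda> P d A (Suc j) \<subseteq> Hom_coboundaries \<Lambda> P d A (Suc j)"
    unfolding Hom_cohomology_def
  proof (rule trivial_factor_group[OF Hom_comm_group[OF lP lA] _ _ BZ])
    show "subgroup (Hom_cocycles \<Lambda> P d A (Suc j)) ?G" unfolding Z by (rule h2.subgroup_kernel)
    show "subgroup (Hom_coboundaries \<Lambda> P d A (Suc j)) ?G" unfolding B by (rule h1.img_is_subgroup)
  qed
  also have "\<dots> \<longleftrightarrow> (\<forall>h. lin \<Lambda> ?N A h \<longrightarrow> (\<exists>e. lin \<Lambda> (P j) A e \<and> (\<forall>x\<in>carrier ?N. e x = h x)))"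
  proof (intro iffI allI impI subsetI)
    fix h assume sub: "Hom_cocycles \<Lambda> P d A (Suc j) \<subseteq> Hom_coboundaries \<Lambda> P d A (Suc j)" and h: "lin \<Lambda> ?N A h"
    let ?b = "compose (carrier (P (Suc j))) h (d (Suc j))"
    have "?b \<in> Hom_cocycles \<Lambda> P d A (Suc j)" unfolding Zi
    proof (intro conjI ballI)
      show "?b \<in> Hom_set \<Lambda> (P (Suc j)) A" by (rule compose_Hom_set[OF lP d1 h])
      fix x assume "x \<in> carrier (syzygy C P d (Suc (Suc j)))"
      then have "x \<in> carrier (P (Suc j))" "d (Suc j) x = \<zero>\<^bsub>?N\<^esub>"
        using ses_closed(1)[OF s1] ses_comp_zero[OF s1] by auto
      then show "?b x = \<zero>\<^bsub>A\<^esub>" using lin_zero[OF sesD(9)[OF s0] lA h] by (simp add: compose_def)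
    qed
    then have "?b \<in> (\<lambda>h. compose (carrier (P (Suc j))) h (d (Suc j))) ` Hom_set \<Lambda> (P j) A"
      using sub by (simp add: B subset_iff)
    then obtain e where "e \<in> Hom_set \<Lambda> (P j) A" and eb: "?b = compose (carrier (P (Suc j))) e (d (Suc j))"
      by (rule imageE) blast
    then have e: "lin \<Lambda> (P j) A e" by (simp add: Hom_set_iff)
    have "e x = h x" if x: "x \<in> carrier ?N" for x
    proof -
      obtain y where y: "y \<in> carrier (P (Suc j))" "d (Suc j) y = x" by (rule ses_surjE[OF s1 x])
      then show ?thesis using fun_cong[OF eb, of y] by (simp add: compose_def)
    qed
    then show "\<exists>e. lin \<Lambda> (P j) A e \<and> (\<forall>x\<in>carrier ?N. e x = h x)" using e by blast
  next
    fix b assume ext: "\<forall>h. lin \<Lambda> ?N A h \<longrightarrow> (\<exists>e. lin \<Lambda> (P j) A e \<and> (\<forall>x\<in>carrier ?N. e x = h x))"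
      and "b \<in> Hom_cocycles \<Lambda> P d A (Suc j)"
    then have b: "lin \<Lambda> (P (Suc j)) A b" "b \<in> extensional (carrier (P (Suc j)))"
      "\<And>x. x \<in> carrier (syzygy C P d (Suc (Suc j))) \<Longrightarrow> b x = \<zero>\<^bsub>A\<^esub>"
      unfolding Zi by (auto simp: Hom_set_iff)
    obtain h where h: "lin \<Lambda> ?N A h" "\<And>x. x \<in> carrier (P (Suc j)) \<Longrightarrow> h (d (Suc j) x) = b x"
      using lin_factor[OF s1 b(1) lA b(3)] by blast
    obtain e where e: "lin \<Lambda> (P j) A e" "\<And>x. x \<in> carrier ?N \<Longrightarrow> e x = h x" using ext h(1) by blast
    have "compose (carrier (P (Suc j))) (restrict e (carrier (P j))) (d (Suc j)) = b"
      using b(2) e(2) h(2) d1c lin_closed[OF d1P]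
      by (intro extensionalityI[of _ "carrier (P (Suc j))"]) (auto simp: compose_def)
    then show "b \<in> Hom_coboundaries \<Lambda> P d A (Suc j)"
      unfolding B using restrict_Hom_set[OF e(1) lP] by (auto intro!: image_eqI[of _ _ "restrict e (carrier (P j))"])
  qed
  finally show ?thesis .
qed

subsection \<open>Absolute resolutions\<close>

text \<open>Left exactness of Hom(P,-) always holds, so \<open>F_projective\<close> amounts to
  surjectivity, that is, to lifting along surjections, each of which has its kernel in
  \<open>mods\<close>.\<close>

lemma F_projective_all_ses: "F_projective \<Lambda> (all_ses \<Lambda>) P \<longleftrightarrow> projective \<Lambda> (P :: ('r, 'm) module)"
proof
  assume P: "F_projective \<Lambda> (all_ses \<Lambda>) P"
  show "projective \<Lambda> P" unfolding projective_def
  proof (intro conjI allI impI)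
    fix B C :: "('r, 'm) module" and g h
    assume *: "B \<in> mods \<and> C \<in> mods \<and> lin \<Lambda> B C g \<and> g ` carrier B = carrier C \<and> lin \<Lambda> P C h"
    then have "ses \<Lambda> (B\<lparr>carrier := {y \<in> carrier B. g y = \<zero>\<^bsub>C\<^esub>}\<rparr>) (\<lambda>x. x) B g C" by (intro kernel_ses) auto
    then obtain A f where s: "ses \<Lambda> A f B g C" by blast
    have "ses \<Lambda> A (restrict f (carrier A)) B (restrict g (carrier B)) C" by (rule ses_cong[OF s]) auto
    then have F: "all_ses \<Lambda> A (restrict f (carrier A)) B (restrict g (carrier B)) C" by (rule ses_imp_all_ses) auto
    obtain k where k: "lin \<Lambda> P B k" "\<And>x. x \<in> carrier P \<Longrightarrow> restrict g (carrier B) (k x) = h x"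
      using F_projective_lift[where F = "all_ses \<Lambda>", OF P F, of h] * by blast
    then show "\<exists>k. lin \<Lambda> P B k \<and> (\<forall>x\<in>carrier P. g (k x) = h x)"
      using lin_closed[OF k(1)] by (intro exI[of _ k]) simp
  qed (use P in \<open>simp add: F_projective_def\<close>)
next
  assume P: "projective \<Lambda> P"
  have Pm: "P \<in> mods" using P by (simp add: projective_def)
  have lP: "left_module \<Lambda> P" using Pm by (rule mod_catD)
  show "F_projective \<Lambda> (all_ses \<Lambda>) P" unfolding F_projective_def
  proof (intro conjI allI impI)
    fix A B C :: "('r, 'm) module" and f g assume "all_ses \<Lambda> A f B g C"
    then have s: "ses \<Lambda> A f B g C" by (rule all_ses_imp_ses)
    note d = sesD[OF s]
    interpret gg: group_hom "Hom \<Lambda> P B" "Hom \<Lambda> P C" "compose (carrier P) g"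
      by (rule postcompose_group_hom[OF lP d(10,11,5)])
    interpret ff: group_hom "Hom \<Lambda> P A" "Hom \<Lambda> P B" "compose (carrier P) f"
      by (rule postcompose_group_hom[OF lP d(9,10,4)])
    have surj: "compose (carrier P) g ` Hom_set \<Lambda> P B = Hom_set \<Lambda> P C"
    proof (intro subset_antisym subsetI)
      fix h assume h: "h \<in> Hom_set \<Lambda> P C"
      then obtain k where k: "lin \<Lambda> P B k" "\<And>x. x \<in> carrier P \<Longrightarrow> g (k x) = h x"
        using projective_lift[OF P s, of h] by (auto simp: Hom_set_iff)
      have "h = compose (carrier P) g (restrict k (carrier P))"
        using h k by (intro extensionalityI[of _ "carrier P"]) (auto simp: compose_def Hom_set_iff)
      then show "h \<in> compose (carrier P) g ` Hom_set \<Lambda> P B" using restrict_Hom_set[OF k(1) lP] by blast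
    qed (use gg.hom_closed in auto)
    have inj: "inj_on (compose (carrier P) f) (Hom_set \<Lambda> P A)"
    proof (rule inj_onI)
      fix h k assume hk: "h \<in> Hom_set \<Lambda> P A" "k \<in> Hom_set \<Lambda> P A" "compose (carrier P) f h = compose (carrier P) f k"
      have lh: "lin \<Lambda> P A h" and lk: "lin \<Lambda> P A k" using hk by (auto simp: Hom_set_iff)
      have "h x = k x" if x: "x \<in> carrier P" for x
        using fun_cong[OF hk(3), of x] x ses_inj[OF s _ lin_closed[OF lh x] lin_closed[OF lk x]]
        by (simp add: compose_def)
      then show "h = k" using hk by (intro extensionalityI[of _ "carrier P"]) (auto simp: Hom_set_iff)
    qed
    have ker: "kernel (Hom \<Lambda> P B) (Hom \<Lambda> P C) (compose (carrier P) g) = compose (carrier P) f ` Hom_set \<Lambda> P A"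
    proof (intro subset_antisym subsetI)
      fix h assume "h \<in> kernel (Hom \<Lambda> P B) (Hom \<Lambda> P C) (compose (carrier P) g)"
      then have h: "lin \<Lambda> P B h" "h \<in> extensional (carrier P)" "compose (carrier P) g h = (\<lambda>x\<in>carrier P. \<zero>\<^bsub>C\<^esub>)"
        by (auto simp: kernel_def Hom_set_iff)
      have h0: "g (h x) = \<zero>\<^bsub>C\<^esub>" if "x \<in> carrier P" for x using fun_cong[OF h(3), of x] that by (simp add: compose_def)
      obtain k where k: "lin \<Lambda> P A k" "\<And>x. x \<in> carrier P \<Longrightarrow> f (k x) = h x"
        using lin_corestrict[OF s h(1) h0] by blast
      have "h = compose (carrier P) f (restrict k (carrier P))"
        using h(2) k by (intro extensionalityI[of _ "carrier P"]) (auto simp: compose_def)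
      then show "h \<in> compose (carrier P) f ` Hom_set \<Lambda> P A" using restrict_Hom_set[OF k(1) lP] by blast
    next
      fix h assume "h \<in> compose (carrier P) f ` Hom_set \<Lambda> P A"
      then obtain k where k: "k \<in> Hom_set \<Lambda> P A" "h = compose (carrier P) f k" by blast
      have "compose (carrier P) g h = (\<lambda>x\<in>carrier P. \<zero>\<^bsub>C\<^esub>)"
        using k ses_comp_zero[OF s] by (auto simp: compose_def fun_eq_iff Hom_set_iff lin_def)
      then show "h \<in> kernel (Hom \<Lambda> P B) (Hom \<Lambda> P C) (compose (carrier P) g)"
        using ff.hom_closed[of k] k by (simp add: kernel_def)
    qed
    show "short_exact_sequence (Hom \<Lambda> P C) (Hom \<Lambda> P B) (Hom \<Lambda> P A) (compose (carrier P) g) (compose (carrier P) f)"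
      unfolding short_exact_sequence_iff
      using surj inj ker gg.group_hom_axioms ff.group_hom_axioms gg.homh ff.homh
      by (simp add: epi_def mon_def)
  qed (rule Pm)
qed

lemma resolutionI:
  assumes proj: "\<And>i. projective \<Lambda> (P i)"
    and ses: "\<And>i. ses \<Lambda> (syzygy C P d (Suc i)) (\<lambda>x. x) (P i) (d i) (syzygy C P d i)"
    and ext: "\<And>i. d i \<in> extensional (carrier (P i))"
  shows "F_projective_resolution \<Lambda> (all_ses \<Lambda>) (C :: ('r, 'm) module) P d"
proof -
  have im: "d i ` carrier (P i) = carrier (syzygy C P d i)" for i by (rule sesD(8)[OF ses])
  have tgt: "(res_target C P i)\<lparr>carrier := d i ` carrier (P i)\<rparr> = syzygy C P d i" for i
    unfolding im by (cases i) (auto simp: res_target_def)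
  have all: "all_ses \<Lambda> (syzygy C P d (Suc i)) (\<lambda>x\<in>carrier (syzygy C P d (Suc i)). x) (P i) (d i) (syzygy C P d i)" for i
    by (intro ses_imp_all_ses ses_cong[OF ses[of i]] ext) auto
  have Hom: "d i \<in> Hom_set \<Lambda> (P i) (res_target C P i)" for i
  proof (cases i)
    case 0
    then show ?thesis using sesD(5)[OF ses[of i]] ext[of i] by (simp add: Hom_set_iff res_target_def)
  next
    case (Suc j)
    have "lin \<Lambda> (P i) (P j) (d i)"
      using lin_comp[OF sesD(5)[OF ses[of i, unfolded Suc]] sesD(4)[OF ses[of j]]] Suc by simp
    then show ?thesis using ext[of i] Suc by (simp add: Hom_set_iff res_target_def)
  qed
  show ?thesis unfolding F_projective_resolution_def F_projective_all_ses
  proof (intro conjI allI)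
    show "d 0 ` carrier (P 0) = carrier C" using im[of 0] by simp
    show "d (Suc i) ` carrier (P (Suc i)) = a_kernel (P i) (res_target C P i) (d i)" for i using im[of "Suc i"] by simp
    show "let K = a_kernel (P i) (res_target C P i) (d i) in
        all_ses \<Lambda> ((P i)\<lparr>carrier := K\<rparr>) (\<lambda>x\<in>K. x) (P i) (d i) ((res_target C P i)\<lparr>carrier := d i ` carrier (P i)\<rparr>)" for i
      using all[of i] by (simp add: tgt)
  qed (rule proj Hom)+
qed

lemma resolution_exists:
  assumes C: "(C :: ('r, 'm) module) \<in> mods"
  obtains P d where "F_projective_resolution \<Lambda> (all_ses \<Lambda>) C P d"
proof -
  have "\<exists>(P :: ('r, 'm) module) p. projective \<Lambda> P \<and> lin \<Lambda> P V p \<and> p ` carrier P = carrier V" if V: "V \<in> mods" for V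
  proof -
    obtain A f P p where P: "projective \<Lambda> P" "ses \<Lambda> A f P p V" by (rule enough_projectives[OF V])
    then show ?thesis using sesD[OF P(2)] by blast
  qed
  then obtain cov :: "('r, 'm) module \<Rightarrow> ('r, 'm) module" and cm where cov: "\<And>V. V \<in> mods \<Longrightarrow> projective \<Lambda> (cov V) \<and> lin \<Lambda> (cov V) V (cm V) \<and> cm V ` carrier (cov V) = carrier V"
    by metis
  define nxt where "nxt V = (cov V)\<lparr>carrier := {x \<in> carrier (cov V). cm V x = \<zero>\<^bsub>V\<^esub>}\<rparr>" for V
  have nxt: "ses \<Lambda> (nxt V) (\<lambda>x. x) (cov V) (cm V) V" if "V \<in> mods" for V
    unfolding nxt_def using cov[OF that] that by (intro kernel_ses) (auto simp: projective_def)
  define S where "S n = (nxt ^^ n) C" for n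
  have S: "S n \<in> mods" for n
    by (induct n) (use C sesD(1)[OF nxt] in \<open>auto simp: S_def\<close>)
  define P where "P n = cov (S n)" for n
  define d where "d n = restrict (cm (S n)) (carrier (P n))" for n
  have syz: "syzygy C P d n = S n" for n
  proof (induct n)
    case (Suc n)
    have "syzygy C P d (Suc n) = (P n)\<lparr>carrier := {x \<in> carrier (P n). d n x = \<zero>\<^bsub>syzygy C P d n\<^esub>}\<rparr>"
      using carrier_syzygy_Suc[of C P d n] by simp
    also have "\<dots> = nxt (S n)"
      unfolding Suc nxt_def P_def[symmetric] by (rule arg_cong[where f = "\<lambda>U. (P n)\<lparr>carrier := U\<rparr>"]) (auto simp: d_def)
    finally show ?case by (simp add: S_def)
  qed (simp add: S_def)
  have "F_projective_resolution \<Lambda> (all_ses \<Lambda>) C P d"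
  proof (rule resolutionI)
    show "projective \<Lambda> (P i)" for i using cov[OF S] by (simp add: P_def)
    show "ses \<Lambda> (syzygy C P d (Suc i)) (\<lambda>x. x) (P i) (d i) (syzygy C P d i)" for i
    proof -
      have "S (Suc i) = nxt (S i)" by (simp add: S_def)
      then have "ses \<Lambda> (S (Suc i)) (\<lambda>x. x) (P i) (cm (S i)) (S i)" using nxt[OF S[of i]] by (simp add: P_def)
      then show ?thesis unfolding syz by (rule ses_cong) (auto simp: d_def)
    qed
    show "d i \<in> extensional (carrier (P i))" for i by (simp add: d_def)
  qed
  then show thesis by (rule that)
qed

text \<open>Splices a presentation of \<open>C\<close> and a resolution of \<open>A\<close>. The
  first syzygy becomes the image of \<open>A\<close> in \<open>P0\<close>, a copy of
  \<open>A\<close>, so literal equality of syzygies starts at index 2. By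
  \<open>trivial_Hom_cohomology_iff\<close> this compares the degrees from 2 on; degree 1 is treated
  apart.\<close>

lemma resolution_cons:
  assumes s: "ses \<Lambda> A f P0 p C" and P0: "projective \<Lambda> P0"
    and res: "F_projective_resolution \<Lambda> (all_ses \<Lambda>) A Q e"
  obtains P d where "F_projective_resolution \<Lambda> (all_ses \<Lambda>) (C :: ('r, 'm) module) P d" "P 0 = P0"
    "\<And>x. x \<in> carrier P0 \<Longrightarrow> d 0 x = p x" "\<And>i. P (Suc i) = Q i" "\<And>i. syzygy C P d (Suc (Suc i)) = syzygy A Q e (Suc i)"
proof -
  note t = resolution_ses[OF res is_ses_class_simps(1)]
  define P where "P = case_nat P0 Q"
  define d where "d i = (case i of 0 \<Rightarrow> restrict p (carrier P0)
     | Suc j \<Rightarrow> (case j of 0 \<Rightarrow> compose (carrier (Q 0)) f (e 0) | Suc _ \<Rightarrow> e j))" for i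
  have P: "P 0 = P0" "P (Suc i) = Q i" for i by (simp_all add: P_def)
  have d: "d 0 = restrict p (carrier P0)" "d (Suc 0) = compose (carrier (Q 0)) f (e 0)" "d (Suc (Suc i)) = e (Suc i)" for i
    by (simp_all add: d_def)
  have t0: "lin \<Lambda> (Q 0) A (e 0)" using sesD(5)[OF t[of 0]] by simp
  note e0c = lin_closed[OF t0]
  interpret A: left_module \<Lambda> A by (rule sesD[OF s])
  have syz1: "syzygy C P d (Suc 0) = P0\<lparr>carrier := f ` carrier A\<rparr>"
  proof -
    have "carrier (syzygy C P d (Suc 0)) = f ` carrier A"
      unfolding carrier_syzygy_Suc P d syzygy.simps(1) sesD(7)[OF s] by auto
    then show ?thesis using P by simp
  qed
  have syz: "syzygy C P d (Suc (Suc i)) = syzygy A Q e (Suc i)" for i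
  proof (induct i)
    case 0
    have "{x \<in> carrier (Q 0). d (Suc 0) x = \<zero>\<^bsub>P0\<^esub>} = {x \<in> carrier (Q 0). e 0 x = \<zero>\<^bsub>A\<^esub>}"
    proof (rule Collect_cong, rule conj_cong[OF refl])
      fix x assume x: "x \<in> carrier (Q 0)"
      have "f (e 0 x) = \<zero>\<^bsub>P0\<^esub> \<longleftrightarrow> f (e 0 x) = f \<zero>\<^bsub>A\<^esub>" using ses_lin_zero(1)[OF s] by simp
      also have "\<dots> \<longleftrightarrow> e 0 x = \<zero>\<^bsub>A\<^esub>" using ses_inj[OF s _ e0c[OF x] A.M.zero_closed] by auto
      finally show "d (Suc 0) x = \<zero>\<^bsub>P0\<^esub> \<longleftrightarrow> e 0 x = \<zero>\<^bsub>A\<^esub>" using x by (simp add: d compose_def)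
    qed
    then have "carrier (syzygy C P d (Suc (Suc 0))) = carrier (syzygy A Q e (Suc 0))"
      unfolding carrier_syzygy_Suc[of C P d "Suc 0"] carrier_syzygy_Suc[of A Q e 0] syz1 P by simp
    then show ?case using P by simp
  next
    case (Suc i)
    have "carrier (syzygy C P d (Suc (Suc (Suc i)))) = carrier (syzygy A Q e (Suc (Suc i)))"
      unfolding carrier_syzygy_Suc[of C P d "Suc (Suc i)"] carrier_syzygy_Suc[of A Q e "Suc i"] Suc P d by simp
    then show ?case using P by simp
  qed
  have "F_projective_resolution \<Lambda> (all_ses \<Lambda>) C P d"
  proof (rule resolutionI)
    show "projective \<Lambda> (P i)" for i
      using P0 res by (cases i) (auto simp: P F_projective_resolution_def F_projective_all_ses)
    have f': "ses \<Lambda> (P0\<lparr>carrier := f ` carrier A\<rparr>) (\<lambda>x. x) P0 p C"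
      unfolding sesD(7)[OF s] by (rule kernel_ses[OF sesD(2,3,5,8)[OF s]])
    show "ses \<Lambda> (syzygy C P d (Suc i)) (\<lambda>x. x) (P i) (d i) (syzygy C P d i)" for i
    proof (cases i)
      case 0
      have "ses \<Lambda> (P0\<lparr>carrier := f ` carrier A\<rparr>) (\<lambda>x. x) P0 (d 0) C" by (rule ses_cong[OF f']) (auto simp: d)
      then show ?thesis unfolding 0 syz1 P syzygy.simps(1) .
    next
      case i: (Suc j)
      show ?thesis
      proof (cases j)
        case 0
        have "ses \<Lambda> (syzygy A Q e (Suc 0)) (\<lambda>x. x) (Q 0) (d (Suc 0)) (P0\<lparr>carrier := f ` carrier A\<rparr>)"
          unfolding ses_def
        proof (intro conjI)
          have "lin \<Lambda> (Q 0) (P0\<lparr>carrier := f ` carrier A\<rparr>) (\<lambda>x. f (e 0 x))"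
            using lin_comp[OF t0 sesD(4)[OF s]] e0c by (auto simp: lin_def)
          then show "lin \<Lambda> (Q 0) (P0\<lparr>carrier := f ` carrier A\<rparr>) (d (Suc 0))"
            by (rule lin_cong[OF _ sesD(10)[OF t[of 0]]]) (simp add: d compose_def)
          show "d (Suc 0) ` carrier (Q 0) = carrier (P0\<lparr>carrier := f ` carrier A\<rparr>)"
          proof -
            have "d (Suc 0) ` carrier (Q 0) = f ` (e 0 ` carrier (Q 0))" by (auto simp: d compose_def image_image)
            then show ?thesis using sesD(8)[OF t[of 0]] by simp
          qed
          show "(\<lambda>x. x) ` carrier (syzygy A Q e (Suc 0)) =
              {y \<in> carrier (Q 0). d (Suc 0) y = \<zero>\<^bsub>P0\<lparr>carrier := f ` carrier A\<rparr>\<^esub>}"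
            using carrier_syzygy_Suc[of C P d "Suc 0"] unfolding syz[of 0] syz1 P by simp
        qed (use sesD[OF t[of 0]] sesD[OF f'] in auto)
        then show ?thesis unfolding i 0 syz[of 0] syz1 P .
      next
        case (Suc k)
        show ?thesis using t[of "Suc k"] unfolding i Suc syz P d .
      qed
    qed
    show "d i \<in> extensional (carrier (P i))" for i
    proof (cases i)
      case 0 then show ?thesis by (simp add: d P)
    next
      case i: (Suc j)
      have "e j \<in> extensional (carrier (Q j))" for j
        using res by (auto simp: F_projective_resolution_def Hom_set_iff)
      then show ?thesis unfolding i by (cases j) (auto simp: d P compose_def)
    qed
  qed
  then show thesis using that P syz d(1) by simp
qed

text \<open>Every projective presentation is the start of a resolution, so vanishing for all
  resolutions gives vanishing for all presentations. Degree n + 2 of \<open>C\<close> is degree n +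
  1 of a syzygy.\<close>

lemma Ext_zero_imp_Ext_van:
  assumes Y: "Y \<in> mods"
  shows "C \<in> mods \<Longrightarrow> Ext_zero \<Lambda> (Suc n) C Y \<Longrightarrow> Ext_van n C Y"
proof (induct n arbitrary: C)
  case 0
  have "\<exists>e. lin \<Lambda> P0 Y e \<and> (\<forall>x\<in>carrier A. e (f x) = h x)"
    if P0: "projective \<Lambda> P0" and s: "ses \<Lambda> A f P0 p C" and h: "lin \<Lambda> A Y h" for A f P0 p h
  proof -
    obtain Q e where Q: "F_projective_resolution \<Lambda> (all_ses \<Lambda>) A Q e"
      by (rule resolution_exists[OF sesD(1)[OF s]])
    obtain P d where P: "F_projective_resolution \<Lambda> (all_ses \<Lambda>) C P d" "P 0 = P0"
      "\<And>x. x \<in> carrier P0 \<Longrightarrow> d 0 x = p x"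
      by (rule resolution_cons[OF s P0 Q]) blast
    let ?N = "syzygy C P d (Suc 0)"
    have N: "carrier ?N = {x \<in> carrier P0. p x = \<zero>\<^bsub>C\<^esub>}"
      using P(2,3) unfolding carrier_syzygy_Suc by auto
    have "ses \<Lambda> ?N (\<lambda>x. x) (P 0) (d 0) (syzygy C P d 0)" by (rule resolution_ses[OF P(1) is_ses_class_simps(1)])
    then have iN: "lin \<Lambda> ?N P0 (\<lambda>x. x)" using sesD(4) P(2) by metis
    \<comment> \<open>\<open>k\<close> inverts \<open>f\<close> on the literal kernel; it carries
      \<open>h\<close> over to the first syzygy of the resolution.\<close>
    obtain k where k: "lin \<Lambda> ?N A k" "\<And>x. x \<in> carrier ?N \<Longrightarrow> f (k x) = x"
      using lin_corestrict[OF s iN] N by auto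
    have "trivial_group (Hom_cohomology \<Lambda> P d Y (Suc 0))"
      using 0(2) P(1) by (auto simp: Ext_zero_def Ext_F_zero_def)
    then obtain e where e: "lin \<Lambda> P0 Y e" "\<And>x. x \<in> carrier ?N \<Longrightarrow> e x = h (k x)"
      using lin_comp[OF k(1) h] unfolding trivial_Hom_cohomology_iff[OF P(1) is_ses_class_simps(1) Y] P(2) by blast
    have "e (f x) = h x" if x: "x \<in> carrier A" for x
    proof -
      have fx: "f x \<in> carrier ?N" unfolding N using ses_closed(1)[OF s x] ses_comp_zero[OF s x] by simp
      have "k (f x) = x" using ses_inj[OF s k(2)[OF fx] lin_closed[OF k(1) fx] x] .
      then show ?thesis using e(2)[OF fx] by simp
    qed
    then show ?thesis using e(1) by blast
  qed
  then show ?case by auto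
next
  case (Suc n)
  have "Ext_van n A Y" if P0: "projective \<Lambda> P0" and s: "ses \<Lambda> A f P0 p C" for A f P0 p
  proof (rule Suc(1)[OF sesD(1)[OF s]])
    show "Ext_zero \<Lambda> (Suc n) A Y" unfolding Ext_zero_def Ext_F_zero_def
    proof (intro allI impI)
      fix Q e assume Q: "F_projective_resolution \<Lambda> (all_ses \<Lambda>) A Q e"
      obtain P d where P: "F_projective_resolution \<Lambda> (all_ses \<Lambda>) C P d" "\<And>i. P (Suc i) = Q i"
        "\<And>i. syzygy C P d (Suc (Suc i)) = syzygy A Q e (Suc i)"
        by (rule resolution_cons[OF s P0 Q]) blast
      have "trivial_group (Hom_cohomology \<Lambda> P d Y (Suc (Suc n)))"
        using Suc(3) P(1) by (auto simp: Ext_zero_def Ext_F_zero_def)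
      then show "trivial_group (Hom_cohomology \<Lambda> Q e Y (Suc n))"
        unfolding trivial_Hom_cohomology_iff[OF P(1) is_ses_class_simps(1) Y]
          trivial_Hom_cohomology_iff[OF Q is_ses_class_simps(1) Y] P(2,3) .
    qed
  qed
  then show ?case by auto
qed

lemma Ext_van_syzygy:
  assumes P: "\<And>i. projective \<Lambda> (P i)" and s: "\<And>i. ses \<Lambda> (S (Suc i)) (f i) (P i) (d i) (S i)"
  shows "Ext_van (i + n) (S j) Y \<Longrightarrow> Ext_van n (S (i + j)) Y"
proof (induct i arbitrary: j)
  case (Suc i)
  have "Ext_van (i + n) (S (Suc j)) Y" by (rule Ext_van_SucD[OF _ P s]) (use Suc(2) in simp)
  from Suc(1)[OF this] show ?case by simp
qed simp

lemma Ext_van_imp_Ext_zero: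
  assumes Y: "Y \<in> mods" and E: "Ext_van n C Y"
  shows "Ext_zero \<Lambda> (Suc n) C Y"
  unfolding Ext_zero_def Ext_F_zero_def
proof (intro allI impI)
  fix P d assume P: "F_projective_resolution \<Lambda> (all_ses \<Lambda>) C P d"
  have pr: "projective \<Lambda> (P i)" for i using P by (auto simp: F_projective_resolution_def F_projective_all_ses)
  note s = resolution_ses[OF P is_ses_class_simps(1)]
  have E0: "Ext_van 0 (syzygy C P d n) Y"
    using Ext_van_syzygy[of P "syzygy C P d" "\<lambda>_ x. x" d n 0 0 Y, OF pr s] E by simp
  show "trivial_group (Hom_cohomology \<Lambda> P d Y (Suc n))"
    unfolding trivial_Hom_cohomology_iff[OF P is_ses_class_simps(1) Y]
  proof (intro allI impI)
    fix h assume "lin \<Lambda> (syzygy C P d (Suc n)) Y h"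
    then obtain e where "lin \<Lambda> (P n) Y e" "\<And>x. x \<in> carrier (syzygy C P d (Suc n)) \<Longrightarrow> e x = h x"
      using Ext_van_0E[OF E0 pr s[of n]] by metis
    then show "\<exists>e. lin \<Lambda> (P n) Y e \<and> (\<forall>x\<in>carrier (syzygy C P d (Suc n)). e x = h x)" by blast
  qed
qed

lemma Ext_orthogonal_iff:
  assumes "C \<in> mods" "Y \<in> mods"
  shows "Ext_orthogonal \<Lambda> k C Y \<longleftrightarrow> (\<forall>n<k. Ext_van n C Y)"
proof
  assume "Ext_orthogonal \<Lambda> k C Y"
  then show "\<forall>n<k. Ext_van n C Y"
    using Ext_zero_imp_Ext_van[OF assms(2,1)] by (auto simp: Ext_orthogonal_def)
next
  assume E: "\<forall>n<k. Ext_van n C Y"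
  show "Ext_orthogonal \<Lambda> k C Y" unfolding Ext_orthogonal_def
  proof (intro allI impI)
    fix i assume "0 < i \<and> i \<le> k"
    then obtain n where "i = Suc n" "n < k" by (cases i) auto
    then show "Ext_zero \<Lambda> i C Y" using Ext_van_imp_Ext_zero[OF assms(2)] E by blast
  qed
qed

end

section \<open>Maximal orthogonal modules\<close>

context artin_modules begin

section \<open>Relative exactness as a lifting or extension property\<close>

lemma F_lowerI:
  assumes s: "ses \<Lambda> A f B g C" and M: "left_module \<Lambda> M"
    and ext: "f \<in> extensional (carrier A)" "g \<in> extensional (carrier B)"
    and lift: "\<And>h. lin \<Lambda> M C h \<Longrightarrow> \<exists>k. lin \<Lambda> M B k \<and> (\<forall>x\<in>carrier M. g (k x) = h x)"
  shows "F_lower \<Lambda> M A f B g C"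
  unfolding F_lower_def
proof (intro conjI subset_antisym subsetI)
  show "all_ses \<Lambda> A f B g C" by (rule ses_imp_all_ses[OF s ext])
  fix h assume "h \<in> compose (carrier M) g ` Hom_set \<Lambda> M B"
  then show "h \<in> Hom_set \<Lambda> M C" using compose_Hom_set[OF M _ sesD(5)[OF s]] by (auto simp: Hom_set_iff)
next
  fix h assume h: "h \<in> Hom_set \<Lambda> M C"
  then obtain k where k: "lin \<Lambda> M B k" "\<And>x. x \<in> carrier M \<Longrightarrow> g (k x) = h x"
    using lift[of h] by (auto simp: Hom_set_iff)
  have "h = compose (carrier M) g (restrict k (carrier M))"
    using h k by (intro extensionalityI[of _ "carrier M"]) (auto simp: compose_def Hom_set_iff)
  then show "h \<in> compose (carrier M) g ` Hom_set \<Lambda> M B" using restrict_Hom_set[OF k(1) M] by blast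
qed

lemma F_lowerD:
  assumes F: "F_lower \<Lambda> M A f B g C" and M: "left_module \<Lambda> M" and h: "lin \<Lambda> M C h"
  shows "\<exists>k. lin \<Lambda> M B k \<and> (\<forall>x\<in>carrier M. g (k x) = h x)"
proof -
  have "restrict h (carrier M) \<in> compose (carrier M) g ` Hom_set \<Lambda> M B"
    using F restrict_Hom_set[OF h M] by (simp add: F_lower_def)
  then obtain k where k: "k \<in> Hom_set \<Lambda> M B" "restrict h (carrier M) = compose (carrier M) g k" by blast
  have "g (k x) = h x" if "x \<in> carrier M" for x
    using fun_cong[OF k(2), of x] that by (simp add: compose_def)
  then show ?thesis using k(1) by (intro exI[of _ k]) (simp add: Hom_set_iff)
qed

lemma F_upperI:
  assumes s: "ses \<Lambda> A f B g C"
    and ext: "f \<in> extensional (carrier A)" "g \<in> extensional (carrier B)"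
    and lift: "\<And>h. lin \<Lambda> A M h \<Longrightarrow> \<exists>k. lin \<Lambda> B M k \<and> (\<forall>x\<in>carrier A. k (f x) = h x)"
  shows "F_upper \<Lambda> M A f B g C"
  unfolding F_upper_def
proof (intro conjI subset_antisym subsetI)
  show "all_ses \<Lambda> A f B g C" by (rule ses_imp_all_ses[OF s ext])
  fix h assume "h \<in> (\<lambda>h. compose (carrier A) h f) ` Hom_set \<Lambda> B M"
  then show "h \<in> Hom_set \<Lambda> A M" using compose_Hom_set[OF sesD(9,4)[OF s]] by (auto simp: Hom_set_iff)
next
  fix h assume h: "h \<in> Hom_set \<Lambda> A M"
  then obtain k where k: "lin \<Lambda> B M k" "\<And>x. x \<in> carrier A \<Longrightarrow> k (f x) = h x"
    using lift[of h] by (auto simp: Hom_set_iff)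
  have "h = compose (carrier A) (restrict k (carrier B)) f"
    using h k ses_closed(1)[OF s] by (intro extensionalityI[of _ "carrier A"]) (auto simp: compose_def Hom_set_iff)
  then show "h \<in> (\<lambda>h. compose (carrier A) h f) ` Hom_set \<Lambda> B M"
    using restrict_Hom_set[OF k(1) sesD(10)[OF s]] by blast
qed

lemma F_upperD:
  assumes F: "F_upper \<Lambda> M A f B g C" and h: "lin \<Lambda> A M h"
  shows "\<exists>k. lin \<Lambda> B M k \<and> (\<forall>x\<in>carrier A. k (f x) = h x)"
proof -
  have s: "ses \<Lambda> A f B g C" using F by (intro all_ses_imp_ses) (simp add: F_upper_def)
  have "restrict h (carrier A) \<in> (\<lambda>h. compose (carrier A) h f) ` Hom_set \<Lambda> B M"
    using F restrict_Hom_set[OF h sesD(9)[OF s]] by (simp add: F_upper_def)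
  then obtain k where k: "k \<in> Hom_set \<Lambda> B M" "restrict h (carrier A) = compose (carrier A) k f" by blast
  have "k (f x) = h x" if "x \<in> carrier A" for x
    using fun_cong[OF k(2), of x] that by (simp add: compose_def)
  then show ?thesis using k(1) by (intro exI[of _ k]) (simp add: Hom_set_iff)
qed

section \<open>Consequences of maximal orthogonality of one module\<close>

context
  fixes l :: nat and M :: "('r, 'm) module"
  assumes max: "maximal_orthogonal \<Lambda> l M"
begin

lemma maximal_orthogonal_mods: "M \<in> mods"
  using max by (simp add: maximal_orthogonal_def)

lemma maximal_orthogonal_rigid: "n < l \<Longrightarrow> Ext_van n M M"
  using max add_cat_self[OF maximal_orthogonal_mods] Ext_orthogonal_iff[OF maximal_orthogonal_mods maximal_orthogonal_mods]
  by (auto simp: maximal_orthogonal_def right_perp_def)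

lemma maximal_orthogonal_right:
  assumes "Y \<in> mods" "\<And>n. n < l \<Longrightarrow> Ext_van n M Y" shows "add_closure M Y"
proof -
  have "Y \<in> right_perp \<Lambda> l M"
    using assms Ext_orthogonal_iff[OF maximal_orthogonal_mods] by (simp add: right_perp_def)
  then show ?thesis
    using max add_cat_imp_add_closure[OF maximal_orthogonal_mods] by (simp add: maximal_orthogonal_def)
qed

lemma maximal_orthogonal_left:
  assumes "Y \<in> mods" "\<And>n. n < l \<Longrightarrow> Ext_van n Y M" shows "add_closure M Y"
proof -
  have "Y \<in> left_perp \<Lambda> l M"
    using assms Ext_orthogonal_iff[OF _ maximal_orthogonal_mods] by (simp add: left_perp_def)
  then show ?thesis
    using max add_cat_imp_add_closure[OF maximal_orthogonal_mods] by (simp add: maximal_orthogonal_def)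
qed

text \<open>Projective modules are left orthogonal to \<open>M\<close>, and the left orthogonal
  modules form add M. This is what makes right approximations surjective.\<close>

lemma projective_add_closure: "projective \<Lambda> P \<Longrightarrow> add_closure M P"
  by (rule maximal_orthogonal_left) (auto simp: projective_def[of \<Lambda> P] intro: Ext_van_projective)

text \<open>A projective module mapping onto \<open>V\<close> lies in add M, so the map factors
  through the approximation, which is therefore onto.\<close>

lemma right_approximation_ses:
  assumes V: "V \<in> mods"
  obtains A f Q p where "add_closure M Q" "ses \<Lambda> A f Q p V"
    "\<And>h. lin \<Lambda> M V h \<Longrightarrow> \<exists>k. lin \<Lambda> M Q k \<and> (\<forall>x\<in>carrier M. p (k x) = h x)"
proof -
  note Mm = maximal_orthogonal_mods
  obtain Q p where Q: "add_closure M Q" "lin \<Lambda> Q V p"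
    "\<And>h. lin \<Lambda> M V h \<Longrightarrow> \<exists>k. lin \<Lambda> M Q k \<and> (\<forall>x\<in>carrier M. p (k x) = h x)"
    by (rule right_approximation[OF Mm V]) blast
  have Qm: "Q \<in> mods" by (rule add_closure_mods[OF Q(1) Mm])
  obtain A f P c where P: "projective \<Lambda> P" "ses \<Lambda> A f P c V" by (rule enough_projectives[OF V])
  obtain k where k: "lin \<Lambda> P Q k" "\<And>x. x \<in> carrier P \<Longrightarrow> p (k x) = c x"
    using add_closure_lift[OF projective_add_closure[OF P(1)] Mm Qm V Q(2,3) sesD(5)[OF P(2)]] by blast
  have "p ` carrier Q = carrier V"
  proof (intro subset_antisym subsetI)
    fix v assume "v \<in> carrier V"
    then obtain x where x: "x \<in> carrier P" "c x = v" by (rule ses_surjE[OF P(2)])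
    then show "v \<in> p ` carrier Q" using k(2)[OF x(1)] lin_closed[OF k(1) x(1)] by (metis imageI)
  qed (use lin_closed[OF Q(2)] in blast)
  from kernel_ses[OF Qm V Q(2) this] Q show thesis using that by blast
qed

text \<open>A right approximation of \<open>P\<close> gives an F_M-exact sequence ending in
  \<open>P\<close>. It splits by relative projectivity, so \<open>P\<close> is a summand of a module
  in add M.\<close>

lemma F_lower_projective_add_closure:
  assumes P: "F_projective \<Lambda> (F_lower \<Lambda> M) P"
  shows "add_closure M P"
proof -
  have Pm: "P \<in> mods" using P by (simp add: F_projective_def)
  obtain A f Q p where Q: "add_closure M Q" "ses \<Lambda> A f Q p P"
    "\<And>h. lin \<Lambda> M P h \<Longrightarrow> \<exists>k. lin \<Lambda> M Q k \<and> (\<forall>x\<in>carrier M. p (k x) = h x)"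
    by (rule right_approximation_ses[OF Pm]) blast
  have "F_lower \<Lambda> M A (restrict f (carrier A)) Q (restrict p (carrier Q)) P"
  proof (rule F_lowerI)
    show "ses \<Lambda> A (restrict f (carrier A)) Q (restrict p (carrier Q)) P" by (rule ses_cong[OF Q(2)]) auto
    fix h assume "lin \<Lambda> M P h"
    then obtain k where k: "lin \<Lambda> M Q k" "\<forall>x\<in>carrier M. p (k x) = h x" using Q(3) by blast
    then show "\<exists>k. lin \<Lambda> M Q k \<and> (\<forall>x\<in>carrier M. restrict p (carrier Q) (k x) = h x)"
      using lin_closed[OF k(1)] by (intro exI[of _ k]) simp
  qed (use maximal_orthogonal_mods mod_catD in auto)
  then obtain s where s: "lin \<Lambda> P Q s" "\<And>x. x \<in> carrier P \<Longrightarrow> restrict p (carrier Q) (s x) = x"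
    using F_projective_lift[where F = "F_lower \<Lambda> M", OF P _ lin_id] by metis
  have "p (s x) = x" if "x \<in> carrier P" for x using s(2)[OF that] lin_closed[OF s(1) that] by simp
  then have "retract P Q" unfolding retract_def using Pm sesD(2,5)[OF Q(2)] s(1) by blast
  then show ?thesis by (rule add_closure.retract[OF Q(1)])
qed

text \<open>M cogenerates every module. This would also follow from the existence of injective
  modules in add M. Instead, the modules Ext of degrees l, ..., 1 from M are killed one after the
  other by universal extensions by syzygies of M. This terminates because Ext from M to its i-th
  syzygy vanishes in the degrees i + 1, ..., l.\<close>

lemma embedding_into_add_closure:
  assumes V: "V \<in> mods"
  obtains Y u where "add_closure M Y" "lin \<Lambda> V Y u" "inj_on u (carrier V)"
proof -
  note Mm = maximal_orthogonal_mods
  obtain P d where res: "F_projective_resolution \<Lambda> (all_ses \<Lambda>) M P d" by (rule resolution_exists[OF Mm])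
  define S where "S = syzygy M P d"
  have s: "ses \<Lambda> (S (Suc i)) (\<lambda>x. x) (P i) (d i) (S i)" for i
    unfolding S_def by (rule resolution_ses[OF res is_ses_class_simps(1)])
  have pr: "projective \<Lambda> (P i)" for i using res by (auto simp: F_projective_resolution_def F_projective_all_ses)
  have Sm: "S i \<in> mods" for i by (rule sesD(3)[OF s])
  \<comment> \<open>Indices i \<le> n < l are the degrees i + 1 to l. Rigidity is the case i = 0,
    and each passage through a projective term, which lies in add M, raises the lower bound by
    one.\<close>
  have MS: "Ext_van n M (S i)" if "i \<le> n" "n < l" for n i
    using that
  proof (induct i arbitrary: n)
    case 0
    then show ?case using maximal_orthogonal_rigid by (simp add: S_def)
  next
    case (Suc i)
    then obtain m where m: "n = Suc m" "i \<le> m" by (cases n) auto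
    have "Ext_van (Suc m) M (P i)"
      using Ext_van_add_closure_right[OF projective_add_closure[OF pr] Mm maximal_orthogonal_rigid] Suc(3) m by blast
    then show ?case unfolding m(1) using Suc m by (intro Ext_van_left_right[OF s]) auto
  qed
  \<comment> \<open>For n = 0, vanishing of Ext^1(S i,-) becomes vanishing of Ext^(i+1)(M,-); this
    is why the universal extensions are taken with syzygies of \<open>M\<close>.\<close>
  have up: "Ext_van n (S i) Y \<Longrightarrow> Ext_van (n + i) M Y" if "Y \<in> mods" for n i Y
  proof (induct i arbitrary: n)
    case 0 then show ?case by (simp add: S_def)
  next
    case (Suc i)
    have "Ext_van (Suc n) (S i) Y"
      by (rule Ext_van_right_left[OF s that Suc(2) Ext_van_projective[OF pr]])
    from Suc(1)[OF this] show ?case by simp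
  qed
  have "\<exists>Y u. Y \<in> mods \<and> lin \<Lambda> V Y u \<and> inj_on u (carrier V) \<and> (\<forall>n. l - t \<le> n \<and> n < l \<longrightarrow> Ext_van n M Y)"
    if "t \<le> l" for t using that
  proof (induct t)
    case 0
    show ?case using V lin_id by (intro exI[of _ V] exI[of _ "\<lambda>x. x"]) (auto simp: inj_on_def)
  next
    case (Suc t)
    then have "\<exists>Y u. Y \<in> mods \<and> lin \<Lambda> V Y u \<and> inj_on u (carrier V) \<and> (\<forall>n. l - t \<le> n \<and> n < l \<longrightarrow> Ext_van n M Y)"
      by simp
    then obtain Y u where Y: "Y \<in> mods" "lin \<Lambda> V Y u" "inj_on u (carrier V)"
      "\<And>n. l - t \<le> n \<Longrightarrow> n < l \<Longrightarrow> Ext_van n M Y" by blast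
    \<comment> \<open>The index killed in this round. The order is downward because
      \<open>MS\<close> ensures that extensions by copies of \<open>S j\<close> keep the vanishing
      already reached for indices above \<open>j\<close>.\<close>
    define j where "j = l - Suc t"
    have j: "j < l" "l - t = Suc j" using Suc(2) by (auto simp: j_def)
    \<comment> \<open>Ext^1(S j, S j) is Ext^(j+1)(M, S j), which vanishes by \<open>MS\<close> with
      n = i = j.\<close>
    have "Ext_van 0 (S (j + 0)) (S j)"
      by (rule Ext_van_syzygy[of P S "\<lambda>_ x. x" d, OF pr s]) (use MS[of j j] j in \<open>simp add: S_def\<close>)
    then have SS: "Ext_van 0 (S j) (S j)" by simp
    obtain Y' v where Y': "Y' \<in> mods" "lin \<Lambda> Y Y' v" "inj_on v (carrier Y)" "Ext_van 0 (S j) Y'"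
      "\<And>n V. Ext_van n V Y \<Longrightarrow> Ext_van n V (S j) \<Longrightarrow> Ext_van n V Y'"
      by (rule universal_extension[OF Sm Y(1) SS]) blast
    have "Ext_van n M Y'" if n: "l - Suc t \<le> n" "n < l" for n
    proof (cases "n = j")
      case True
      then show ?thesis using up[OF Y'(1,4)] by simp
    next
      case False
      then have "Suc j \<le> n" using n(1) by (simp add: j_def)
      then show ?thesis using Y'(5)[OF Y(4) MS] n(2) j by simp
    qed
    moreover have "inj_on (\<lambda>x. v (u x)) (carrier V)"
      using Y(3) Y'(3) lin_closed[OF Y(2)] by (auto simp: inj_on_def)
    ultimately show ?case using Y'(1) lin_comp[OF Y(2) Y'(2)] by blast
  qed
  from this[of l] obtain Y u where Y: "Y \<in> mods" "lin \<Lambda> V Y u" "inj_on u (carrier V)"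
    "\<And>n. n < l \<Longrightarrow> Ext_van n M Y" by auto
  show thesis by (rule that[OF maximal_orthogonal_right[OF Y(1,4)] Y(2,3)])
qed

text \<open>An embedding of \<open>V\<close> into a module of add M factors through the left
  approximation, which is therefore injective.\<close>

lemma left_approximation_ses:
  assumes V: "V \<in> mods"
  obtains Q u C g where "add_closure M Q" "ses \<Lambda> V u Q g C"
    "\<And>h. lin \<Lambda> V M h \<Longrightarrow> \<exists>k. lin \<Lambda> Q M k \<and> (\<forall>x\<in>carrier V. k (u x) = h x)"
proof -
  note Mm = maximal_orthogonal_mods
  obtain Q u where Q: "add_closure M Q" "lin \<Lambda> V Q u"
    "\<And>h. lin \<Lambda> V M h \<Longrightarrow> \<exists>k. lin \<Lambda> Q M k \<and> (\<forall>x\<in>carrier V. k (u x) = h x)"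
    by (rule left_approximation[OF Mm V]) blast
  have Qm: "Q \<in> mods" by (rule add_closure_mods[OF Q(1) Mm])
  obtain Y v where Y: "add_closure M Y" "lin \<Lambda> V Y v" "inj_on v (carrier V)"
    by (rule embedding_into_add_closure[OF V])
  obtain k where k: "\<forall>x\<in>carrier V. k (u x) = v x"
    using add_closure_extend[OF Y(1) Mm Q(2,3) Y(2)] by blast
  have "inj_on u (carrier V)"
  proof (rule inj_onI)
    fix x y assume "x \<in> carrier V" "y \<in> carrier V" "u x = u y"
    then show "x = y" using k Y(3) by (metis inj_onD)
  qed
  then obtain C g where "ses \<Lambda> V u Q g C" using cokernel_ses[OF V Qm Q(2)] by blast
  then show thesis using that Q by blast
qed

end

text \<open>Dimension shift in the second variable for a relative resolution: the two hypotheses on the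
  sequence from A to C say that it is F-exact and that B is F-injective.\<close>

lemma relative_dimension_shift:
  assumes res: "F_projective_resolution \<Lambda> F U P d" and F: "is_ses_class \<Lambda> F"
    and s: "ses \<Lambda> A f B g C"
    and Fs: "F A (restrict f (carrier A)) B (restrict g (carrier B)) C"
    and inj: "\<And>h. lin \<Lambda> (syzygy U P d (Suc (Suc i))) B h \<Longrightarrow>
      \<exists>e. lin \<Lambda> (P (Suc i)) B e \<and> (\<forall>x\<in>carrier (syzygy U P d (Suc (Suc i))). e x = h x)"
    and ext: "\<And>h. lin \<Lambda> (syzygy U P d (Suc i)) C h \<Longrightarrow>
      \<exists>e. lin \<Lambda> (P i) C e \<and> (\<forall>x\<in>carrier (syzygy U P d (Suc i)). e x = h x)"
    and h: "lin \<Lambda> (syzygy U P d (Suc (Suc i))) A h"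
  shows "\<exists>e. lin \<Lambda> (P (Suc i)) A e \<and> (\<forall>x\<in>carrier (syzygy U P d (Suc (Suc i))). e x = h x)"
proof -
  note t0 = resolution_ses[OF res F, of i] and t1 = resolution_ses[OF res F, of "Suc i"]
  let ?X1 = "syzygy U P d (Suc i)" and ?X2 = "syzygy U P d (Suc (Suc i))"
  interpret B: left_module \<Lambda> B by (rule sesD[OF s])
  interpret C: left_module \<Lambda> C by (rule sesD[OF s])
  obtain e where e: "lin \<Lambda> (P (Suc i)) B e" "\<And>x. x \<in> carrier ?X2 \<Longrightarrow> e x = f (h x)"
    using inj[OF lin_comp[OF h sesD(4)[OF s]]] by blast
  have e0: "g (e x) = \<zero>\<^bsub>C\<^esub>" if "x \<in> carrier ?X2" for x
    using e(2)[OF that] ses_comp_zero[OF s lin_closed[OF h that]] by simp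
  \<comment> \<open>g e vanishes on ?X2 and descends to ?X1. Its extension to P i lifts to
    \<open>B\<close> because P i is F-projective; this is where the F-exactness of the sequence from
    \<open>A\<close> to \<open>C\<close> enters.\<close>
  obtain l where l: "lin \<Lambda> ?X1 C l" "\<And>x. x \<in> carrier (P (Suc i)) \<Longrightarrow> l (d (Suc i) x) = g (e x)"
    using lin_factor[OF t1 lin_comp[OF e(1) sesD(5)[OF s]] C.left_module_axioms e0] by blast
  obtain t where t: "lin \<Lambda> (P i) C t" "\<And>x. x \<in> carrier ?X1 \<Longrightarrow> t x = l x" using ext[OF l(1)] by blast
  have "F_projective \<Lambda> F (P i)" using res by (simp add: F_projective_resolution_def)
  then obtain k where k: "lin \<Lambda> (P i) B k" "\<And>x. x \<in> carrier (P i) \<Longrightarrow> restrict g (carrier B) (k x) = t x"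
    using F_projective_lift[where F = F, OF _ Fs t(1)] by metis
  have gk: "g (k x) = t x" if "x \<in> carrier (P i)" for x using k(2)[OF that] lin_closed[OF k(1) that] by simp
  have kd: "lin \<Lambda> (P (Suc i)) B (\<lambda>x. k (d (Suc i) x))"
    using lin_comp[OF lin_comp[OF sesD(5)[OF t1] sesD(4)[OF t0]] k(1)] by simp
  have m: "lin \<Lambda> (P (Suc i)) B (\<lambda>x. e x \<ominus>\<^bsub>B\<^esub> k (d (Suc i) x))"
    by (intro lin_diff B.left_module_axioms e(1) kd)
  have m0: "g (e x \<ominus>\<^bsub>B\<^esub> k (d (Suc i) x)) = \<zero>\<^bsub>C\<^esub>" if x: "x \<in> carrier (P (Suc i))" for x
  proof -
    have dx: "d (Suc i) x \<in> carrier ?X1" by (rule ses_closed(2)[OF t1 x])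
    have "g (e x) = g (k (d (Suc i) x))"
      using l(2)[OF x] t(2)[OF dx] gk[OF ses_closed(1)[OF t0 dx]] by simp
    then show ?thesis using lin_closed[OF e(1) x] lin_closed[OF kd x] ses_closed(2)[OF s]
      by (simp add: lin_minus[OF sesD(10,11,5)[OF s]] C.diff_eq_zero_iff)
  qed
  obtain q where q: "lin \<Lambda> (P (Suc i)) A q" "\<And>x. x \<in> carrier (P (Suc i)) \<Longrightarrow> f (q x) = e x \<ominus>\<^bsub>B\<^esub> k (d (Suc i) x)"
    using lin_corestrict[OF s m m0] by blast
  have "q x = h x" if x: "x \<in> carrier ?X2" for x
  proof (rule ses_inj[OF s])
    note xP = ses_closed(1)[OF t1 x]
    have "k (d (Suc i) x) = \<zero>\<^bsub>B\<^esub>"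
      using ses_comp_zero[OF t1 x] lin_zero[OF sesD(10)[OF t0] B.left_module_axioms k(1)] by simp
    then show "f (q x) = f (h x)"
      using q(2)[OF xP] e(2)[OF x] ses_closed(1)[OF s lin_closed[OF h x]] by simp
    show "q x \<in> carrier A" by (rule lin_closed[OF q(1) xP])
    show "h x \<in> carrier A" by (rule lin_closed[OF h x])
  qed
  then show ?thesis using q(1) by blast
qed

section \<open>The proof of (a) and (b)\<close>

context
  fixes k l :: nat and M1 M2 :: "('r, 'm) module"
  assumes max1: "maximal_orthogonal \<Lambda> l M1" and max2: "maximal_orthogonal \<Lambda> l M2"
    and k: "0 < k" "k \<le> l" "l \<le> 2 * k + 1" and orth: "Ext_orthogonal \<Lambda> k M2 M1"
begin

lemma M1: "M1 \<in> mods" and M2: "M2 \<in> mods"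
  by (rule maximal_orthogonal_mods[OF max1], rule maximal_orthogonal_mods[OF max2])

lemma Ext_M2_M1: "n < k \<Longrightarrow> Ext_van n M2 M1"
  using orth Ext_orthogonal_iff[OF M2 M1] by simp

lemma Ext_F_lower_zero:
  assumes i: "i < l" shows "Ext_F_zero \<Lambda> (F_lower \<Lambda> M2) (Suc i) M1 M1"
  unfolding Ext_F_zero_def
proof (intro allI impI)
  fix P d assume res: "F_projective_resolution \<Lambda> (F_lower \<Lambda> M2) M1 P d"
  let ?S = "syzygy M1 P d"
  note s = resolution_ses[OF res is_ses_class_simps(2)]
  have P: "add_closure M2 (P j)" for j
    using res F_lower_projective_add_closure[OF max2] by (simp add: F_projective_resolution_def)
  \<comment> \<open>\<open>Ext_van n\<close> is degree n + 1, hence the strict bounds. Each sequence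
    raises the degree by one; degree 1 of the next syzygy has no predecessor and comes from the
    F_{M_2}-exactness of the resolution.\<close>
  have A1: "Ext_van n M2 (?S j)" if "n < l" "n < k + j" for n j
    using that
  proof (induct j arbitrary: n)
    case 0
    then show ?case using Ext_M2_M1 by simp
  next
    case (Suc j)
    have EP: "Ext_van n M2 (P j)"
      by (rule Ext_van_add_closure_right[OF P M2 maximal_orthogonal_rigid[OF max2 Suc(2)]])
    show ?case
    proof (cases n)
      case 0
      have "Ext_van 0 M2 (P j)" using EP 0 by simp
      then show ?thesis unfolding 0
        by (rule Ext_van_left_right_0[OF s M2])
          (rule F_lowerD[OF resolution_ses_class[OF res] mod_catD[OF M2]])
    next
      case (Suc m)
      have "Ext_van m M2 (?S j)" using Suc.hyps Suc.prems Suc by simp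
      then show ?thesis unfolding Suc by (rule Ext_van_left_right[OF s]) (use EP Suc in simp)
    qed
  qed
  \<comment> \<open>The terms P j lie in add M2, so M2 \<perp> M1 controls them for n < k. The start
    j = 0 is the rigidity of \<open>M1\<close>, so the sum of the indices may reach
    \<open>k\<close>, one more than orthogonality by itself would give.\<close>
  have A2: "Ext_van n (?S j) M1" if "n + j < l" "n + j \<le> k" for n j
    using that
  proof (induct j arbitrary: n)
    case 0
    then show ?case using maximal_orthogonal_rigid[OF max1] by simp
  next
    case (Suc j)
    have "Ext_van n (P j) M1"
      by (rule Ext_van_add_closure_left[OF P M2 M1 Ext_M2_M1]) (use Suc(3) in simp)
    moreover have "Ext_van (Suc n) (?S j) M1" by (rule Suc(1)) (use Suc(2,3) in auto)
    ultimately show ?case by (rule Ext_van_left_left[OF s M1])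
  qed
  show "trivial_group (Hom_cohomology \<Lambda> P d M1 (Suc i))"
    unfolding trivial_Hom_cohomology_iff[OF res is_ses_class_simps(2) M1]
  proof (intro allI impI)
    fix h assume h: "lin \<Lambda> (?S (Suc i)) M1 h"
    show "\<exists>e. lin \<Lambda> (P i) M1 e \<and> (\<forall>x\<in>carrier (?S (Suc i)). e x = h x)"
    \<comment> \<open>The degree is i + 1, so the first case consists of the degrees up to k +
      1.\<close>
    proof (cases "i \<le> k")
      case True
      then have "Ext_van 0 (?S i) M1" using A2[of 0 i] i by simp
      from Ext_van_0_extend[OF this M1 s h] show ?thesis by metis
    next
      case False
      have "Ext_van n M2 (?S i)" if "n < l" for n using A1[OF that, of i] False that k(3) by simp
      then have "add_closure M2 (?S i)" by (rule maximal_orthogonal_right[OF max2 sesD(3)[OF s]])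
      \<comment> \<open>The identity of the syzygy lifts along d i, since the syzygy is in add M2
        and the sequence is F_{M_2}-exact. The resulting retraction of P i onto the next syzygy
        extends \<open>h\<close>.\<close>
      then obtain t where t: "lin \<Lambda> (?S i) (P i) t" "\<And>x. x \<in> carrier (?S i) \<Longrightarrow> d i (t x) = x"
        using add_closure_lift[OF _ M2 sesD(2,3,5)[OF s] F_lowerD[OF resolution_ses_class[OF res] mod_catD[OF M2]] lin_id]
        by metis
      obtain r where "biprod \<Lambda> (?S (Suc i)) (?S i) (P i) (\<lambda>x. x) t r (d i)"
        using ses_split[OF s t] by blast
      then have r: "lin \<Lambda> (P i) (?S (Suc i)) r" "\<And>x. x \<in> carrier (?S (Suc i)) \<Longrightarrow> r x = x"
        unfolding biprod_def by blast+
      then show ?thesis using lin_comp[OF r(1) h] by (intro exI[of _ "\<lambda>x. h (r x)"]) simp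
    qed
  qed
qed

text \<open>The cosyzygies \<open>C j\<close> arise by iterating cokernels of left approximations;
  the last conclusion is the F^{M_1}-exactness of the coresolution.\<close>

lemma coresolution_exists:
  obtains C I u q where "C 0 = M2" "\<And>j. add_closure M1 (I j)" "\<And>j. ses \<Lambda> (C j) (u j) (I j) (q j) (C (Suc j))"
    "\<And>j h. lin \<Lambda> (C j) M1 h \<Longrightarrow> \<exists>e. lin \<Lambda> (I j) M1 e \<and> (\<forall>x\<in>carrier (C j). e (u j x) = h x)"
proof -
  have "\<exists>Q u C g. add_closure M1 Q \<and> ses \<Lambda> V u Q g C \<and>
      (\<forall>h. lin \<Lambda> V M1 h \<longrightarrow> (\<exists>e. lin \<Lambda> Q M1 e \<and> (\<forall>x\<in>carrier V. e (u x) = h x)))" if V: "V \<in> mods" for V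
    using left_approximation_ses[OF max1 V] by metis
  then obtain Q u C g where Q: "\<And>V. V \<in> mods \<Longrightarrow> add_closure M1 (Q V) \<and> ses \<Lambda> V (u V) (Q V) (g V) (C V) \<and>
      (\<forall>h. lin \<Lambda> V M1 h \<longrightarrow> (\<exists>e. lin \<Lambda> (Q V) M1 e \<and> (\<forall>x\<in>carrier V. e (u V x) = h x)))"
    by metis
  define D where "D n = (C ^^ n) M2" for n
  have D: "D n \<in> mods" for n
  proof (induct n)
    case (Suc n)
    then have "ses \<Lambda> (D n) (u (D n)) (Q (D n)) (g (D n)) (C (D n))" using Q by blast
    then show ?case using sesD(3) by (auto simp: D_def)
  qed (simp add: D_def M2)
  show thesis
  proof (rule that[of D "\<lambda>j. Q (D j)" "\<lambda>j. u (D j)" "\<lambda>j. g (D j)"])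
    show "ses \<Lambda> (D j) (u (D j)) (Q (D j)) (g (D j)) (D (Suc j))" for j
      using Q[OF D[of j]] by (simp add: D_def)
  qed (use Q D in \<open>auto simp: D_def\<close>)
qed

text \<open>The extension problem for maps from syzygy i + 1 to C 0 = M2 is moved along a diagonal,
  one syzygy down for one cosyzygy up, to maps from syzygy 1 to C i. There it is settled by
  Ext^1(M2, C i) = 0 or by the membership of C i in add M1.\<close>

lemma Ext_F_upper_zero:
  assumes i: "i < l" shows "Ext_F_zero \<Lambda> (F_upper \<Lambda> M1) (Suc i) M2 M2"
  unfolding Ext_F_zero_def
proof (intro allI impI)
  fix P d assume res: "F_projective_resolution \<Lambda> (F_upper \<Lambda> M1) M2 P d"
  let ?S = "syzygy M2 P d"
  note s = resolution_ses[OF res is_ses_class_simps(3)]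
  obtain C I u q where C0: "C 0 = M2" and I: "\<And>j. add_closure M1 (I j)"
    and c: "\<And>j. ses \<Lambda> (C j) (u j) (I j) (q j) (C (Suc j))"
    and ext: "\<And>j h. lin \<Lambda> (C j) M1 h \<Longrightarrow> \<exists>e. lin \<Lambda> (I j) M1 e \<and> (\<forall>x\<in>carrier (C j). e (u j x) = h x)"
    by (rule coresolution_exists) blast
  \<comment> \<open>The mirror image of \<open>A1\<close> in the proof of (a): degree 1 comes from
    the extension of maps C j \<rightarrow> M1 to I j, higher degrees from the preceding
    cosyzygy.\<close>
  have B1: "Ext_van n (C j) M1" if "n < l" "n < k + j" for n j
    using that
  proof (induct j arbitrary: n)
    case 0
    then show ?case using Ext_M2_M1 C0 by simp
  next
    case (Suc j)
    have EI: "Ext_van n (I j) M1"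
      by (rule Ext_van_add_closure_left[OF I M1 M1 maximal_orthogonal_rigid[OF max1 Suc(2)]])
    show ?case
    proof (cases n)
      case 0
      have "Ext_van 0 (I j) M1" using EI 0 by simp
      then show ?thesis unfolding 0 by (rule Ext_van_right_left_0[OF c M1]) (rule ext)
    next
      case (Suc m)
      have "Ext_van m (C j) M1" using Suc.hyps Suc.prems Suc by simp
      then show ?thesis unfolding Suc by (rule Ext_van_right_left[OF c M1]) (use EI Suc in simp)
    qed
  qed
  have B2: "Ext_van n M2 (C j)" if "n + j < l" "n + j \<le> k" for n j
    using that
  proof (induct j arbitrary: n)
    case 0
    then show ?case using maximal_orthogonal_rigid[OF max2] C0 by simp
  next
    case (Suc j)
    have "Ext_van n M2 (I j)"
      by (rule Ext_van_add_closure_right[OF I M1 Ext_M2_M1]) (use Suc(3) in simp)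
    moreover have "Ext_van (Suc n) M2 (C j)" by (rule Suc(1)) (use Suc(2,3) in auto)
    ultimately show ?case by (rule Ext_van_right_right[OF c])
  qed
  \<comment> \<open>Modules in add M1 behave as F^{M_1}-injectives: the resolution is F^{M_1}-exact,
    so maps from its syzygies to \<open>M1\<close>, and then to all of add M1, extend to its
    terms.\<close>
  have extend: "\<exists>e. lin \<Lambda> (P j) W e \<and> (\<forall>x\<in>carrier (?S (Suc j)). e x = h x)"
    if W: "add_closure M1 W" and h: "lin \<Lambda> (?S (Suc j)) W h" for j W h
  proof (rule add_closure_extend[OF W M1 sesD(4)[OF s] _ h])
    fix h' assume "lin \<Lambda> (?S (Suc j)) M1 h'"
    from F_upperD[OF resolution_ses_class[OF res, of j] this]
    show "\<exists>e. lin \<Lambda> (P j) M1 e \<and> (\<forall>x\<in>carrier (?S (Suc j)). e x = h' x)" by auto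
  qed
  have Fc: "F_upper \<Lambda> M1 (C j) (restrict (u j) (carrier (C j))) (I j) (restrict (q j) (carrier (I j))) (C (Suc j))" for j
  proof (rule F_upperI)
    show "ses \<Lambda> (C j) (restrict (u j) (carrier (C j))) (I j) (restrict (q j) (carrier (I j))) (C (Suc j))"
      by (rule ses_cong[OF c]) auto
    fix h assume "lin \<Lambda> (C j) M1 h"
    from ext[OF this] show "\<exists>k. lin \<Lambda> (I j) M1 k \<and> (\<forall>x\<in>carrier (C j). k (restrict (u j) (carrier (C j)) x) = h x)"
      by auto
  qed auto
  \<comment> \<open>\<open>?EP i j\<close> expresses that Ext^(i+1)(M2, C j) relative to F^{M_1},
    computed with the given resolution, vanishes.\<close>
  let ?EP = "\<lambda>i j. \<forall>h. lin \<Lambda> (?S (Suc i)) (C j) h \<longrightarrow> (\<exists>e. lin \<Lambda> (P i) (C j) e \<and> (\<forall>x\<in>carrier (?S (Suc i)). e x = h x))"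
  have shift: "?EP 0 (i + j) \<Longrightarrow> ?EP i j" for i j
  proof (induct i arbitrary: j)
    case (Suc i)
    then have IH: "?EP i (Suc j)" by simp
    show ?case
    proof (intro allI impI)
      fix h assume h: "lin \<Lambda> (?S (Suc (Suc i))) (C j) h"
      show "\<exists>e. lin \<Lambda> (P (Suc i)) (C j) e \<and> (\<forall>x\<in>carrier (?S (Suc (Suc i))). e x = h x)"
        by (rule relative_dimension_shift[OF res is_ses_class_simps(3) c Fc extend[OF I] IH[rule_format] h])
    qed
  qed simp
  have "?EP 0 i"
  proof (intro allI impI)
    fix h assume h: "lin \<Lambda> (?S (Suc 0)) (C i) h"
    show "\<exists>e. lin \<Lambda> (P 0) (C i) e \<and> (\<forall>x\<in>carrier (?S (Suc 0)). e x = h x)"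
    proof (cases "i \<le> k")
      case True
      then have "Ext_van 0 (?S 0) (C i)" using B2[of 0 i] i by simp
      from Ext_van_0_extend[OF this sesD(1)[OF c] s h] show ?thesis by metis
    next
      case False
      have "Ext_van n (C i) M1" if "n < l" for n using B1[OF that, of i] False that k(3) by simp
      then have "add_closure M1 (C i)" by (rule maximal_orthogonal_left[OF max1 sesD(1)[OF c]])
      then show ?thesis using h by (rule extend)
    qed
  qed
  then have "?EP i 0" using shift[of i 0] by simp
  then show "trivial_group (Hom_cohomology \<Lambda> P d M2 (Suc i))"
    unfolding trivial_Hom_cohomology_iff[OF res is_ses_class_simps(3) M2] C0 .
qed

end

end

theorem proposition2p8:
  fixes K :: "('k, 'a) ring_scheme" and \<phi> :: "'k \<Rightarrow> 'r"
    and \<Lambda> :: "('r, 'b) ring_scheme"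
    and M1 M2 :: "('r, 'm) module"
    and k l :: nat
  assumes "artin_algebra K \<phi> \<Lambda>"
    and "infinite (UNIV :: 'm set)" and "carrier \<Lambda> \<lesssim> (UNIV :: 'm set)"
    and "maximal_orthogonal \<Lambda> l M1" and "maximal_orthogonal \<Lambda> l M2"
    and "0 < k" and "k \<le> l" and "l \<le> 2 * k + 1"
    and "Ext_orthogonal \<Lambda> k M2 M1"
  shows "(\<forall>i. 0 < i \<and> i \<le> l \<longrightarrow> Ext_F_zero \<Lambda> (F_lower \<Lambda> M2) i M1 M1) \<and>
         (\<forall>i. 0 < i \<and> i \<le> l \<longrightarrow> Ext_F_zero \<Lambda> (F_upper \<Lambda> M1) i M2 M2)"
proof -
  interpret artin_modules K \<phi> \<Lambda> "TYPE('m)"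
    using assms(1-3) by (intro artin_modules.intro artin_setup.intro artin_modules_axioms.intro)
  have "Ext_F_zero \<Lambda> (F_lower \<Lambda> M2) i M1 M1 \<and> Ext_F_zero \<Lambda> (F_upper \<Lambda> M1) i M2 M2"
    if i: "0 < i" "i \<le> l" for i
  proof -
    obtain j where j: "i = Suc j" "j < l" using i by (cases i) auto
    show ?thesis unfolding j(1)
      using Ext_F_lower_zero[OF assms(4-9) j(2)] Ext_F_upper_zero[OF assms(4-9) j(2)] by blast
  qed
  then show ?thesis by blast
qed

end
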